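(* Let a compact Lie group $G$ act continuously on a nonempty finite set $\bar{\mathbf{x}}$, and let $F$ be a $G$-equivariant topological complex vector bundle over $\bar{\mathbf{x}}$. Let $\bar{\mathbf{s}}\subset\bar{\mathbf{x}}$ be a subset containing exactly one element of each $G$-orbit of $\bar{\mathbf{x}}$. Then for each $w\in\mathrm{ext}\,F$, the path-component $\Psi_F(w)$ of $\Psi_F$ is homeomorphic to the quotient space $$\Bigg(\prod_{\bar{s}\in\bar{\mathbf{s}}}\mathrm{iso}_{G_{\bar{s}}}(w)\Bigg)\Bigg/\mathrm{iso}_G(w),$$ where, for a closed subgroup $K\subset G$, $\mathrm{iso}_K(w)$ is the group of all $K$-isomorphisms of $w$, and $\mathrm{iso}_G(w)$ is diagonally embedded into the product group.
   Context: All representations are finite-dimensional (continuous) complex representations. For $\bar{x}\in\bar{\mathbf{x}}$, $G_{\bar{x}}$ is the isotropy group and $F_{\bar{x}}$ is the fiber of $F$ over $\bar{x}$, regarded as a $G_{\bar{x}}$-representation. For vector spaces $V,W$, $\mathrm{iso}(V,W)$ is the set of all linear isomorphisms $V\to W$ (no group action considered). The groups $\mathrm{iso}_K(w)$ have the usual topology as subgroups of the general linear group of $w$. A pointwise clutching map with respect to $F$ is an element $\psi$ of $\prod_{(\bar{x},\bar{x}')\in\bar{\mathbf{x}}\times\bar{\mathbf{x}}}\mathrm{iso}(F_{\bar{x}},F_{\bar{x}'})$, with components $\psi(\bar{x},\bar{x}')$, such that for all $\bar{x},\bar{x}',\bar{x}''\in\bar{\mathbf{x}}$: $\psi(\bar{x},\bar{x})=\mathrm{id}_{F_{\bar{x}}}$;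 $\psi(\bar{x},\bar{x}')=\psi(\bar{x}',\bar{x})^{-1}$; $\psi(\bar{x},\bar{x}'')=\psi(\bar{x}',\bar{x}'')\psi(\bar{x},\bar{x}')$. The group $G$ acts on pointwise clutching maps by $(g\cdot\psi)(\bar{x},\bar{x}')\bar{u}=g\,\psi(g^{-1}\bar{x},g^{-1}\bar{x}')\,g^{-1}\bar{u}$; $\psi$ is equivariant if $g\cdot\psi=\psi$ for all $g\in G$. $\Psi_F$ is the set of all equivariant pointwise clutching maps with respect to $F$, with the subspace topology from the product topology. For a pointwise clutching map $\psi$, $F/\psi$ is the quotient of $F$ by $\bar{u}\sim\bar{u}' \iff \psi(\bar{x},\bar{x}')\bar{u}=\bar{u}'$ (for $\bar{u}\in F_{\bar{x}}$, $\bar{u}'\in F_{\bar{x}'}$), and $p_\psi:F\to F/\psi$ is the quotient map; $F/\psi$ has the unique vector space structure for which $p_\psi$ restricts to a linear isomorphism on each fiber. If $\psi$ is equivariant, $F/\psi$ carries a unique $G$-representation structure for which $p_\psi$ is $G$-equivariant, and $F/\psi$ denotes this representation. A complex $G$-representation $w$ is a representation extension of $F$ if $\mathrm{res}^G_{G_{\bar{x}}}w\cong F_{\bar{x}}$ as $G_{\bar{x}}$-representations for each $\bar{x}\in\bar{\mathbf{x}}$. $\mathrm{ext}\,F$ is the set of $G$-isomorphism classes of representation extensions of $F$ (a class is denoted by a representative $w$). The map $\mathrm{gl}:\Psi_F\to\mathrm{ext}\,F$ sends $\psi$ to the class of $F/\psi$, and $\Psi_F(w):=\mathrm{gl}^{-1}(w)$,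 i.e. the set of $\psi\in\Psi_F$ with $F/\psi\cong w$. Each $\Psi_F(w)$, $w\in\mathrm{ext}\,F$, is a nonempty path-component of $\Psi_F$. *)

theory Defs
  imports "HOL-Analysis.Analysis" "HOL-Algebra.Module" "HOL-Algebra.Group_Action"
    "HOL-Algebra.Product_Groups"
begin

section \<open>Compact Lie groups\<close>

text \<open>
  Manifolds of dimension \<open>n\<close> are modelled on the topology \<^term>\<open>Euclidean_space n\<close> on
  \<^typ>\<open>nat \<Rightarrow> real\<close> rather than on a type of class \<^class>\<open>euclidean_space\<close>: such a type has
  positive dimension, which would exclude the finite groups.
\<close>

text \<open>
  \<open>Ck_on k n U f\<close> is meant for \<open>U\<close> open in \<^term>\<open>Euclidean_space n\<close>; \<open>D i\<close> is the \<open>i\<close>-th partial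
  derivative.
\<close>

primrec Ck_on :: "nat \<Rightarrow> nat \<Rightarrow> (nat \<Rightarrow> real) set \<Rightarrow> ((nat \<Rightarrow> real) \<Rightarrow> real) \<Rightarrow> bool" where
  "Ck_on 0 n U f \<longleftrightarrow> continuous_map (subtopology (Euclidean_space n) U) euclideanreal f"
| "Ck_on (Suc k) n U f \<longleftrightarrow>
     continuous_map (subtopology (Euclidean_space n) U) euclideanreal f \<and>
     (\<exists>D. \<forall>i<n. (\<forall>x\<in>U. ((\<lambda>t. f (x(i := t))) has_real_derivative D i x) (at (x i)))
            \<and> Ck_on k n U (D i))"

definition smooth_on :: "nat \<Rightarrow> (nat \<Rightarrow> real) set \<Rightarrow> ((nat \<Rightarrow> real) \<Rightarrow> real) \<Rightarrow> bool" where
  "smooth_on n U f \<longleftrightarrow> (\<forall>k. Ck_on k n U f)"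

type_synonym 'a chart = "'a set \<times> ('a \<Rightarrow> nat \<Rightarrow> real)"

definition is_chart :: "nat \<Rightarrow> 'a topology \<Rightarrow> 'a chart \<Rightarrow> bool" where
  "is_chart n T = (\<lambda>(U, \<phi>). openin T U \<and> openin (Euclidean_space n) (\<phi> ` U) \<and>
     homeomorphic_map (subtopology T U) (subtopology (Euclidean_space n) (\<phi> ` U)) \<phi>)"

definition smooth_manifold :: "nat \<Rightarrow> 'a topology \<Rightarrow> 'a chart set \<Rightarrow> bool" where
  "smooth_manifold n T A \<longleftrightarrow>
     Hausdorff_space T \<and> second_countable T \<and>
     (\<forall>c\<in>A. is_chart n T c) \<and> (\<Union>(U, \<phi>)\<in>A. U) = topspace T \<and>
     (\<forall>(U, \<phi>)\<in>A. \<forall>(V, \<psi>)\<in>A. \<forall>i<n. smooth_on n (\<phi> ` (U \<inter> V)) (\<lambda>x. \<psi> (inv_into U \<phi> x) i))"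

definition smooth_map ::
  "nat \<Rightarrow> 'a topology \<Rightarrow> 'a chart set \<Rightarrow> nat \<Rightarrow> 'b topology \<Rightarrow> 'b chart set \<Rightarrow> ('a \<Rightarrow> 'b) \<Rightarrow> bool" where
  "smooth_map n T A m T' B f \<longleftrightarrow> continuous_map T T' f \<and>
     (\<forall>(U, \<phi>)\<in>A. \<forall>(V, \<psi>)\<in>B. \<forall>i<m.
        smooth_on n (\<phi> ` {p\<in>U. f p \<in> V}) (\<lambda>x. \<psi> (f (inv_into U \<phi> x)) i))"

definition prod_atlas :: "nat \<Rightarrow> 'a chart set \<Rightarrow> 'b chart set \<Rightarrow> ('a \<times> 'b) chart set" where
  "prod_atlas n A B =
     {(U \<times> V, \<lambda>(p, q) i. if i < n then \<phi> p i else \<psi> q (i - n)) | U \<phi> V \<psi>. (U, \<phi>) \<in> A \<and> (V, \<psi>) \<in> B}"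

definition lie_group ::
  "('g, 'm) monoid_scheme \<Rightarrow> 'g topology \<Rightarrow> nat \<Rightarrow> 'g chart set \<Rightarrow> bool" where
  "lie_group G TG n A \<longleftrightarrow> group G \<and> topspace TG = carrier G \<and> smooth_manifold n TG A \<and>
     smooth_map (n + n) (prod_topology TG TG) (prod_atlas n A A) n TG A (\<lambda>(g, h). g \<otimes>\<^bsub>G\<^esub> h) \<and>
     smooth_map n TG A n TG A (\<lambda>g. inv\<^bsub>G\<^esub> g)"

definition compact_lie_group ::
  "('g, 'm) monoid_scheme \<Rightarrow> 'g topology \<Rightarrow> nat \<Rightarrow> 'g chart set \<Rightarrow> bool" where
  "compact_lie_group G TG n A \<longleftrightarrow> lie_group G TG n A \<and> compact_space TG"

definition continuous_action ::
  "('g, 'm) monoid_scheme \<Rightarrow> 'g topology \<Rightarrow> 'a topology \<Rightarrow> ('g \<Rightarrow> 'a \<Rightarrow> 'a) \<Rightarrow> bool" where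
  "continuous_action G TG T a \<longleftrightarrow> group_action G (topspace T) a \<and>
     continuous_map (prod_topology TG T) T (\<lambda>(g, p). a g p)"


section \<open>Finite-dimensional complex vector spaces\<close>

text \<open>
  Vector spaces are modules over the field of complex numbers. The record type carries the
  irrelevant ring fields \<open>mult\<close> and \<open>one\<close>, which are left undefined.
\<close>

definition complex_field :: "complex ring" where
  "complex_field = \<lparr>carrier = UNIV, mult = (*), one = 1, ring.zero = 0, add = (+)\<rparr>"

definition lin_map :: "(complex, 'a) module \<Rightarrow> (complex, 'b) module \<Rightarrow> ('a \<Rightarrow> 'b) \<Rightarrow> bool" where
  "lin_map V W f \<longleftrightarrow> f \<in> carrier V \<rightarrow> carrier W \<and>
     (\<forall>u\<in>carrier V. \<forall>v\<in>carrier V. f (u \<oplus>\<^bsub>V\<^esub> v) = f u \<oplus>\<^bsub>W\<^esub> f v) \<and>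
     (\<forall>c. \<forall>v\<in>carrier V. f (c \<odot>\<^bsub>V\<^esub> v) = c \<odot>\<^bsub>W\<^esub> f v)"

definition lin_isos :: "(complex, 'a) module \<Rightarrow> (complex, 'b) module \<Rightarrow> ('a \<Rightarrow> 'b) set" where
  "lin_isos V W = {f \<in> extensional (carrier V). lin_map V W f \<and> bij_betw f (carrier V) (carrier W)}"

definition coord_space :: "nat \<Rightarrow> (complex, nat \<Rightarrow> complex) module" where
  "coord_space n = \<lparr>carrier = {..<n} \<rightarrow>\<^sub>E UNIV, mult = undefined, one = undefined,
     ring.zero = (\<lambda>i\<in>{..<n}. 0), add = (\<lambda>u v. \<lambda>i\<in>{..<n}. u i + v i),
     smult = (\<lambda>c v. \<lambda>i\<in>{..<n}. c * v i)\<rparr>"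

definition coord_topology :: "nat \<Rightarrow> (nat \<Rightarrow> complex) topology" where
  "coord_topology n = product_topology (\<lambda>_. euclidean) {..<n}"

definition fd_space :: "(complex, 'a) module \<Rightarrow> bool" where
  "fd_space V \<longleftrightarrow> Module.module complex_field V \<and> (\<exists>n. lin_isos V (coord_space n) \<noteq> {})"

text \<open>
  The usual topology of a finite-dimensional space, transported from \<open>\<complex>\<^sup>n\<close> along linear coordinates;
  all coordinate isomorphisms give the same topology.
\<close>

definition fd_topology :: "(complex, 'a) module \<Rightarrow> 'a topology" where
  "fd_topology V = topology (\<lambda>U. U \<subseteq> carrier V \<and>
     (\<forall>n. \<forall>f\<in>lin_isos V (coord_space n). openin (coord_topology n) (f ` U)))"

lemma openin_fd_topology:
  "openin (fd_topology V) U \<longleftrightarrow> U \<subseteq> carrier V \<and>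
     (\<forall>n. \<forall>f\<in>lin_isos V (coord_space n). openin (coord_topology n) (f ` U))"
proof -
  have "istopology (\<lambda>U. U \<subseteq> carrier V \<and>
     (\<forall>n. \<forall>f\<in>lin_isos V (coord_space n). openin (coord_topology n) (f ` U)))"
    unfolding istopology_def
  proof (intro conjI allI impI ballI, goal_cases)
    case (1 S T) then show ?case by blast
  next
    case (2 S T n f)
    then have "inj_on f (carrier V)" by (auto simp: lin_isos_def bij_betw_def)
    then have "f ` (S \<inter> T) = f ` S \<inter> f ` T" using 2 by (meson inj_on_image_Int)
    then show ?case using 2 by auto
  next
    case (3 K) then show ?case by blast
  next
    case (4 K n f)
    then have "openin (coord_topology n) (\<Union>S\<in>K. f ` S)" by blast
    then show ?case by (simp add: image_Union)
  qed
  then show ?thesis by (simp add: fd_topology_def)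
qed

lemma topspace_fd_topology [simp]: "topspace (fd_topology V) = carrier V"
proof -
  have "f ` carrier V = topspace (coord_topology n)" if "f \<in> lin_isos V (coord_space n)" for n f
    using that by (auto simp: lin_isos_def bij_betw_def coord_space_def coord_topology_def)
  then have "openin (fd_topology V) (carrier V)"
    by (auto simp: openin_fd_topology)
  moreover have "topspace (fd_topology V) \<subseteq> carrier V"
    by (meson openin_fd_topology openin_topspace)
  ultimately show ?thesis
    by (meson openin_subset subset_antisym)
qed

definition hom_space ::
  "(complex, 'a) module \<Rightarrow> (complex, 'b) module \<Rightarrow> (complex, 'a \<Rightarrow> 'b) module" where
  "hom_space V W = \<lparr>carrier = {f \<in> extensional (carrier V). lin_map V W f},
     mult = undefined, one = undefined, ring.zero = (\<lambda>v\<in>carrier V. \<zero>\<^bsub>W\<^esub>),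
     add = (\<lambda>f g. \<lambda>v\<in>carrier V. f v \<oplus>\<^bsub>W\<^esub> g v), smult = (\<lambda>c f. \<lambda>v\<in>carrier V. c \<odot>\<^bsub>W\<^esub> f v)\<rparr>"

definition iso_topology ::
  "(complex, 'a) module \<Rightarrow> (complex, 'b) module \<Rightarrow> ('a \<Rightarrow> 'b) topology" where
  "iso_topology V W = subtopology (fd_topology (hom_space V W)) (lin_isos V W)"


section \<open>Representations\<close>

record ('g, 'a) rep =
  rspace :: "(complex, 'a) module"
  ract :: "'g \<Rightarrow> 'a \<Rightarrow> 'a"

definition representation ::
  "('g, 'm) monoid_scheme \<Rightarrow> 'g topology \<Rightarrow> ('g, 'a) rep \<Rightarrow> bool" where
  "representation G TG V \<longleftrightarrow> fd_space (rspace V) \<and>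
     continuous_action G TG (fd_topology (rspace V)) (ract V) \<and>
     (\<forall>g\<in>carrier G. lin_map (rspace V) (rspace V) (ract V g))"

definition rep_isos :: "'g set \<Rightarrow> ('g, 'a) rep \<Rightarrow> ('g, 'b) rep \<Rightarrow> ('a \<Rightarrow> 'b) set" where
  "rep_isos K V W = {f \<in> lin_isos (rspace V) (rspace W).
     \<forall>g\<in>K. \<forall>v\<in>carrier (rspace V). f (ract V g v) = ract W g (f v)}"

definition iso_group :: "'g set \<Rightarrow> ('g, 'a) rep \<Rightarrow> ('a \<Rightarrow> 'a) monoid" where
  "iso_group K V = \<lparr>carrier = rep_isos K V V, mult = compose (carrier (rspace V)),
     one = (\<lambda>v\<in>carrier (rspace V). v)\<rparr>"

definition iso_group_topology :: "'g set \<Rightarrow> ('g, 'a) rep \<Rightarrow> ('a \<Rightarrow> 'a) topology" where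
  "iso_group_topology K V = subtopology (iso_topology (rspace V) (rspace V)) (rep_isos K V V)"


section \<open>Equivariant vector bundles\<close>

text \<open>\<open>bfib F x\<close> is the vector space structure on the fiber over \<open>x\<close>.\<close>

record ('g, 'x, 'f) vbundle =
  btop :: "'f topology"
  bproj :: "'f \<Rightarrow> 'x"
  bfib :: "'x \<Rightarrow> (complex, 'f) module"
  bact :: "'g \<Rightarrow> 'f \<Rightarrow> 'f"

definition vector_bundle :: "'x topology \<Rightarrow> ('g, 'x, 'f) vbundle \<Rightarrow> bool" where
  "vector_bundle B F \<longleftrightarrow>
     continuous_map (btop F) B (bproj F) \<and>
     (\<forall>x\<in>topspace B. fd_space (bfib F x) \<and>
        carrier (bfib F x) = {u \<in> topspace (btop F). bproj F u = x}) \<and>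
     (\<forall>x\<in>topspace B. \<exists>U n h. openin B U \<and> x \<in> U \<and>
        homeomorphic_map (subtopology (btop F) {u \<in> topspace (btop F). bproj F u \<in> U})
          (prod_topology (subtopology B U) (coord_topology n)) h \<and>
        (\<forall>y\<in>U. (\<forall>u\<in>carrier (bfib F y). fst (h u) = y) \<and>
           lin_map (bfib F y) (coord_space n) (\<lambda>u. snd (h u))))"

definition equivariant_vector_bundle ::
  "('g, 'm) monoid_scheme \<Rightarrow> 'g topology \<Rightarrow> 'x topology \<Rightarrow> ('g \<Rightarrow> 'x \<Rightarrow> 'x) \<Rightarrow> ('g, 'x, 'f) vbundle \<Rightarrow> bool" where
  "equivariant_vector_bundle G TG B act F \<longleftrightarrow> vector_bundle B F \<and>
     continuous_action G TG (btop F) (bact F) \<and>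
     (\<forall>g\<in>carrier G. \<forall>u\<in>topspace (btop F). bproj F (bact F g u) = act g (bproj F u)) \<and>
     (\<forall>g\<in>carrier G. \<forall>x\<in>topspace B. lin_map (bfib F x) (bfib F (act g x)) (bact F g))"

definition fiber_rep :: "('g, 'x, 'f) vbundle \<Rightarrow> 'x \<Rightarrow> ('g, 'f) rep" where
  "fiber_rep F x = \<lparr>rspace = bfib F x, ract = (\<lambda>g. \<lambda>u\<in>carrier (bfib F x). bact F g u)\<rparr>"

definition representation_extension ::
  "('g, 'm) monoid_scheme \<Rightarrow> 'g topology \<Rightarrow> 'x set \<Rightarrow> ('g \<Rightarrow> 'x \<Rightarrow> 'x) \<Rightarrow> ('g, 'x, 'f) vbundle
    \<Rightarrow> ('g, 'w) rep \<Rightarrow> bool" where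
  "representation_extension G TG X act F w \<longleftrightarrow> representation G TG w \<and>
     (\<forall>x\<in>X. rep_isos (stabilizer G act x) w (fiber_rep F x) \<noteq> {})"


section \<open>Equivariant pointwise clutching maps\<close>

definition clutching_maps :: "'x set \<Rightarrow> ('g, 'x, 'f) vbundle \<Rightarrow> ('x \<times> 'x \<Rightarrow> 'f \<Rightarrow> 'f) set" where
  "clutching_maps X F = {\<psi> \<in> (\<Pi>\<^sub>E (x, x')\<in>X \<times> X. lin_isos (bfib F x) (bfib F x')).
     (\<forall>x\<in>X. \<psi> (x, x) = (\<lambda>u\<in>carrier (bfib F x). u)) \<and>
     (\<forall>x\<in>X. \<forall>x'\<in>X. \<psi> (x, x') =
        (\<lambda>u\<in>carrier (bfib F x). inv_into (carrier (bfib F x')) (\<psi> (x', x)) u)) \<and>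
     (\<forall>x\<in>X. \<forall>x'\<in>X. \<forall>x''\<in>X.
        \<psi> (x, x'') = compose (carrier (bfib F x)) (\<psi> (x', x'')) (\<psi> (x, x')))}"

definition clutching_act ::
  "('g, 'm) monoid_scheme \<Rightarrow> 'x set \<Rightarrow> ('g \<Rightarrow> 'x \<Rightarrow> 'x) \<Rightarrow> ('g, 'x, 'f) vbundle \<Rightarrow> 'g
    \<Rightarrow> ('x \<times> 'x \<Rightarrow> 'f \<Rightarrow> 'f) \<Rightarrow> ('x \<times> 'x \<Rightarrow> 'f \<Rightarrow> 'f)" where
  "clutching_act G X act F g \<psi> = (\<lambda>(x, x')\<in>X \<times> X. \<lambda>u\<in>carrier (bfib F x).
     bact F g (\<psi> (act (inv\<^bsub>G\<^esub> g) x, act (inv\<^bsub>G\<^esub> g) x') (bact F (inv\<^bsub>G\<^esub> g) u)))"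

definition Psi ::
  "('g, 'm) monoid_scheme \<Rightarrow> 'x set \<Rightarrow> ('g \<Rightarrow> 'x \<Rightarrow> 'x) \<Rightarrow> ('g, 'x, 'f) vbundle
    \<Rightarrow> ('x \<times> 'x \<Rightarrow> 'f \<Rightarrow> 'f) set" where
  "Psi G X act F = {\<psi> \<in> clutching_maps X F. \<forall>g\<in>carrier G. clutching_act G X act F g \<psi> = \<psi>}"

definition Psi_topology ::
  "('g, 'm) monoid_scheme \<Rightarrow> 'x set \<Rightarrow> ('g \<Rightarrow> 'x \<Rightarrow> 'x) \<Rightarrow> ('g, 'x, 'f) vbundle
    \<Rightarrow> ('x \<times> 'x \<Rightarrow> 'f \<Rightarrow> 'f) topology" where
  "Psi_topology G X act F = subtopology
     (product_topology (\<lambda>(x, x'). iso_topology (bfib F x) (bfib F x')) (X \<times> X)) (Psi G X act F)"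

definition clutch_rel :: "('g, 'x, 'f) vbundle \<Rightarrow> ('x \<times> 'x \<Rightarrow> 'f \<Rightarrow> 'f) \<Rightarrow> ('f \<times> 'f) set" where
  "clutch_rel F \<psi> = {(u, u'). u \<in> topspace (btop F) \<and> u' \<in> topspace (btop F) \<and>
     \<psi> (bproj F u, bproj F u') u = u'}"

definition quot_space ::
  "'x set \<Rightarrow> ('g, 'x, 'f) vbundle \<Rightarrow> ('x \<times> 'x \<Rightarrow> 'f \<Rightarrow> 'f) \<Rightarrow> (complex, 'f set) module" where
  "quot_space X F \<psi> = \<lparr>carrier = topspace (btop F) // clutch_rel F \<psi>,
     mult = undefined, one = undefined,
     ring.zero = (THE c. \<exists>x\<in>X. c = clutch_rel F \<psi> `` {\<zero>\<^bsub>bfib F x\<^esub>}),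
     add = (\<lambda>a b. THE c. \<exists>x\<in>X. \<exists>u\<in>a \<inter> carrier (bfib F x). \<exists>v\<in>b \<inter> carrier (bfib F x).
              c = clutch_rel F \<psi> `` {u \<oplus>\<^bsub>bfib F x\<^esub> v}),
     smult = (\<lambda>k a. THE c. \<exists>x\<in>X. \<exists>u\<in>a \<inter> carrier (bfib F x).
              c = clutch_rel F \<psi> `` {k \<odot>\<^bsub>bfib F x\<^esub> u})\<rparr>"

text \<open>
  The representation \<open>F/\<psi>\<close>. The lemmas \<open>quot_map_lin_iso\<close> and \<open>quot_map_equivariant\<close> below show
  that, for an equivariant clutching map, it is the structure making the quotient map fiberwise a linear isomorphism and
  equivariant.
\<close>

definition quot_rep ::
  "'x set \<Rightarrow> ('g, 'x, 'f) vbundle \<Rightarrow> ('x \<times> 'x \<Rightarrow> 'f \<Rightarrow> 'f) \<Rightarrow> ('g, 'f set) rep" where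
  "quot_rep X F \<psi> = \<lparr>rspace = quot_space X F \<psi>,
     ract = (\<lambda>g. \<lambda>a\<in>carrier (quot_space X F \<psi>). bact F g ` a)\<rparr>"

lemma clutching_mapsD:
  assumes "\<psi> \<in> clutching_maps X F" "x \<in> X" "x' \<in> X"
  shows "lin_map (bfib F x) (bfib F x') (\<psi> (x, x'))"
    and "bij_betw (\<psi> (x, x')) (carrier (bfib F x)) (carrier (bfib F x'))"
    and "u \<in> carrier (bfib F x) \<Longrightarrow> \<psi> (x, x') u \<in> carrier (bfib F x')"
    and "u \<in> carrier (bfib F x) \<Longrightarrow> \<psi> (x, x) u = u"
    and "x'' \<in> X \<Longrightarrow> u \<in> carrier (bfib F x) \<Longrightarrow> \<psi> (x', x'') (\<psi> (x, x') u) = \<psi> (x, x'') u"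
proof -
  have "\<psi> \<in> (\<Pi>\<^sub>E (x, x')\<in>X \<times> X. lin_isos (bfib F x) (bfib F x'))"
    using assms(1) unfolding clutching_maps_def mem_Collect_eq by (elim conjE)
  then have 1: "\<psi> (x, x') \<in> lin_isos (bfib F x) (bfib F x')"
    using assms(2,3) PiE_mem[of \<psi> "X \<times> X" _ "(x, x')"] by fastforce
  have id: "\<forall>x\<in>X. \<psi> (x, x) = (\<lambda>u\<in>carrier (bfib F x). u)"
    using assms(1) unfolding clutching_maps_def mem_Collect_eq by (elim conjE)
  have comp: "\<forall>x\<in>X. \<forall>x'\<in>X. \<forall>x''\<in>X.
        \<psi> (x, x'') = compose (carrier (bfib F x)) (\<psi> (x', x'')) (\<psi> (x, x'))"
    using assms(1) unfolding clutching_maps_def mem_Collect_eq by (elim conjE)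
  show "lin_map (bfib F x) (bfib F x') (\<psi> (x, x'))"
    and "bij_betw (\<psi> (x, x')) (carrier (bfib F x)) (carrier (bfib F x'))"
    using 1 by (auto simp: lin_isos_def)
  then show "u \<in> carrier (bfib F x) \<Longrightarrow> \<psi> (x, x') u \<in> carrier (bfib F x')"
    by (auto simp: bij_betw_def)
  show "u \<in> carrier (bfib F x) \<Longrightarrow> \<psi> (x, x) u = u"
    using id assms(2) by simp
  show "\<psi> (x', x'') (\<psi> (x, x') u) = \<psi> (x, x'') u" if "x'' \<in> X" "u \<in> carrier (bfib F x)"
  proof -
    have "\<psi> (x, x'') = compose (carrier (bfib F x)) (\<psi> (x', x'')) (\<psi> (x, x'))"
      using comp assms that by blast
    then show ?thesis using that by (simp add: compose_eq)
  qed
qed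

lemma carrier_bfib:
  assumes "vector_bundle (discrete_topology X) F" "x \<in> X"
  shows "u \<in> carrier (bfib F x) \<longleftrightarrow> u \<in> topspace (btop F) \<and> bproj F u = x"
  using assms by (auto simp: vector_bundle_def)

lemma bproj_in:
  assumes "vector_bundle (discrete_topology X) F" "u \<in> topspace (btop F)"
  shows "bproj F u \<in> X"
  using assms by (auto simp: vector_bundle_def continuous_map_def)

lemma equiv_clutch_rel:
  assumes "vector_bundle (discrete_topology X) F" "\<psi> \<in> clutching_maps X F"
  shows "equiv (topspace (btop F)) (clutch_rel F \<psi>)"
proof (rule equivI)
  note fib = carrier_bfib[OF assms(1)] and pX = bproj_in[OF assms(1)]
  have self: "\<psi> (bproj F u, bproj F u) u = u" if "u \<in> topspace (btop F)" for u
    using clutching_mapsD(4)[OF assms(2) pX[OF that] pX[OF that]] fib[OF pX[OF that]] that by blast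
  show "clutch_rel F \<psi> \<subseteq> topspace (btop F) \<times> topspace (btop F)"
    by (auto simp: clutch_rel_def)
  show "refl_on (topspace (btop F)) (clutch_rel F \<psi>)"
    using self by (auto simp: clutch_rel_def refl_on_def)
  show "sym (clutch_rel F \<psi>)"
  proof (rule symI)
    fix u v assume "(u, v) \<in> clutch_rel F \<psi>"
    then have *: "u \<in> topspace (btop F)" "v \<in> topspace (btop F)" "\<psi> (bproj F u, bproj F v) u = v"
      by (auto simp: clutch_rel_def)
    have "\<psi> (bproj F v, bproj F u) (\<psi> (bproj F u, bproj F v) u) = \<psi> (bproj F u, bproj F u) u"
      using * fib pX by (intro clutching_mapsD(5)[OF assms(2)]) auto
    also have "\<dots> = u" using self * by simp
    finally show "(v, u) \<in> clutch_rel F \<psi>" using * by (auto simp: clutch_rel_def)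
  qed
  show "trans (clutch_rel F \<psi>)"
  proof (rule transI)
    fix u v t assume "(u, v) \<in> clutch_rel F \<psi>" "(v, t) \<in> clutch_rel F \<psi>"
    then have *: "u \<in> topspace (btop F)" "v \<in> topspace (btop F)" "t \<in> topspace (btop F)"
      "\<psi> (bproj F u, bproj F v) u = v" "\<psi> (bproj F v, bproj F t) v = t"
      by (auto simp: clutch_rel_def)
    have "\<psi> (bproj F v, bproj F t) (\<psi> (bproj F u, bproj F v) u) = \<psi> (bproj F u, bproj F t) u"
      using * fib pX by (intro clutching_mapsD(5)[OF assms(2)]) auto
    then show "(u, t) \<in> clutch_rel F \<psi>" using * by (auto simp: clutch_rel_def)
  qed
qed

lemma quot_map_lin_iso:
  assumes vb: "vector_bundle (discrete_topology X) F" and \<psi>: "\<psi> \<in> clutching_maps X F" and x: "x \<in> X"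
  shows "(\<lambda>u\<in>carrier (bfib F x). clutch_rel F \<psi> `` {u}) \<in> lin_isos (bfib F x) (quot_space X F \<psi>)"
proof -
  define r where "r = clutch_rel F \<psi>"
  note fib = carrier_bfib[OF vb] and pX = bproj_in[OF vb] and D = clutching_mapsD[OF \<psi>]
  have eq: "equiv (topspace (btop F)) r"
    using equiv_clutch_rel[OF vb \<psi>] by (simp add: r_def)
  have rel: "(u, u') \<in> r \<longleftrightarrow> \<psi> (y, y') u = u'"
    if "y \<in> X" "y' \<in> X" "u \<in> carrier (bfib F y)" "u' \<in> carrier (bfib F y')" for y y' u u'
    using that fib by (auto simp: r_def clutch_rel_def)
  have cls: "r `` {u} = r `` {u'} \<longleftrightarrow> \<psi> (y, y') u = u'"
    if "y \<in> X" "y' \<in> X" "u \<in> carrier (bfib F y)" "u' \<in> carrier (bfib F y')" for y y' u u'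
    using that rel[OF that] fib eq_equiv_class_iff[OF eq] by auto
  have mod: "Module.module complex_field (bfib F y)" if "y \<in> X" for y
    using vb that by (auto simp: vector_bundle_def fd_space_def)
  have add_cl: "u \<oplus>\<^bsub>bfib F y\<^esub> v \<in> carrier (bfib F y)"
    if "y \<in> X" "u \<in> carrier (bfib F y)" "v \<in> carrier (bfib F y)" for y u v
    using mod[OF that(1)] that by (simp add: Module.module_def abelian_groupE(1))
  have sm_cl: "c \<odot>\<^bsub>bfib F y\<^esub> v \<in> carrier (bfib F y)"
    if "y \<in> X" "v \<in> carrier (bfib F y)" for y c v
    using Module.module.smult_closed[OF mod[OF that(1)]] that by (simp add: complex_field_def)
  have inj: "inj_on (\<lambda>u. r `` {u}) (carrier (bfib F x))"
    using cls[OF x x] D(4)[OF x x] by (intro inj_onI) auto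
  have surj: "(\<lambda>u. r `` {u}) ` carrier (bfib F x) = topspace (btop F) // r"
  proof (intro equalityI subsetI)
    fix c assume "c \<in> (\<lambda>u. r `` {u}) ` carrier (bfib F x)"
    then show "c \<in> topspace (btop F) // r" using fib[OF x] by (auto intro: quotientI)
  next
    fix c assume "c \<in> topspace (btop F) // r"
    then obtain u where u: "u \<in> topspace (btop F)" "c = r `` {u}" by (auto elim: quotientE)
    have uy: "bproj F u \<in> X" "u \<in> carrier (bfib F (bproj F u))" using u pX fib by auto
    then have "\<psi> (bproj F u, x) u \<in> carrier (bfib F x)" using D(3) x by blast
    moreover have "c = r `` {\<psi> (bproj F u, x) u}"
      using cls[OF uy(1) x uy(2) calculation] u by auto
    ultimately show "c \<in> (\<lambda>u. r `` {u}) ` carrier (bfib F x)" by blast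
  qed
  have add: "add (quot_space X F \<psi>) (r `` {u}) (r `` {v}) = r `` {u \<oplus>\<^bsub>bfib F x\<^esub> v}"
    if u: "u \<in> carrier (bfib F x)" and v: "v \<in> carrier (bfib F x)" for u v
  proof -
    have "(THE c. \<exists>y\<in>X. \<exists>u'\<in>r `` {u} \<inter> carrier (bfib F y). \<exists>v'\<in>r `` {v} \<inter> carrier (bfib F y).
              c = r `` {u' \<oplus>\<^bsub>bfib F y\<^esub> v'}) = r `` {u \<oplus>\<^bsub>bfib F x\<^esub> v}"
    proof (rule the_equality)
      show "\<exists>y\<in>X. \<exists>u'\<in>r `` {u} \<inter> carrier (bfib F y). \<exists>v'\<in>r `` {v} \<inter> carrier (bfib F y).
              r `` {u \<oplus>\<^bsub>bfib F x\<^esub> v} = r `` {u' \<oplus>\<^bsub>bfib F y\<^esub> v'}"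
        using u v x fib[OF x] equiv_class_self[OF eq] by blast
      fix c assume "\<exists>y\<in>X. \<exists>u'\<in>r `` {u} \<inter> carrier (bfib F y). \<exists>v'\<in>r `` {v} \<inter> carrier (bfib F y).
              c = r `` {u' \<oplus>\<^bsub>bfib F y\<^esub> v'}"
      then obtain y u' v' where *: "y \<in> X" "u' \<in> carrier (bfib F y)" "v' \<in> carrier (bfib F y)"
        "(u, u') \<in> r" "(v, v') \<in> r" "c = r `` {u' \<oplus>\<^bsub>bfib F y\<^esub> v'}" by auto
      then have "u' = \<psi> (x, y) u" "v' = \<psi> (x, y) v" using rel x u v by auto
      then have "\<psi> (x, y) (u \<oplus>\<^bsub>bfib F x\<^esub> v) = u' \<oplus>\<^bsub>bfib F y\<^esub> v'"
        using D(1)[OF x *(1)] u v by (auto simp: lin_map_def)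
      then show "c = r `` {u \<oplus>\<^bsub>bfib F x\<^esub> v}"
        using cls[OF x *(1) add_cl[OF x u v] add_cl[OF *(1-3)]] * by auto
    qed
    then show ?thesis by (simp add: quot_space_def r_def)
  qed
  have sm: "smult (quot_space X F \<psi>) k (r `` {u}) = r `` {k \<odot>\<^bsub>bfib F x\<^esub> u}"
    if u: "u \<in> carrier (bfib F x)" for k u
  proof -
    have "(THE c. \<exists>y\<in>X. \<exists>u'\<in>r `` {u} \<inter> carrier (bfib F y). c = r `` {k \<odot>\<^bsub>bfib F y\<^esub> u'})
            = r `` {k \<odot>\<^bsub>bfib F x\<^esub> u}"
    proof (rule the_equality)
      show "\<exists>y\<in>X. \<exists>u'\<in>r `` {u} \<inter> carrier (bfib F y).
              r `` {k \<odot>\<^bsub>bfib F x\<^esub> u} = r `` {k \<odot>\<^bsub>bfib F y\<^esub> u'}"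
        using u x fib[OF x] equiv_class_self[OF eq] by blast
      fix c assume "\<exists>y\<in>X. \<exists>u'\<in>r `` {u} \<inter> carrier (bfib F y). c = r `` {k \<odot>\<^bsub>bfib F y\<^esub> u'}"
      then obtain y u' where *: "y \<in> X" "u' \<in> carrier (bfib F y)" "(u, u') \<in> r"
        "c = r `` {k \<odot>\<^bsub>bfib F y\<^esub> u'}" by auto
      then have "u' = \<psi> (x, y) u" using rel x u by auto
      then have "\<psi> (x, y) (k \<odot>\<^bsub>bfib F x\<^esub> u) = k \<odot>\<^bsub>bfib F y\<^esub> u'"
        using D(1)[OF x *(1)] u by (auto simp: lin_map_def)
      then show "c = r `` {k \<odot>\<^bsub>bfib F x\<^esub> u}"
        using cls[OF x *(1) sm_cl[OF x u] sm_cl[OF *(1-2)]] * by auto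
    qed
    then show ?thesis by (simp add: quot_space_def r_def)
  qed
  have car: "carrier (quot_space X F \<psi>) = topspace (btop F) // r"
    by (simp add: quot_space_def r_def)
  have "lin_map (bfib F x) (quot_space X F \<psi>) (\<lambda>u\<in>carrier (bfib F x). r `` {u})"
    using add sm surj add_cl[OF x] sm_cl[OF x] unfolding lin_map_def car by auto
  moreover have "bij_betw (\<lambda>u\<in>carrier (bfib F x). r `` {u}) (carrier (bfib F x))
      (carrier (quot_space X F \<psi>))"
    using inj surj unfolding bij_betw_def car by (auto simp: inj_on_def)
  ultimately show ?thesis by (simp add: lin_isos_def r_def)
qed

lemma quot_map_equivariant:
  assumes act: "group_action G X act"
    and F: "equivariant_vector_bundle G TG (discrete_topology X) act F"
    and \<psi>: "\<psi> \<in> Psi G X act F" and g: "g \<in> carrier G" and u: "u \<in> topspace (btop F)"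
  shows "ract (quot_rep X F \<psi>) g (clutch_rel F \<psi> `` {u}) = clutch_rel F \<psi> `` {bact F g u}"
proof -
  have vb: "vector_bundle (discrete_topology X) F"
    using F unfolding equivariant_vector_bundle_def by (elim conjE)
  have ga: "group_action G (topspace (btop F)) (bact F)"
    using F unfolding equivariant_vector_bundle_def continuous_action_def by (elim conjE)
  have "\<forall>g\<in>carrier G. \<forall>u\<in>topspace (btop F). bproj F (bact F g u) = act g (bproj F u)"
    using F unfolding equivariant_vector_bundle_def by (elim conjE)
  then have pr: "bproj F (bact F g u) = act g (bproj F u)"
    if "g \<in> carrier G" "u \<in> topspace (btop F)" for g u
    using that by blast
  interpret A: group_action G X act by (rule act)
  interpret B: group_action G "topspace (btop F)" "bact F" by (rule ga)
  have grp: "group G" by (rule group_hom.axioms(1)[OF A.group_hom])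
  interpret Gr: group G by (rule grp)
  note fib = carrier_bfib[OF vb] and pX = bproj_in[OF vb]
  have bcl: "bact F h v \<in> topspace (btop F)"
    if "h \<in> carrier G" "v \<in> topspace (btop F)" for h v
    using B.element_image[OF that refl] .
  have inv1: "act (inv\<^bsub>G\<^esub> h) (act h y) = y" if "h \<in> carrier G" "y \<in> X" for h y
    using A.orbit_sym_aux[OF that refl] .
  have inv2: "bact F (inv\<^bsub>G\<^esub> h) (bact F h v) = v" if "h \<in> carrier G" "v \<in> topspace (btop F)" for h v
    using B.orbit_sym_aux[OF that refl] .
  have key: "(u, v) \<in> clutch_rel F \<psi> \<Longrightarrow> (bact F h u, bact F h v) \<in> clutch_rel F \<psi>"
    if h: "h \<in> carrier G" for h u v
  proof -
    assume "(u, v) \<in> clutch_rel F \<psi>"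
    then have *: "u \<in> topspace (btop F)" "v \<in> topspace (btop F)" "\<psi> (bproj F u, bproj F v) u = v"
      by (auto simp: clutch_rel_def)
    have X: "act h (bproj F u) \<in> X" "act h (bproj F v) \<in> X"
      using A.element_image[OF h pX refl] * by auto
    have "\<psi> (act h (bproj F u), act h (bproj F v)) (bact F h u)
        = clutching_act G X act F h \<psi> (act h (bproj F u), act h (bproj F v)) (bact F h u)"
      using \<psi> h by (simp add: Psi_def)
    also have "\<dots> = bact F h (\<psi> (bproj F u, bproj F v) u)"
      using X * h bcl pX by (simp add: clutching_act_def inv1 inv2 fib[OF X(1)] pr)
    finally show ?thesis using * bcl h pr by (simp add: clutch_rel_def)
  qed
  have "bact F g ` (clutch_rel F \<psi> `` {u}) = clutch_rel F \<psi> `` {bact F g u}"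
  proof (intro equalityI subsetI)
    fix c assume "c \<in> bact F g ` (clutch_rel F \<psi> `` {u})"
    then show "c \<in> clutch_rel F \<psi> `` {bact F g u}" using key[OF g] by auto
  next
    fix c assume "c \<in> clutch_rel F \<psi> `` {bact F g u}"
    then have c: "(bact F g u, c) \<in> clutch_rel F \<psi>" "c \<in> topspace (btop F)"
      by (auto simp: clutch_rel_def)
    have gi: "inv\<^bsub>G\<^esub> g \<in> carrier G" using g by simp
    have "(u, bact F (inv\<^bsub>G\<^esub> g) c) \<in> clutch_rel F \<psi>" using key[OF gi c(1)] inv2[OF g u] by simp
    moreover have "bact F g (bact F (inv\<^bsub>G\<^esub> g) c) = c" using inv2[OF gi c(2)] g by simp
    ultimately show "c \<in> bact F g ` (clutch_rel F \<psi> `` {u})" by force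
  qed
  moreover have "clutch_rel F \<psi> `` {u} \<in> carrier (quot_space X F \<psi>)"
    using u by (simp add: quot_space_def quotientI)
  ultimately show ?thesis by (simp add: quot_rep_def)
qed

definition Psi_class ::
  "('g, 'm) monoid_scheme \<Rightarrow> 'x set \<Rightarrow> ('g \<Rightarrow> 'x \<Rightarrow> 'x) \<Rightarrow> ('g, 'x, 'f) vbundle
    \<Rightarrow> ('g, 'w) rep \<Rightarrow> ('x \<times> 'x \<Rightarrow> 'f \<Rightarrow> 'f) set" where
  "Psi_class G X act F w = {\<psi> \<in> Psi G X act F. rep_isos (carrier G) (quot_rep X F \<psi>) w \<noteq> {}}"


section \<open>Quotient spaces\<close>

definition quotient_topology :: "'a topology \<Rightarrow> ('a \<Rightarrow> 'b) \<Rightarrow> 'b topology" where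
  "quotient_topology T q = topology (\<lambda>U. U \<subseteq> q ` topspace T \<and> openin T {x \<in> topspace T. q x \<in> U})"

lemma openin_quotient_topology:
  "openin (quotient_topology T q) U \<longleftrightarrow> U \<subseteq> q ` topspace T \<and> openin T {x \<in> topspace T. q x \<in> U}"
proof -
  have "istopology (\<lambda>U. U \<subseteq> q ` topspace T \<and> openin T {x \<in> topspace T. q x \<in> U})"
    unfolding istopology_def
  proof (rule conjI; intro allI impI)
    fix U V
    assume *: "U \<subseteq> q ` topspace T \<and> openin T {x \<in> topspace T. q x \<in> U}"
      "V \<subseteq> q ` topspace T \<and> openin T {x \<in> topspace T. q x \<in> V}"
    have "{x \<in> topspace T. q x \<in> U \<inter> V} = {x \<in> topspace T. q x \<in> U} \<inter> {x \<in> topspace T. q x \<in> V}"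
      by blast
    then show "U \<inter> V \<subseteq> q ` topspace T \<and> openin T {x \<in> topspace T. q x \<in> U \<inter> V}"
      using * by (simp add: openin_Int le_infI1)
  next
    fix K
    assume *: "\<forall>U\<in>K. U \<subseteq> q ` topspace T \<and> openin T {x \<in> topspace T. q x \<in> U}"
    have "{x \<in> topspace T. q x \<in> \<Union>K} = \<Union>((\<lambda>U. {x \<in> topspace T. q x \<in> U}) ` K)"
      by blast
    moreover have "openin T (\<Union>((\<lambda>U. {x \<in> topspace T. q x \<in> U}) ` K))"
      using * by (intro openin_Union) (simp add: image_iff, metis)
    ultimately show "\<Union>K \<subseteq> q ` topspace T \<and> openin T {x \<in> topspace T. q x \<in> \<Union>K}"
      using * by (simp add: Sup_le_iff)
  qed
  then show ?thesis by (simp add: quotient_topology_def)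
qed

definition diagonal :: "'i set \<Rightarrow> 'a set \<Rightarrow> ('i \<Rightarrow> 'a) set" where
  "diagonal S H = {(\<lambda>s\<in>S. h) | h. h \<in> H}"

text \<open>The space of left cosets of the diagonal \<open>iso\<^sub>G(w)\<close> in the product of the \<open>iso\<^bsub>G\<^sub>s\<^esub>(w)\<close>.\<close>

definition iso_quotient ::
  "('g, 'm) monoid_scheme \<Rightarrow> ('g \<Rightarrow> 'x \<Rightarrow> 'x) \<Rightarrow> 'x set \<Rightarrow> ('g, 'w) rep
    \<Rightarrow> ('x \<Rightarrow> 'w \<Rightarrow> 'w) set topology" where
  "iso_quotient G act S w = quotient_topology
     (product_topology (\<lambda>s. iso_group_topology (stabilizer G act s) w) S)
     (\<lambda>p. p <#\<^bsub>product_group S (\<lambda>s. iso_group (stabilizer G act s) w)\<^esub>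
            diagonal S (carrier (iso_group (carrier G) w)))"

end

theory Submission
  imports Defs "HOL-Library.Function_Algebras"
begin

text \<open>
  Call a family of linear isomorphisms \<open>\<phi>\<^sub>x : w \<rightarrow> F\<^sub>x\<close> with \<open>\<phi>\<^bsub>gx\<^esub> g = g \<phi>\<^sub>x\<close> equivariant. Equivariant families
  correspond to points of \<open>\<Prod>\<^sub>s iso\<^bsub>G\<^sub>s\<^esub>(w)\<close>: fix \<open>G\<^sub>s\<close>-isomorphisms \<open>\<alpha>\<^sub>s : w \<rightarrow> F\<^sub>s\<close>, send \<open>p\<close> to
  \<open>\<phi>\<^bsub>gs\<^esub> = g \<alpha>\<^sub>s p\<^sub>s g\<^sup>-\<^sup>1\<close>, and \<open>\<phi>\<close> back to \<open>\<alpha>\<^sub>s\<^sup>-\<^sup>1 \<phi>\<^sub>s\<close>. The clutching maps \<open>\<psi>\<close> with \<open>F/\<psi> \<cong> w\<close> are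
  exactly the maps \<open>\<psi>(x, x') = \<phi>\<^bsub>x'\<^esub> \<phi>\<^sub>x\<^sup>-\<^sup>1\<close>, and two families give the same \<open>\<psi>\<close> iff they differ by
  an element of \<open>iso\<^sub>G(w)\<close>. This yields a continuous surjection onto \<open>\<Psi>\<^sub>F(w)\<close> whose fibers are the
  cosets, and it remains to find local sections. A preimage of \<open>\<psi>\<close> amounts to an invertible
  intertwiner \<open>w \<rightarrow> F/\<psi>\<close>. The intertwiners form the kernel of a linear system that depends continuously on
  \<open>\<psi>\<close>, and on \<open>\<Psi>\<^sub>F(w)\<close> its dimension is constant, equal to that of the endomorphism algebra of \<open>w\<close>;
  hence Gaussian elimination extends a given intertwiner continuously to a neighborhood.
\<close>

section \<open>Linear systems depending continuously on a parameter\<close>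

text \<open>The target \<open>F/\<psi>\<close> of an intertwiner varies with \<open>\<psi>\<close>,
  even as a set. Fixing a point \<open>x0\<close> and identifying \<open>F/\<psi>\<close> with the
  fiber over \<open>x0\<close> turns the intertwiners into linear maps \<open>T\<close> from
  \<open>w\<close> to one fixed space, subject to \<open>T g = \<psi>(g x0, x0) g T\<close>; only
  the coefficients of this system move. Elimination alone controls the kernel from one side: near
  \<open>z0\<close> a solution is determined by its free coordinates, but fewer values of these may
  be realised than at \<open>z0\<close>, because a rank can jump upwards. Equality is forced by
  supplying, for each parameter, some injective linear map from the kernel at \<open>z0\<close> into
  the kernel there. These maps need not depend continuously on the parameter, so they may come from
  arbitrary choices of an isomorphism between \<open>w\<close> and \<open>F/\<psi>\<close>. The same
  elimination takes the place of determinants: it also yields openness of injectivity and continuity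
  of inversion. Sections are built through each prescribed point of the product, not merely over
  each \<open>\<psi>\<close>; this makes the map open, hence a quotient map.\<close>

lemma continuous_map_mult_complex:
  fixes f g :: "'a \<Rightarrow> complex"
  assumes "continuous_map X euclidean f" "continuous_map X euclidean g"
  shows "continuous_map X euclidean (\<lambda>x. f x * g x)"
  using assms by (simp add: continuous_map_atin tendsto_mult)

lemma continuous_map_divide_complex:
  fixes f g :: "'a \<Rightarrow> complex"
  assumes "continuous_map X euclidean f" "continuous_map X euclidean g"
    and "\<And>x. x \<in> topspace X \<Longrightarrow> g x \<noteq> 0"
  shows "continuous_map X euclidean (\<lambda>x. f x / g x)"
  using assms by (simp add: continuous_map_atin tendsto_divide)

text \<open>
  Gaussian elimination with the pivots chosen at \<open>z0\<close>, where they are nonzero, so that they stay nonzero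
  nearby; \<open>J\<close> indexes the free variables.
\<close>

lemma local_echelon:
  fixes Z :: "'z topology" and A :: "('z \<Rightarrow> 'i \<Rightarrow> complex) set"
  assumes "finite I" "z0 \<in> topspace Z"
    and "\<And>a i. a \<in> A \<Longrightarrow> i \<in> I \<Longrightarrow> continuous_map Z euclidean (\<lambda>z. a z i)"
  obtains U J c where "openin Z U" "z0 \<in> U" "J \<subseteq> I"
    and "\<And>i j. i \<in> I \<Longrightarrow> j \<in> J \<Longrightarrow> continuous_map (subtopology Z U) euclidean (\<lambda>z. c z i j :: complex)"
    and "\<And>z i j. z \<in> U \<Longrightarrow> i \<in> J \<Longrightarrow> j \<in> J \<Longrightarrow> c z i j = (if i = j then 1 else 0)"
    and "\<And>t a. a \<in> A \<Longrightarrow> (\<Sum>i\<in>I. a z0 i * (\<Sum>j\<in>J. c z0 i j * t j)) = 0"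
    and "\<And>z v i. z \<in> U \<Longrightarrow> \<forall>a\<in>A. (\<Sum>i\<in>I. a z i * v i) = 0 \<Longrightarrow> i \<in> I \<Longrightarrow>
           v i = (\<Sum>j\<in>J. c z i j * v j)"
proof -
  have "\<exists>U J c. openin Z U \<and> z0 \<in> U \<and> J \<subseteq> I
    \<and> (\<forall>i\<in>I. \<forall>j\<in>J. continuous_map (subtopology Z U) euclidean (\<lambda>z. c z i j :: complex))
    \<and> (\<forall>z\<in>U. \<forall>i\<in>J. \<forall>j\<in>J. c z i j = (if i = j then 1 else 0))
    \<and> (\<forall>a\<in>A. \<forall>t. (\<Sum>i\<in>I. a z0 i * (\<Sum>j\<in>J. c z0 i j * t j)) = 0)
    \<and> (\<forall>z\<in>U. \<forall>v. (\<forall>a\<in>A. (\<Sum>i\<in>I. a z i * v i) = 0) \<longrightarrow>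
           (\<forall>i\<in>I. v i = (\<Sum>j\<in>J. c z i j * v j)))"
    using assms
  \<comment> \<open>The unknowns are removed one at a time. \<open>Z\<close> and \<open>A\<close>
    have to vary, because a pivot restricts the space to the open set where it is nonzero and
    replaces the rows.\<close>
  proof (induction I arbitrary: Z A rule: finite_psubset_induct)
    case (psubset I)
    show ?case
    proof (cases "\<forall>a\<in>A. \<forall>i\<in>I. a z0 i = 0")
      \<comment> \<open>No pivot is left at \<open>z0\<close>, so every remaining variable is free
        and \<open>c\<close> is the identity. Rows may be nonzero away from \<open>z0\<close>; the
        claims survive since exact solvability is asserted at \<open>z0\<close> only.\<close>
      case True
      have *: "v i = (\<Sum>j\<in>I. (if i = j then 1 else 0) * v j)" if "i \<in> I" for v :: "'i \<Rightarrow> complex" and i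
      proof -
        have "(\<Sum>j\<in>I. (if i = j then 1 else 0) * v j) = (\<Sum>j\<in>I. if i = j then v j else 0)"
          by (rule sum.cong) auto
        then show ?thesis using that psubset.hyps by simp
      qed
      show ?thesis
        using True psubset.prems *
        by (intro exI[of _ "topspace Z"] exI[of _ I] exI[of _ "\<lambda>z i j. if i = j then 1 else 0"]) auto
    next
      case False
      then obtain a k where a: "a \<in> A" "k \<in> I" "a z0 k \<noteq> 0" by blast
      define U1 where "U1 = {z \<in> topspace Z. a z k \<in> - {0}}"
      have U1: "openin Z U1"
        unfolding U1_def using psubset.prems(2)[OF a(1,2)]
        by (rule openin_continuous_map_preimage) auto
      define I' where "I' = I - {k}"
      have I': "I' \<subset> I" "finite I'" "I = insert k I'" "k \<notin> I'" using a psubset.hyps by (auto simp: I'_def)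
      have sumI: "(\<Sum>i\<in>I. u i) = u k + (\<Sum>i\<in>I'. u i)" for u :: "'i \<Rightarrow> complex"
        using I' by simp
      \<comment> \<open>Row operation clearing the variable \<open>k\<close> with the pivot row
        \<open>a\<close>. Applied to \<open>a\<close> itself it gives the zero row on
        \<open>U1\<close>, so \<open>a\<close> can stay in the system.\<close>
      define e where "e = (\<lambda>b z i. b z i - b z k * a z i / a z k)"
      have nz: "a z k \<noteq> 0" if "z \<in> topspace (subtopology Z U1)" for z
        using that by (auto simp: U1_def)
      have cont: "continuous_map (subtopology Z U1) euclidean (\<lambda>z. b z i)" if "b \<in> A" "i \<in> I" for b i
        using psubset.prems(2)[OF that] by (rule continuous_map_from_subtopology)
      have "\<exists>U J c. openin (subtopology Z U1) U \<and> z0 \<in> U \<and> J \<subseteq> I'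
        \<and> (\<forall>i\<in>I'. \<forall>j\<in>J. continuous_map (subtopology (subtopology Z U1) U) euclidean (\<lambda>z. c z i j :: complex))
        \<and> (\<forall>z\<in>U. \<forall>i\<in>J. \<forall>j\<in>J. c z i j = (if i = j then 1 else 0))
        \<and> (\<forall>b\<in>e ` A. \<forall>t. (\<Sum>i\<in>I'. b z0 i * (\<Sum>j\<in>J. c z0 i j * t j)) = 0)
        \<and> (\<forall>z\<in>U. \<forall>v. (\<forall>b\<in>e ` A. (\<Sum>i\<in>I'. b z i * v i) = 0) \<longrightarrow>
           (\<forall>i\<in>I'. v i = (\<Sum>j\<in>J. c z i j * v j)))"
      proof (rule psubset.IH[OF I'(1)])
        show "z0 \<in> topspace (subtopology Z U1)" using psubset.prems a by (simp add: U1_def)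
        fix b i assume "b \<in> e ` A" "i \<in> I'"
        then obtain b' where b': "b' \<in> A" "b = e b'" "i \<in> I" using I' by auto
        show "continuous_map (subtopology Z U1) euclidean (\<lambda>z. b z i)"
          unfolding b' e_def
          by (intro continuous_map_diff continuous_map_mult_complex continuous_map_divide_complex
              cont a b' nz)
      qed
      then obtain U J c where
        U: "openin (subtopology Z U1) U" "z0 \<in> U" and J: "J \<subseteq> I'" and
        c: "\<forall>i\<in>I'. \<forall>j\<in>J. continuous_map (subtopology (subtopology Z U1) U) euclidean (\<lambda>z. c z i j :: complex)" and
        cJ: "\<forall>z\<in>U. \<forall>i\<in>J. \<forall>j\<in>J. c z i j = (if i = j then 1 else 0)" and
        c1: "\<forall>b\<in>e ` A. \<forall>t. (\<Sum>i\<in>I'. b z0 i * (\<Sum>j\<in>J. c z0 i j * t j)) = 0" and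
        c2: "\<forall>z\<in>U. \<forall>v. (\<forall>b\<in>e ` A. (\<Sum>i\<in>I'. b z i * v i) = 0) \<longrightarrow>
           (\<forall>i\<in>I'. v i = (\<Sum>j\<in>J. c z i j * v j))"
        by (elim exE conjE) (rule that)
      \<comment> \<open>Back substitution: the row \<open>k\<close> of \<open>C\<close> solves the
        equation of \<open>a\<close> for the variable \<open>k\<close>. As \<open>k\<close> is not
        in \<open>J\<close>, the identity block on \<open>J\<close> is untouched.\<close>
      define C where "C = (\<lambda>z i j. if i = k then - (\<Sum>i\<in>I'. a z i * c z i j) / a z k else c z i j)"
      have UU1: "U \<subseteq> U1" "openin Z U"
        using U U1 openin_subset[OF U(1)] openin_trans_full by fastforce+
      have top: "subtopology (subtopology Z U1) U = subtopology Z U"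
        using UU1 by (simp add: subtopology_subtopology inf.absorb2)
      have C': "C z i j = c z i j" if "i \<in> I'" for z i j
        using that I' by (auto simp: C_def)
      have Ccont: "continuous_map (subtopology Z U) euclidean (\<lambda>z. C z i j)" if "i \<in> I" "j \<in> J" for i j
      proof (cases "i = k")
        case False
        then show ?thesis using c that J I' top by (auto simp: C_def)
      next
        case True
        have *: "continuous_map (subtopology Z U) euclidean (\<lambda>z. a z l)" if "l \<in> I" for l
          using psubset.prems(2)[OF a(1) that] by (rule continuous_map_from_subtopology)
        have "continuous_map (subtopology Z U) euclidean
            (\<lambda>z. - (\<Sum>i\<in>I'. a z i * c z i j) / a z k)"
        proof (intro continuous_map_divide_complex continuous_map_minus continuous_map_sum
            continuous_map_mult_complex * a I')
          show "a z k \<noteq> 0" if "z \<in> topspace (subtopology Z U)" for z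
            using that UU1 by (auto simp: U1_def)
        qed (use c that J I' top in auto)
        then show ?thesis using True by (simp add: C_def)
      qed
      have C1: "(\<Sum>i\<in>I. b z0 i * (\<Sum>j\<in>J. C z0 i j * t j)) = 0" if b: "b \<in> A" for b t
      proof -
        define v where "v i = (\<Sum>j\<in>J. C z0 i j * t j)" for i
        have v': "v i = (\<Sum>j\<in>J. c z0 i j * t j)" if "i \<in> I'" for i
          using that C' by (simp add: v_def)
        have "v k = - (\<Sum>j\<in>J. \<Sum>i\<in>I'. a z0 i * c z0 i j * t j) / a z0 k"
          by (simp add: v_def C_def sum_divide_distrib sum_distrib_right sum_negf)
        also have "\<dots> = - (\<Sum>i\<in>I'. \<Sum>j\<in>J. a z0 i * c z0 i j * t j) / a z0 k"
          by (subst sum.swap) simp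
        also have "\<dots> = - (\<Sum>i\<in>I'. a z0 i * v i) / a z0 k"
          by (simp add: v' sum_distrib_left mult.assoc)
        finally have vk: "v k = - (\<Sum>i\<in>I'. a z0 i * v i) / a z0 k" .
        have "(\<Sum>i\<in>I'. e b z0 i * v i) = (\<Sum>i\<in>I'. e b z0 i * (\<Sum>j\<in>J. c z0 i j * t j))"
          by (intro sum.cong) (auto simp: v')
        then have "(\<Sum>i\<in>I'. e b z0 i * v i) = 0" using c1 b by auto
        moreover have "(\<Sum>i\<in>I'. e b z0 i * v i)
            = (\<Sum>i\<in>I'. b z0 i * v i) - (\<Sum>i\<in>I'. a z0 i * v i) * b z0 k / a z0 k"
          by (simp add: e_def algebra_simps sum_subtractf sum_distrib_left sum_divide_distrib)
        ultimately have "(\<Sum>i\<in>I. b z0 i * v i) = 0"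
          using vk by (simp add: sumI)
        then show ?thesis by (simp add: v_def)
      qed
      have C2: "v i = (\<Sum>j\<in>J. C z i j * v j)"
        if z: "z \<in> U" and v: "\<forall>b\<in>A. (\<Sum>i\<in>I. b z i * v i) = 0" and i: "i \<in> I" for z v i
      proof -
        have az: "a z k \<noteq> 0" using z UU1 by (auto simp: U1_def)
        have ak: "a z k * v k + (\<Sum>i\<in>I'. a z i * v i) = 0"
          using v a by (simp add: sumI)
        have "(\<Sum>i\<in>I'. e b z i * v i) = 0" if "b \<in> A" for b
        proof -
          have bk: "b z k * v k + (\<Sum>i\<in>I'. b z i * v i) = 0"
            using v that by (simp add: sumI)
          have "(\<Sum>i\<in>I'. e b z i * v i)
            = (\<Sum>i\<in>I'. b z i * v i) - (\<Sum>i\<in>I'. a z i * v i) * b z k / a z k"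
            by (simp add: e_def algebra_simps sum_subtractf sum_distrib_left sum_divide_distrib)
          moreover have "(\<Sum>i\<in>I'. b z i * v i) = - (b z k * v k)" "(\<Sum>i\<in>I'. a z i * v i) = - (a z k * v k)"
            using ak bk by (simp_all add: eq_neg_iff_add_eq_0 add.commute)
          ultimately show ?thesis using az by simp
        qed
        then have v': "v i = (\<Sum>j\<in>J. c z i j * v j)" if "i \<in> I'" for i
          using c2 z that by blast
        show ?thesis
        proof (cases "i = k")
          case False
          then show ?thesis using v' i I' by (auto simp: C_def)
        next
          case True
          have *: "(\<Sum>j\<in>J. a z i * c z i j * v j) = a z i * v i" if "i \<in> I'" for i
            by (subst v'[OF that]) (simp add: sum_distrib_left mult.assoc)
          have "(\<Sum>j\<in>J. C z k j * v j) = - (\<Sum>j\<in>J. \<Sum>i\<in>I'. a z i * c z i j * v j) / a z k"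
            by (simp add: C_def sum_divide_distrib sum_distrib_right sum_negf)
          also have "\<dots> = - (\<Sum>i\<in>I'. \<Sum>j\<in>J. a z i * c z i j * v j) / a z k"
            by (subst sum.swap) simp
          also have "\<dots> = - (\<Sum>i\<in>I'. a z i * v i) / a z k"
            using * by simp
          also have "\<dots> = v k" using ak az by (simp add: field_simps add_eq_0_iff)
          finally show ?thesis using True by simp
        qed
      qed
      have CJ: "C z i j = (if i = j then 1 else 0)" if "z \<in> U" "i \<in> J" "j \<in> J" for z i j
        using that cJ J C' by auto
      show ?thesis
      proof (intro exI[of _ U] exI[of _ J] exI[of _ C] conjI ballI allI impI)
        show "openin Z U" "z0 \<in> U" "J \<subseteq> I" using UU1 U J I' by auto
      qed (rule Ccont CJ C1 C2; assumption)+
    qed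
  qed
  then show ?thesis
  proof (elim exE conjE, goal_cases)
    case (1 U J c)
    show ?thesis
      by (rule that[where c = c, OF 1(1-3)]) (use 1(4-7) in blast)+
  qed
qed

lemma sum_mult_delta:
  fixes t :: "'i \<Rightarrow> complex"
  assumes "finite J"
  shows "(\<Sum>j\<in>J. t j * (if i = j then 1 else 0)) = (if i \<in> J then t i else 0)"
    and "(\<Sum>j\<in>J. t j * (if j = i then 1 else 0)) = (if i \<in> J then t i else 0)"
    and "(\<Sum>j\<in>J. (if i = j then 1 else 0) * t j) = (if i \<in> J then t i else 0)"
    and "(\<Sum>j\<in>J. (if j = i then 1 else 0) * t j) = (if i \<in> J then t i else 0)"
  using assms by (simp_all add: if_distrib[of "\<lambda>x. _ * x"] if_distrib[of "\<lambda>x. x * _"] cong: if_cong)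

text \<open>Dimension count. Injectivity makes the columns independent; if \<open>y\<close> were
  outside their span, adding it would give one more independent vector than there are unit vectors
  spanning the space.\<close>

lemma matrix_inj_imp_surj:
  fixes m :: "'i \<Rightarrow> 'i \<Rightarrow> complex"
  assumes J: "finite J"
    and inj: "\<And>t. \<forall>i\<in>J. (\<Sum>j\<in>J. m i j * t j) = 0 \<Longrightarrow> \<forall>j\<in>J. t j = 0"
  obtains t where "\<And>i. i \<in> J \<Longrightarrow> (\<Sum>j\<in>J. m i j * t j) = y i"
proof -
  \<comment> \<open>The ambient space consists of functions on the whole index type with pointwise
    operations; vectors indexed by \<open>J\<close> are extended by 0.\<close>
  interpret vector_space "\<lambda>(c::complex) (f::'i \<Rightarrow> complex) i. c * f i"
    by unfold_locales (auto simp: fun_eq_iff algebra_simps)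
  have app: "(\<Sum>j\<in>J. f j) i = (\<Sum>j\<in>J. f j i)" for f :: "'i \<Rightarrow> 'i \<Rightarrow> complex" and i
    using J by (induction J) auto
  define u :: "'i \<Rightarrow> 'i \<Rightarrow> complex" where "u j i = (if i = j then 1 else 0)" for i j
  define N where "N j i = (if i \<in> J then m i j else 0)" for i j
  define V where "V = {t :: 'i \<Rightarrow> complex. \<forall>i. i \<notin> J \<longrightarrow> t i = 0}"
  have span: "V \<subseteq> span (u ` J)"
  proof
    fix t assume "t \<in> V"
    then have "t = (\<Sum>j\<in>J. (\<lambda>i. t j * u j i))"
      using J by (auto simp: fun_eq_iff app u_def V_def sum_mult_delta)
    moreover have "(\<Sum>j\<in>J. (\<lambda>i. t j * u j i)) \<in> span (u ` J)"
      by (intro span_sum span_scale span_base) auto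
    ultimately show "t \<in> span (u ` J)" by simp
  qed
  have zero: "t j = 0" if "(\<Sum>j\<in>J. (\<lambda>i. t j * N j i)) = 0" "j \<in> J" for t j
  proof -
    have "(\<Sum>j\<in>J. m i j * t j) = 0" if "i \<in> J" for i
      using fun_cong[OF \<open>(\<Sum>j\<in>J. (\<lambda>i. t j * N j i)) = 0\<close>, of i] that
      by (simp add: app N_def mult.commute)
    then show ?thesis using inj that by blast
  qed
  \<comment> \<open>Independence speaks of the set of columns, so coinciding columns are excluded
    separately: two equal ones satisfy the relation with coefficients 1 and -1.\<close>
  have injN: "inj_on N J"
  proof (rule inj_onI, rule ccontr)
    fix j k assume jk: "j \<in> J" "k \<in> J" "N j = N k" "j \<noteq> k"
    let ?t = "\<lambda>l. (if l = j then 1 else 0) - (if l = k then 1 else 0) :: complex"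
    have "(\<Sum>l\<in>J. (\<lambda>i. ?t l * N l i)) = 0"
      using J jk by (simp add: fun_eq_iff app left_diff_distrib sum_subtractf sum_mult_delta)
    then have "?t j = 0" by (rule zero) (rule jk(1))
    then show False using jk by simp
  qed
  have indep: "independent (N ` J)"
  proof (rule independent_if_scalars_zero)
    fix f x assume "(\<Sum>x\<in>N ` J. (\<lambda>i. f x * x i)) = 0" "x \<in> N ` J"
    then show "f x = 0"
      using zero[of "\<lambda>j. f (N j)"] by (auto simp: sum.reindex[OF injN] o_def)
  qed (use J in simp)
  define y' where "y' i = (if i \<in> J then y i else 0)" for i
  have "y' \<in> span (N ` J)"
  proof (rule ccontr)
    assume y': "y' \<notin> span (N ` J)"
    have "insert y' (N ` J) \<subseteq> span (u ` J)"
      by (rule order_trans[OF _ span]) (auto simp: V_def N_def y'_def)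
    then have "card (insert y' (N ` J)) \<le> card (u ` J)"
      using independent_span_bound[OF _ independent_insertI[OF y' indep]] J by blast
    moreover have "y' \<notin> N ` J" using y' span_base by blast
    ultimately show False
      using J card_image[OF injN] card_image_le[OF J, of u] by simp
  qed
  then obtain t where t: "y' = (\<Sum>x\<in>N ` J. (\<lambda>i. t x * x i))"
    using span_finite[of "N ` J"] J by auto
  show ?thesis
  proof
    fix i assume i: "i \<in> J"
    have "y' i = (\<Sum>j\<in>J. t (N j) * N j i)"
      unfolding t by (simp add: sum.reindex[OF injN] o_def app)
    then show "(\<Sum>j\<in>J. m i j * t (N j)) = y i"
      using i by (simp add: y'_def N_def mult.commute)
  qed
qed

section \<open>Finite-dimensional spaces in coordinates\<close>

text \<open>The closure clauses stand in for the module axioms: any other identity in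
  \<open>V\<close> can be checked after applying the injective map \<open>f\<close>. Thus
  \<open>hom_space\<close> can be handled in the same way as the given spaces.\<close>

definition coordinates :: "(complex, 'a) module \<Rightarrow> nat \<Rightarrow> ('a \<Rightarrow> nat \<Rightarrow> complex) \<Rightarrow> bool" where
  "coordinates V n f \<longleftrightarrow> f \<in> lin_isos V (coord_space n) \<and>
     (\<forall>u\<in>carrier V. \<forall>v\<in>carrier V. u \<oplus>\<^bsub>V\<^esub> v \<in> carrier V) \<and>
     (\<forall>c. \<forall>v\<in>carrier V. c \<odot>\<^bsub>V\<^esub> v \<in> carrier V)"

definition linear_form :: "(complex, 'a) module \<Rightarrow> ('a \<Rightarrow> complex) \<Rightarrow> bool" where
  "linear_form V l \<longleftrightarrow> (\<forall>u\<in>carrier V. \<forall>v\<in>carrier V. l (u \<oplus>\<^bsub>V\<^esub> v) = l u + l v) \<and>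
     (\<forall>c. \<forall>v\<in>carrier V. l (c \<odot>\<^bsub>V\<^esub> v) = c * l v)"

text \<open>The \<open>k\<close>-th basis vector belonging to a coordinate map \<open>f\<close>. For
  \<open>k \<ge> n\<close> the prescribed tuple is zero, so the vector lies in the carrier for every
  \<open>k\<close>.\<close>

definition coordinate_vector :: "(complex, 'a) module \<Rightarrow> nat \<Rightarrow> ('a \<Rightarrow> nat \<Rightarrow> complex) \<Rightarrow> nat \<Rightarrow> 'a" where
  "coordinate_vector V n f k = inv_into (carrier V) f (\<lambda>j\<in>{..<n}. if j = k then 1 else 0)"

lemma fd_space_coordinates:
  assumes "fd_space V"
  obtains n f where "coordinates V n f"
proof -
  interpret Module.module complex_field V using assms by (simp add: fd_space_def)
  obtain n f where "f \<in> lin_isos V (coord_space n)" using assms by (auto simp: fd_space_def)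
  then have "coordinates V n f"
    using smult_closed by (simp add: coordinates_def complex_field_def)
  then show ?thesis by (rule that)
qed

lemma coordinatesD:
  assumes "coordinates V n f"
  shows "\<And>v. v \<in> carrier V \<Longrightarrow> f v \<in> {..<n} \<rightarrow>\<^sub>E UNIV"
    and "\<And>u v. u \<in> carrier V \<Longrightarrow> v \<in> carrier V \<Longrightarrow> u \<oplus>\<^bsub>V\<^esub> v \<in> carrier V"
    and "\<And>c v. v \<in> carrier V \<Longrightarrow> c \<odot>\<^bsub>V\<^esub> v \<in> carrier V"
    and "inj_on f (carrier V)"
    and "\<And>y. y \<in> {..<n} \<rightarrow>\<^sub>E UNIV \<Longrightarrow> inv_into (carrier V) f y \<in> carrier V"
    and "\<And>y. y \<in> {..<n} \<rightarrow>\<^sub>E UNIV \<Longrightarrow> f (inv_into (carrier V) f y) = y"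
    and "\<And>v. v \<in> carrier V \<Longrightarrow> inv_into (carrier V) f (f v) = v"
    and "f ` carrier V = {..<n} \<rightarrow>\<^sub>E UNIV"
    and "\<And>k. coordinate_vector V n f k \<in> carrier V"
    and "\<And>j k. j < n \<Longrightarrow> f (coordinate_vector V n f k) j = (if j = k then 1 else 0)"
    and "\<And>i. i < n \<Longrightarrow> linear_form V (\<lambda>v. f v i)"
proof -
  have f: "lin_map V (coord_space n) f" "inj_on f (carrier V)" "f ` carrier V = {..<n} \<rightarrow>\<^sub>E UNIV"
    using assms by (auto simp: coordinates_def lin_isos_def bij_betw_def coord_space_def)
  then show "inj_on f (carrier V)" "f ` carrier V = {..<n} \<rightarrow>\<^sub>E UNIV" by auto
  show "f v \<in> {..<n} \<rightarrow>\<^sub>E UNIV" if "v \<in> carrier V" for v using f that by blast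
  show "u \<oplus>\<^bsub>V\<^esub> v \<in> carrier V" if "u \<in> carrier V" "v \<in> carrier V" for u v
    using assms that by (simp add: coordinates_def)
  show "c \<odot>\<^bsub>V\<^esub> v \<in> carrier V" if "v \<in> carrier V" for c v
    using assms that by (simp add: coordinates_def)
  show *: "inv_into (carrier V) f y \<in> carrier V" "f (inv_into (carrier V) f y) = y"
    if "y \<in> {..<n} \<rightarrow>\<^sub>E UNIV" for y
    using that f(3) by (metis inv_into_into, metis f_inv_into_f)
  show "inv_into (carrier V) f (f v) = v" if "v \<in> carrier V" for v using that f by simp
  show "coordinate_vector V n f k \<in> carrier V" for k
    unfolding coordinate_vector_def by (rule *) simp
  show "f (coordinate_vector V n f k) j = (if j = k then 1 else 0)" if "j < n" for j k
    unfolding coordinate_vector_def by (subst *(2)) (use that in auto)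
  show "linear_form V (\<lambda>v. f v i)" if "i < n" for i
    using f(1) that by (simp add: linear_form_def lin_map_def coord_space_def)
qed

lemma coordinates_eqI:
  assumes "coordinates V n f" "u \<in> carrier V" "v \<in> carrier V" "\<And>i. i < n \<Longrightarrow> f u i = f v i"
  shows "u = v"
proof -
  have "f u = f v"
    using assms coordinatesD(1)[OF assms(1)] by (intro PiE_ext[of _ "{..<n}" "\<lambda>_. UNIV"]) auto
  then show ?thesis using coordinatesD(4)[OF assms(1)] assms by (simp add: inj_on_def)
qed

text \<open>Induction over the truncations \<open>p k\<close> of \<open>v\<close>, which keep the
  coordinates below \<open>k\<close> and set the others to 0. In this way no finite sums inside the
  carrier of \<open>V\<close> have to be formed.\<close>

lemma linear_form_expand:
  assumes f: "coordinates V n f" and l: "linear_form V l" and v: "v \<in> carrier V"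
  shows "l v = (\<Sum>i<n. f v i * l (coordinate_vector V n f i))"
proof -
  note D = coordinatesD[OF f]
  define p where "p k = inv_into (carrier V) f (\<lambda>j\<in>{..<n}. if j < k then f v j else 0)" for k
  have p: "p k \<in> carrier V" "f (p k) = (\<lambda>j\<in>{..<n}. if j < k then f v j else 0)" for k
    unfolding p_def by (rule D; simp)+
  have lin: "w \<in> carrier V \<Longrightarrow> f (u \<oplus>\<^bsub>V\<^esub> w) i = f u i + f w i" "f (c \<odot>\<^bsub>V\<^esub> u) i = c * f u i"
    if "u \<in> carrier V" "i < n" for u w c i
    using D(11)[OF that(2)] that by (auto simp: linear_form_def)
  have "l (p k) = (\<Sum>i<k. f v i * l (coordinate_vector V n f i))" if "k \<le> n" for k
    using that
  proof (induction k)
    case 0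
    \<comment> \<open>A \<open>linear_form\<close> has no clause about a zero vector;
      \<open>l\<close> vanishes at \<open>p 0\<close> because this vector is 0 times itself.\<close>
    have "p 0 = 0 \<odot>\<^bsub>V\<^esub> p 0"
      by (rule coordinates_eqI[OF f]) (auto simp: p D lin)
    then have "l (p 0) = 0 * l (p 0)"
      using l p(1)[of 0] by (metis linear_form_def)
    then show ?case by simp
  next
    case (Suc k)
    have "p (Suc k) = p k \<oplus>\<^bsub>V\<^esub> (f v k \<odot>\<^bsub>V\<^esub> coordinate_vector V n f k)"
      by (rule coordinates_eqI[OF f]) (auto simp: p D lin less_Suc_eq)
    then have "l (p (Suc k)) = l (p k) + f v k * l (coordinate_vector V n f k)"
      using l p(1) D(3,9) by (simp add: linear_form_def)
    then show ?case using Suc by simp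
  qed
  moreover have "p n = v"
    by (rule coordinates_eqI[OF f]) (auto simp: p v)
  ultimately show ?thesis by fastforce
qed

lemma continuous_map_coord_topology:
  "continuous_map Z (coord_topology n) h \<longleftrightarrow>
     h \<in> topspace Z \<rightarrow> {..<n} \<rightarrow>\<^sub>E UNIV \<and> (\<forall>i<n. continuous_map Z euclidean (\<lambda>z. h z i))"
  unfolding coord_topology_def continuous_map_componentwise
  by (auto simp: PiE_def)

lemma linear_form_lin_map:
  assumes "lin_map V W T" "linear_form W l"
  shows "linear_form V (\<lambda>v. l (T v))"
  using assms by (auto simp: lin_map_def linear_form_def Pi_iff)

text \<open>The topology quantifies over all coordinate maps \<open>g\<close>. One of them suffices,
  since the transition from \<open>g\<close> to \<open>f\<close> is linear in finitely many
  coordinates and therefore continuous.\<close>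

lemma openin_fd_topology_coordinates:
  assumes f: "coordinates V n f"
  shows "openin (fd_topology V) U \<longleftrightarrow> U \<subseteq> carrier V \<and> openin (coord_topology n) (f ` U)"
proof -
  note D = coordinatesD[OF f]
  have "openin (coord_topology m) (g ` U)"
    if U: "U \<subseteq> carrier V" "openin (coord_topology n) (f ` U)" and g: "g \<in> lin_isos V (coord_space m)"
    for m g
  proof -
    have g': "coordinates V m g" using f g by (simp add: coordinates_def)
    note E = coordinatesD[OF g']
    let ?k = "\<lambda>y. f (inv_into (carrier V) g y)"
    have "f (inv_into (carrier V) g y) i = (\<Sum>j<m. y j * f (coordinate_vector V m g j) i)"
      if "y \<in> {..<m} \<rightarrow>\<^sub>E UNIV" "i < n" for y i
      using linear_form_expand[OF g' D(11)[OF that(2)] E(5)[OF that(1)]] E(6)[OF that(1)] by simp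
    then have expand: "(\<Sum>j<m. y j * f (coordinate_vector V m g j) i) = f (inv_into (carrier V) g y) i"
      if "y \<in> topspace (coord_topology m)" "i < n" for y i
      using that by (simp add: coord_topology_def)
    have proj: "continuous_map (coord_topology m) euclidean (\<lambda>y. y j)" if "j \<in> {..<m}" for j
      unfolding coord_topology_def using that by (rule continuous_map_product_projection)
    have k: "continuous_map (coord_topology m) euclidean (\<lambda>y. f (inv_into (carrier V) g y) i)"
      if "i < n" for i
    proof (rule continuous_map_eq[OF _ expand[OF _ that]])
      show "continuous_map (coord_topology m) euclidean (\<lambda>y. \<Sum>j<m. y j * f (coordinate_vector V m g j) i)"
        by (intro continuous_map_sum continuous_map_mult_complex proj) simp_all
    qed
    have "?k \<in> topspace (coord_topology m) \<rightarrow> {..<n} \<rightarrow>\<^sub>E UNIV"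
      using E(5) D(1) by (auto simp: coord_topology_def simp del: PiE_iff)
    then have "continuous_map (coord_topology m) (coord_topology n) ?k"
      using k by (simp add: continuous_map_coord_topology)
    then have "openin (coord_topology m) {y \<in> topspace (coord_topology m). ?k y \<in> f ` U}"
      using U(2) by (rule openin_continuous_map_preimage)
    moreover have "{y \<in> topspace (coord_topology m). ?k y \<in> f ` U} = g ` U"
    proof (intro equalityI subsetI)
      fix y assume "y \<in> {y \<in> topspace (coord_topology m). ?k y \<in> f ` U}"
      then have y: "y \<in> {..<m} \<rightarrow>\<^sub>E UNIV" "?k y \<in> f ` U" by (auto simp: coord_topology_def)
      then have "inv_into (carrier V) g y \<in> U"
        using D(4) E(5) U(1) by (auto dest!: inj_onD[OF D(4)])
      then show "y \<in> g ` U" using E(6)[OF y(1)] by force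
    next
      fix y assume "y \<in> g ` U"
      then obtain v where v: "v \<in> U" "y = g v" "v \<in> carrier V" using U(1) by blast
      then have "y \<in> {..<m} \<rightarrow>\<^sub>E UNIV" using E(1) by blast
      then show "y \<in> {y \<in> topspace (coord_topology m). ?k y \<in> f ` U}"
        using v E(7) by (simp add: coord_topology_def)
    qed
    ultimately show ?thesis by simp
  qed
  then show ?thesis
    using f by (auto simp: openin_fd_topology coordinates_def)
qed

lemma continuous_map_fd_topology:
  assumes f: "coordinates V n f"
  shows "continuous_map Z (fd_topology V) h \<longleftrightarrow>
     h \<in> topspace Z \<rightarrow> carrier V \<and> (\<forall>i<n. continuous_map Z euclidean (\<lambda>z. f (h z) i))"
    (is "_ \<longleftrightarrow> ?R")
proof -
  note D = coordinatesD[OF f]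
  have top: "topspace (coord_topology n) = {..<n} \<rightarrow>\<^sub>E UNIV" by (simp add: coord_topology_def)
  have f_cont: "continuous_map (fd_topology V) (coord_topology n) f"
    unfolding continuous_map_def openin_fd_topology_coordinates[OF f] topspace_fd_topology top
  proof (intro conjI allI impI)
    fix U assume U: "openin (coord_topology n) U"
    then have "U \<subseteq> f ` carrier V" using openin_subset[OF U] top D(8) by simp
    then have "f ` {v \<in> carrier V. f v \<in> U} = U" by auto
    then show "openin (coord_topology n) (f ` {v \<in> carrier V. f v \<in> U})" using U by simp
  qed (use D(1) in auto)
  show ?thesis
  proof
    assume h: "continuous_map Z (fd_topology V) h"
    have "continuous_map Z (coord_topology n) (f \<circ> h)"
      using h f_cont by (rule continuous_map_compose)
    then show ?R
      using continuous_map_funspace[OF h] by (simp add: continuous_map_coord_topology)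
  next
    assume R: ?R
    then have fh: "continuous_map Z (coord_topology n) (\<lambda>z. f (h z))"
      using D(1) by (auto simp: continuous_map_coord_topology Pi_iff simp del: PiE_iff)
    show "continuous_map Z (fd_topology V) h"
      unfolding continuous_map_def openin_fd_topology_coordinates[OF f] topspace_fd_topology
    proof (intro conjI allI impI)
      show "h \<in> topspace Z \<rightarrow> carrier V" using R by blast
      fix U assume U: "U \<subseteq> carrier V \<and> openin (coord_topology n) (f ` U)"
      then have "openin Z {z \<in> topspace Z. f (h z) \<in> f ` U}"
        using openin_continuous_map_preimage[OF fh] by blast
      moreover have "{z \<in> topspace Z. f (h z) \<in> f ` U} = {z \<in> topspace Z. h z \<in> U}"
        using R U inj_on_image_mem_iff[OF D(4)] by blast
      ultimately show "openin Z {z \<in> topspace Z. h z \<in> U}" by simp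
    qed
  qed
qed

text \<open>Linearity upgrades separate to joint continuity: \<open>l z (h z)\<close> is a finite
  sum of coordinates of \<open>h z\<close> times the values of \<open>l z\<close> on a fixed
  basis.\<close>

lemma continuous_map_linear_form:
  assumes f: "coordinates V n f" and l: "\<And>z. z \<in> topspace Z \<Longrightarrow> linear_form V (l z)"
    and "\<And>v. v \<in> carrier V \<Longrightarrow> continuous_map Z euclidean (\<lambda>z. l z v)"
    and h: "continuous_map Z (fd_topology V) h"
  shows "continuous_map Z euclidean (\<lambda>z. l z (h z))"
proof (rule continuous_map_eq)
  show "continuous_map Z euclidean (\<lambda>z. \<Sum>i<n. f (h z) i * l z (coordinate_vector V n f i))"
    using h assms(3) coordinatesD(9)[OF f]
    by (intro continuous_map_sum continuous_map_mult_complex)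
      (auto simp: continuous_map_fd_topology[OF f])
  show "(\<Sum>i<n. f (h z) i * l z (coordinate_vector V n f i)) = l z (h z)" if "z \<in> topspace Z" for z
    using linear_form_expand[OF f l[OF that], of "h z"] h that
    by (auto simp: continuous_map_fd_topology[OF f] Pi_iff)
qed

text \<open>Vector-valued form of the same principle, obtained by composing \<open>T z\<close> with
  each coordinate of \<open>W\<close>.\<close>

lemma continuous_map_apply:
  assumes f: "coordinates V n f" and g: "coordinates W m g"
    and T: "\<And>z. z \<in> topspace Z \<Longrightarrow> lin_map V W (T z)"
    and Tv: "\<And>v. v \<in> carrier V \<Longrightarrow> continuous_map Z (fd_topology W) (\<lambda>z. T z v)"
    and h: "continuous_map Z (fd_topology V) h"
  shows "continuous_map Z (fd_topology W) (\<lambda>z. T z (h z))"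
  unfolding continuous_map_fd_topology[OF g]
proof (intro conjI allI impI)
  show "(\<lambda>z. T z (h z)) \<in> topspace Z \<rightarrow> carrier W"
    using T continuous_map_funspace[OF h] by (auto simp: lin_map_def Pi_iff)
  fix i assume i: "i < m"
  show "continuous_map Z euclidean (\<lambda>z. g (T z (h z)) i)"
  proof (rule continuous_map_linear_form[OF f _ _ h, where l = "\<lambda>z v. g (T z v) i"])
    show "linear_form V (\<lambda>v. g (T z v) i)" if "z \<in> topspace Z" for z
      using linear_form_lin_map[OF T[OF that] coordinatesD(11)[OF g i]] .
    show "continuous_map Z euclidean (\<lambda>z. g (T z v) i)" if "v \<in> carrier V" for v
      using Tv[OF that] i by (simp add: continuous_map_fd_topology[OF g])
  qed
qed

text \<open>The matrix of \<open>T\<close>, flattened: the index \<open>i * m + j\<close> holds the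
  \<open>j\<close>-th coordinate of the image of the \<open>i\<close>-th basis vector. For
  \<open>m = 0\<close> there are no indices, so the division is harmless.\<close>

definition hom_coordinates ::
  "(complex, 'a) module \<Rightarrow> nat \<Rightarrow> ('a \<Rightarrow> nat \<Rightarrow> complex) \<Rightarrow> (complex, 'b) module \<Rightarrow> nat
    \<Rightarrow> ('b \<Rightarrow> nat \<Rightarrow> complex) \<Rightarrow> ('a \<Rightarrow> 'b) \<Rightarrow> nat \<Rightarrow> complex" where
  "hom_coordinates V n f W m g = (\<lambda>T\<in>carrier (hom_space V W). \<lambda>k\<in>{..<n * m}.
     g (T (coordinate_vector V n f (k div m))) (k mod m))"

lemma carrier_hom_space:
  "T \<in> carrier (hom_space V W) \<longleftrightarrow> T \<in> extensional (carrier V) \<and> lin_map V W T"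
  by (simp add: hom_space_def)

lemma coordinates_hom_space:
  assumes f: "coordinates V n f" and g: "coordinates W m g"
  shows "coordinates (hom_space V W) (n * m) (hom_coordinates V n f W m g)"
proof -
  note D = coordinatesD[OF f] and E = coordinatesD[OF g]
  let ?H = "hom_space V W" and ?c = "hom_coordinates V n f W m g"
  have gl: "w \<in> carrier W \<Longrightarrow> g (u \<oplus>\<^bsub>W\<^esub> w) i = g u i + g w i" "g (c \<odot>\<^bsub>W\<^esub> u) i = c * g u i"
    if "u \<in> carrier W" "i < m" for u w c i
    using E(11)[OF that(2)] that by (auto simp: linear_form_def)
  have TW: "T v \<in> carrier W" if "lin_map V W T" "v \<in> carrier V" for T v
    using that by (auto simp: lin_map_def)
  have add: "S \<oplus>\<^bsub>?H\<^esub> T \<in> carrier ?H" if "S \<in> carrier ?H" "T \<in> carrier ?H" for S T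
  proof -
    have ST: "lin_map V W S" "lin_map V W T" using that by (auto simp: hom_space_def)
    then have "lin_map V W (\<lambda>v\<in>carrier V. S v \<oplus>\<^bsub>W\<^esub> T v)"
      using E(2,3) D(2,3) TW unfolding lin_map_def
      by (auto simp: Pi_iff gl algebra_simps intro!: coordinates_eqI[OF g])
    then show ?thesis by (simp add: hom_space_def)
  qed
  have smult: "c \<odot>\<^bsub>?H\<^esub> T \<in> carrier ?H" if "T \<in> carrier ?H" for c T
  proof -
    have T: "lin_map V W T" using that by (auto simp: hom_space_def)
    then have "lin_map V W (\<lambda>v\<in>carrier V. c \<odot>\<^bsub>W\<^esub> T v)"
      using E(2,3) D(2,3) TW unfolding lin_map_def
      by (auto simp: Pi_iff gl algebra_simps intro!: coordinates_eqI[OF g])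
    then show ?thesis by (simp add: hom_space_def)
  qed
  \<comment> \<open>An index below \<open>n * m\<close> forces \<open>m\<close> to be positive,
    which the bound on the remainder needs.\<close>
  have km: "k div m < n" "k mod m < m" if "k < n * m" for k
    using that by (simp add: less_mult_imp_div_less, metis gr_zeroI mod_less_divisor mult_0_right not_less_zero)
  have lin: "lin_map ?H (coord_space (n * m)) ?c"
    unfolding lin_map_def
  proof (intro conjI ballI allI)
    show "?c \<in> carrier ?H \<rightarrow> carrier (coord_space (n * m))"
      by (auto simp: hom_coordinates_def coord_space_def)
  next
    fix S T assume ST: "S \<in> carrier ?H" "T \<in> carrier ?H"
    then have "S (coordinate_vector V n f i) \<in> carrier W" "T (coordinate_vector V n f i) \<in> carrier W" for i
      using TW D(9) by (auto simp: carrier_hom_space)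
    then have "?c (S \<oplus>\<^bsub>?H\<^esub> T) k = (?c S \<oplus>\<^bsub>coord_space (n * m)\<^esub> ?c T) k" for k
      using add[OF ST] ST km[of k] D(9)
      by (cases "k < n * m") (simp_all add: hom_coordinates_def coord_space_def gl, simp add: hom_space_def gl)
    then show "?c (S \<oplus>\<^bsub>?H\<^esub> T) = ?c S \<oplus>\<^bsub>coord_space (n * m)\<^esub> ?c T" by blast
  next
    fix c T assume T: "T \<in> carrier ?H"
    then have "T (coordinate_vector V n f i) \<in> carrier W" for i
      using TW D(9) by (auto simp: carrier_hom_space)
    then have "?c (c \<odot>\<^bsub>?H\<^esub> T) k = (c \<odot>\<^bsub>coord_space (n * m)\<^esub> ?c T) k" for k
      using smult[OF T] T km[of k] D(9)
      by (cases "k < n * m") (simp_all add: hom_coordinates_def coord_space_def gl, simp add: hom_space_def gl)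
    then show "?c (c \<odot>\<^bsub>?H\<^esub> T) = c \<odot>\<^bsub>coord_space (n * m)\<^esub> ?c T" by blast
  qed
  have inj: "inj_on ?c (carrier ?H)"
  proof (rule inj_onI)
    fix S T assume ST: "S \<in> carrier ?H" "T \<in> carrier ?H" "?c S = ?c T"
    then have L: "lin_map V W S" "lin_map V W T" by (auto simp: hom_space_def)
    have eq: "g (S (coordinate_vector V n f i)) j = g (T (coordinate_vector V n f i)) j"
      if "i < n" "j < m" for i j
    proof -
      have "i * m + j < n * m"
      proof -
        have "i * m + j < Suc i * m" using that by simp
        also have "\<dots> \<le> n * m" using that by (intro mult_le_mono1) simp
        finally show ?thesis .
      qed
      then show ?thesis
        using fun_cong[OF ST(3), of "i * m + j"] ST(1,2) that by (simp add: hom_coordinates_def)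
    qed
    show "S = T"
    proof (rule extensionalityI[where A = "carrier V"])
      fix v assume v: "v \<in> carrier V"
      show "S v = T v"
      proof (rule coordinates_eqI[OF g])
        fix i assume i: "i < m"
        show "g (S v) i = g (T v) i"
          unfolding linear_form_expand[OF f linear_form_lin_map[OF L(1) E(11)[OF i]] v]
            linear_form_expand[OF f linear_form_lin_map[OF L(2) E(11)[OF i]] v]
          using eq i by (intro sum.cong) auto
      qed (use L v TW in auto)
    qed (use ST in \<open>auto simp: hom_space_def\<close>)
  qed
  have surj: "\<exists>T\<in>carrier ?H. ?c T = y" if y: "y \<in> {..<n * m} \<rightarrow>\<^sub>E UNIV" for y
  proof -
    \<comment> \<open>The linear map whose matrix is \<open>y\<close>, undoing the
      flattening.\<close>
    define T where "T = (\<lambda>v\<in>carrier V. inv_into (carrier W) g (\<lambda>j\<in>{..<m}. \<Sum>i<n. f v i * y (i * m + j)))"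
    have T: "T v \<in> carrier W" "g (T v) = (\<lambda>j\<in>{..<m}. \<Sum>i<n. f v i * y (i * m + j))"
      if "v \<in> carrier V" for v
      using that by (simp_all add: T_def E(5,6) restrict_PiE_iff)
    have fl: "w \<in> carrier V \<Longrightarrow> f (u \<oplus>\<^bsub>V\<^esub> w) i = f u i + f w i" "f (c \<odot>\<^bsub>V\<^esub> u) i = c * f u i"
      if "u \<in> carrier V" "i < n" for u w c i
      using D(11)[OF that(2)] that by (auto simp: linear_form_def)
    have "lin_map V W T"
      unfolding lin_map_def
    proof (intro conjI ballI allI)
      show "T \<in> carrier V \<rightarrow> carrier W" using T by blast
      fix u v assume uv: "u \<in> carrier V" "v \<in> carrier V"
      show "T (u \<oplus>\<^bsub>V\<^esub> v) = T u \<oplus>\<^bsub>W\<^esub> T v"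
        by (rule coordinates_eqI[OF g])
          (use uv in \<open>auto simp: T D E gl fl algebra_simps sum.distrib\<close>)
    next
      fix c v assume v: "v \<in> carrier V"
      show "T (c \<odot>\<^bsub>V\<^esub> v) = c \<odot>\<^bsub>W\<^esub> T v"
        by (rule coordinates_eqI[OF g])
          (use v in \<open>auto simp: T D E gl fl algebra_simps sum_distrib_left\<close>)
    qed
    then have TH: "T \<in> carrier ?H" by (simp add: carrier_hom_space T_def)
    have "?c T k = y k" if "k < n * m" for k
      using TH that km[OF that] D(9)
      by (simp add: hom_coordinates_def T D(10) sum_mult_delta)
    moreover have "?c T \<in> {..<n * m} \<rightarrow>\<^sub>E UNIV" using TH by (simp add: hom_coordinates_def)
    ultimately have "?c T = y"
      using y by (intro PiE_ext[of _ "{..<n * m}" "\<lambda>_. UNIV"]) auto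
    then show ?thesis using TH by blast
  qed
  have "?c T \<in> {..<n * m} \<rightarrow>\<^sub>E UNIV" if "T \<in> carrier ?H" for T
    using that by (simp add: hom_coordinates_def)
  then have "?c ` carrier ?H = {..<n * m} \<rightarrow>\<^sub>E UNIV"
    using surj by blast
  then have "?c \<in> lin_isos ?H (coord_space (n * m))"
    using lin inj by (simp add: lin_isos_def bij_betw_def hom_coordinates_def coord_space_def)
  then show ?thesis using add smult by (simp add: coordinates_def)
qed

text \<open>In finite dimension the topology of the space of linear maps is that of pointwise
  convergence: evaluations are linear, and conversely matrix entries are coordinates of evaluations
  at basis vectors. All later continuity statements about linear maps use this pointwise
  form.\<close>

lemma continuous_map_hom_space:
  assumes f: "coordinates V n f" and g: "coordinates W m g"
  shows "continuous_map Z (fd_topology (hom_space V W)) h \<longleftrightarrow>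
     h \<in> topspace Z \<rightarrow> carrier (hom_space V W) \<and>
     (\<forall>v\<in>carrier V. continuous_map Z (fd_topology W) (\<lambda>z. h z v))" (is "?L \<longleftrightarrow> ?R")
proof
  note c = coordinates_hom_space[OF f g]
  show ?R if L: ?L
  proof (intro conjI ballI)
    show h: "h \<in> topspace Z \<rightarrow> carrier (hom_space V W)" using continuous_map_funspace[OF L] by simp
    fix v assume v: "v \<in> carrier V"
    have "continuous_map Z euclidean (\<lambda>z. g (h z v) i)" if i: "i < m" for i
    proof (rule continuous_map_linear_form[OF c _ _ L, where l = "\<lambda>_ T. g (T v) i"])
      show "linear_form (hom_space V W) (\<lambda>T. g (T v) i)"
        using v coordinatesD(11)[OF g i]
        by (auto simp: linear_form_def hom_space_def lin_map_def Pi_iff)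
    qed simp
    then show "continuous_map Z (fd_topology W) (\<lambda>z. h z v)"
      using h v by (auto simp: continuous_map_fd_topology[OF g] carrier_hom_space lin_map_def Pi_iff)
  qed
  show ?L if R: ?R
    unfolding continuous_map_fd_topology[OF c]
  proof (intro conjI allI impI)
    show "h \<in> topspace Z \<rightarrow> carrier (hom_space V W)" using R by blast
    fix k assume k: "k < n * m"
    then have "k mod m < m" by (metis gr_zeroI mod_less_divisor mult_0_right not_less_zero)
    then have "continuous_map Z euclidean (\<lambda>z. g (h z (coordinate_vector V n f (k div m))) (k mod m))"
      using R coordinatesD(9)[OF f] by (simp add: continuous_map_fd_topology[OF g])
    then show "continuous_map Z euclidean (\<lambda>z. hom_coordinates V n f W m g (h z) k)"
      by (rule continuous_map_eq) (use R k in \<open>auto simp: hom_coordinates_def\<close>)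
  qed
qed

section \<open>Continuity of kernels and of inverses\<close>

text \<open>The candidate \<open>\<sigma> z\<close> is the vector that has the free coordinates of
  \<open>v0\<close> and the dependent ones prescribed by the echelon form at \<open>z\<close>. It
  lies in the kernel only if the kernel at \<open>z\<close> realises all values of the free
  coordinates. This is what \<open>h z\<close> ensures: it embeds the kernel at \<open>z0\<close>,
  which does realise them all, and an injective square matrix is surjective.\<close>

lemma kernel_local_section:
  assumes f: "coordinates V n f" and z0: "z0 \<in> topspace Z"
    and lin: "\<And>l z. l \<in> L \<Longrightarrow> z \<in> topspace Z \<Longrightarrow> linear_form V (l z)"
    and cont: "\<And>l v. l \<in> L \<Longrightarrow> v \<in> carrier V \<Longrightarrow> continuous_map Z euclidean (\<lambda>z. l z v)"
    and h: "\<And>z. z \<in> topspace Z \<Longrightarrow> lin_map V V (h z)"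
      "\<And>z. z \<in> topspace Z \<Longrightarrow> inj_on (h z) (carrier V)"
    and hK: "\<And>z v l. z \<in> topspace Z \<Longrightarrow> v \<in> carrier V \<Longrightarrow> \<forall>l\<in>L. l z0 v = 0 \<Longrightarrow> l \<in> L \<Longrightarrow> l z (h z v) = 0"
    and v0: "v0 \<in> carrier V" "\<forall>l\<in>L. l z0 v0 = 0"
  obtains U \<sigma> where "openin Z U" "z0 \<in> U"
    "continuous_map (subtopology Z U) (fd_topology V) \<sigma>" "\<sigma> z0 = v0"
    "\<And>z l. z \<in> U \<Longrightarrow> l \<in> L \<Longrightarrow> l z (\<sigma> z) = 0"
proof -
  note D = coordinatesD[OF f]
  let ?e = "coordinate_vector V n f"
  define A where "A = (\<lambda>l z i. l z (?e i)) ` L"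
  have eval: "l z v = (\<Sum>i\<in>{..<n}. l z (?e i) * f v i)"
    if "l \<in> L" "z \<in> topspace Z" "v \<in> carrier V" for l z v
    using linear_form_expand[OF f lin[OF that(1,2)] that(3)] by (simp add: mult.commute)
  have A: "continuous_map Z euclidean (\<lambda>z. a z i)" if "a \<in> A" "i \<in> {..<n}" for a i
    using that cont D(9) by (auto simp: A_def)
  obtain U J c where U: "openin Z U" "z0 \<in> U" "J \<subseteq> {..<n}"
    and c: "\<And>i j. i \<in> {..<n} \<Longrightarrow> j \<in> J \<Longrightarrow> continuous_map (subtopology Z U) euclidean (\<lambda>z. c z i j :: complex)"
    and c1: "\<And>z i j. z \<in> U \<Longrightarrow> i \<in> J \<Longrightarrow> j \<in> J \<Longrightarrow> c z i j = (if i = j then 1 else 0)"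
    and c2: "\<And>t a. a \<in> A \<Longrightarrow> (\<Sum>i\<in>{..<n}. a z0 i * (\<Sum>j\<in>J. c z0 i j * t j)) = 0"
    and c3: "\<And>z v i. z \<in> U \<Longrightarrow> \<forall>a\<in>A. (\<Sum>i\<in>{..<n}. a z i * v i) = 0 \<Longrightarrow> i \<in> {..<n} \<Longrightarrow>
           v i = (\<Sum>j\<in>J. c z i j * v j)"
    by (rule local_echelon[of "{..<n}" z0 Z A], rule finite_lessThan, rule z0, erule (1) A, rule that)
  have J: "finite J" using U(3) finite_subset by blast
  have UZ: "z \<in> topspace Z" if "z \<in> U" for z using that openin_subset[OF U(1)] by blast
  define p where "p z t = inv_into (carrier V) f (\<lambda>i\<in>{..<n}. \<Sum>j\<in>J. c z i j * t j)" for z t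
  have p: "p z t \<in> carrier V" "f (p z t) = (\<lambda>i\<in>{..<n}. \<Sum>j\<in>J. c z i j * t j)" for z t
    unfolding p_def by (rule D; simp)+
  have ker: "f v i = (\<Sum>j\<in>J. c z i j * f v j)"
    if "z \<in> U" "v \<in> carrier V" "\<forall>l\<in>L. l z v = 0" "i < n" for z v i
    using c3[of z "f v" i] that eval UZ by (auto simp: A_def)
  have p0: "\<forall>l\<in>L. l z0 (p z0 t) = 0" for t
  proof
    fix l assume l: "l \<in> L"
    then have "(\<lambda>z i. l z (?e i)) \<in> A" by (auto simp: A_def)
    then show "l z0 (p z0 t) = 0" using c2[of _ t] eval[OF l z0 p(1)] by (simp add: p(2))
  qed
  define \<sigma> where "\<sigma> z = p z (f v0)" for z
  show ?thesis
  proof (rule that[OF U(1,2), of \<sigma>])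
    show "continuous_map (subtopology Z U) (fd_topology V) \<sigma>"
      unfolding continuous_map_fd_topology[OF f]
    proof (intro conjI allI impI)
      fix i assume "i < n"
      then have "continuous_map (subtopology Z U) euclidean (\<lambda>z. \<Sum>j\<in>J. c z i j * f v0 j)"
        using c J by (intro continuous_map_sum continuous_map_mult_complex) auto
      then show "continuous_map (subtopology Z U) euclidean (\<lambda>z. f (\<sigma> z) i)"
        using \<open>i < n\<close> by (simp add: \<sigma>_def p)
    qed (simp add: \<sigma>_def p)
    show "\<sigma> z0 = v0"
      using ker[OF U(2) v0] by (intro coordinates_eqI[OF f]) (auto simp: \<sigma>_def p v0)
    fix z l assume z: "z \<in> U" and l: "l \<in> L"
    note zZ = UZ[OF z]
    have hV: "h z v \<in> carrier V" if "v \<in> carrier V" for v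
      using h(1)[OF zZ] that by (auto simp: lin_map_def)
    \<comment> \<open>The square matrix sending \<open>t\<close> to the free coordinates of
      \<open>h z (p z0 t)\<close>; here \<open>p z0\<close> parametrizes the kernel at
      \<open>z0\<close> by its free coordinates.\<close>
    define m where "m i j = (\<Sum>k<n. c z0 k j * f (h z (?e k)) i)" for i j
    have fh: "f (h z (p z0 t)) i = (\<Sum>j\<in>J. m i j * t j)" if "i < n" for i t
    proof -
      have "f (h z (p z0 t)) i = (\<Sum>k<n. (\<Sum>j\<in>J. c z0 k j * t j) * f (h z (?e k)) i)"
        using linear_form_expand[OF f linear_form_lin_map[OF h(1)[OF zZ] D(11)[OF that]] p(1)]
        by (simp add: p(2))
      also have "\<dots> = (\<Sum>k<n. \<Sum>j\<in>J. c z0 k j * f (h z (?e k)) i * t j)"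
        by (simp add: sum_distrib_left sum_distrib_right mult_ac)
      also have "\<dots> = (\<Sum>j\<in>J. m i j * t j)"
        unfolding m_def sum_distrib_right by (rule sum.swap)
      finally show ?thesis .
    qed
    have hker: "\<forall>l\<in>L. l z (h z (p z0 t)) = 0" for t
      using hK[OF zZ p(1) p0] by blast
    have inj: "\<forall>j\<in>J. t j = 0" if t: "\<forall>i\<in>J. (\<Sum>j\<in>J. m i j * t j) = 0" for t
    proof
      fix j assume j: "j \<in> J"
      have "f (h z (p z0 t)) i = 0" if "i < n" for i
      proof -
        have "f (h z (p z0 t)) j = 0" if "j \<in> J" for j
          using t fh[of j t] that U(3) by auto
        then show ?thesis using ker[OF z hV[OF p(1)] hker that] by simp
      qed
      moreover have "f (h z (0 \<odot>\<^bsub>V\<^esub> p z0 t)) i = 0" if "i < n" for i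
        using linear_form_lin_map[OF h(1)[OF zZ] D(11)[OF that]] p(1) by (simp add: linear_form_def)
      ultimately have "h z (p z0 t) = h z (0 \<odot>\<^bsub>V\<^esub> p z0 t)"
        by (intro coordinates_eqI[OF f] hV D(3) p) auto
      then have "p z0 t = 0 \<odot>\<^bsub>V\<^esub> p z0 t"
        using h(2)[OF zZ] p(1) D(3) by (auto dest: inj_onD)
      moreover have jn: "j < n" using j U(3) by auto
      ultimately have "f (p z0 t) j = 0 * f (p z0 t) j"
        using D(11)[OF jn] p(1) by (metis linear_form_def)
      then have "(\<Sum>j'\<in>J. c z0 j j' * t j') = 0" using jn by (simp add: p(2))
      moreover have "(\<Sum>j'\<in>J. c z0 j j' * t j') = (\<Sum>j'\<in>J. (if j = j' then 1 else 0) * t j')"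
        using c1[OF U(2) j] by (intro sum.cong) auto
      ultimately show "t j = 0" using j J by (simp add: sum_mult_delta)
    qed
    \<comment> \<open>This \<open>t\<close> makes \<open>h z (p z0 t)\<close> a kernel vector with
      the same free coordinates as \<open>\<sigma> z\<close>. The two vectors therefore
      coincide.\<close>
    obtain t where t: "\<And>i. i \<in> J \<Longrightarrow> (\<Sum>j\<in>J. m i j * t j) = f v0 i"
      using matrix_inj_imp_surj[OF J inj] by blast
    have "\<sigma> z = h z (p z0 t)"
    proof (rule coordinates_eqI[OF f])
      fix i assume i: "i < n"
      have "f (h z (p z0 t)) j = f v0 j" if "j \<in> J" for j
        using t[OF that] fh that U(3) by auto
      then show "f (\<sigma> z) i = f (h z (p z0 t)) i"
        using ker[OF z hV[OF p(1)] hker i] i by (simp add: \<sigma>_def p(2))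
    qed (auto simp: \<sigma>_def p intro: hV)
    then show "l z (\<sigma> z) = 0" using hker l by simp
  qed
qed

text \<open>A free variable would give a kernel vector at \<open>z0\<close> with a coordinate equal
  to 1. So there are none, and near \<open>z0\<close> every coordinate of a kernel vector is an
  empty sum.\<close>

lemma kernel_locally_trivial:
  assumes f: "coordinates V n f" and z0: "z0 \<in> topspace Z"
    and lin: "\<And>l z. l \<in> L \<Longrightarrow> z \<in> topspace Z \<Longrightarrow> linear_form V (l z)"
    and cont: "\<And>l v. l \<in> L \<Longrightarrow> v \<in> carrier V \<Longrightarrow> continuous_map Z euclidean (\<lambda>z. l z v)"
    and triv: "\<And>v i. v \<in> carrier V \<Longrightarrow> \<forall>l\<in>L. l z0 v = 0 \<Longrightarrow> i < n \<Longrightarrow> f v i = 0"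
  obtains U where "openin Z U" "z0 \<in> U"
    "\<And>z v i. z \<in> U \<Longrightarrow> v \<in> carrier V \<Longrightarrow> \<forall>l\<in>L. l z v = 0 \<Longrightarrow> i < n \<Longrightarrow> f v i = 0"
proof -
  note D = coordinatesD[OF f]
  let ?e = "coordinate_vector V n f"
  define A where "A = (\<lambda>l z i. l z (?e i)) ` L"
  have eval: "l z v = (\<Sum>i\<in>{..<n}. l z (?e i) * f v i)"
    if "l \<in> L" "z \<in> topspace Z" "v \<in> carrier V" for l z v
    using linear_form_expand[OF f lin[OF that(1,2)] that(3)] by (simp add: mult.commute)
  have A: "continuous_map Z euclidean (\<lambda>z. a z i)" if "a \<in> A" "i \<in> {..<n}" for a i
    using that cont D(9) by (auto simp: A_def)
  obtain U J c where U: "openin Z U" "z0 \<in> U" "J \<subseteq> {..<n}"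
    and c1: "\<And>z i j. z \<in> U \<Longrightarrow> i \<in> J \<Longrightarrow> j \<in> J \<Longrightarrow> c z i j = (if i = j then 1 else 0 :: complex)"
    and c2: "\<And>t a. a \<in> A \<Longrightarrow> (\<Sum>i\<in>{..<n}. a z0 i * (\<Sum>j\<in>J. c z0 i j * t j)) = 0"
    and c3: "\<And>z v i. z \<in> U \<Longrightarrow> \<forall>a\<in>A. (\<Sum>i\<in>{..<n}. a z i * v i) = 0 \<Longrightarrow> i \<in> {..<n} \<Longrightarrow>
           v i = (\<Sum>j\<in>J. c z i j * v j)"
    by (rule local_echelon[of "{..<n}" z0 Z A], rule finite_lessThan, rule z0, erule (1) A, rule that)
  have J: "finite J" using U(3) finite_subset by blast
  have "J = {}"
  proof (rule ccontr)
    assume "J \<noteq> {}"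
    then obtain j where j: "j \<in> J" by blast
    define t where "t i = (if i = j then 1 else 0 :: complex)" for i
    define v where "v = inv_into (carrier V) f (\<lambda>i\<in>{..<n}. \<Sum>j\<in>J. c z0 i j * t j)"
    have v: "v \<in> carrier V" "f v = (\<lambda>i\<in>{..<n}. \<Sum>j\<in>J. c z0 i j * t j)"
      unfolding v_def by (rule D; simp)+
    have "\<forall>l\<in>L. l z0 v = 0"
    proof
      fix l assume l: "l \<in> L"
      then have "(\<lambda>z i. l z (?e i)) \<in> A" by (auto simp: A_def)
      then show "l z0 v = 0" using c2[of _ t] eval[OF l z0 v(1)] by (simp add: v(2))
    qed
    then have "f v j = 0" using triv[OF v(1)] j U(3) by auto
    moreover have "f v j = 1"
      using j U(3) J c1[OF U(2) j j] by (auto simp: v(2) t_def sum_mult_delta)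
    ultimately show False by simp
  qed
  show ?thesis
  proof (rule that[OF U(1,2)])
    fix z v i assume "z \<in> U" "v \<in> carrier V" "\<forall>l\<in>L. l z v = 0" "i < n"
    moreover have "z \<in> topspace Z" using \<open>z \<in> U\<close> openin_subset[OF U(1)] by blast
    ultimately show "f v i = 0"
      using c3[of z "f v" i] eval \<open>J = {}\<close> by (auto simp: A_def)
  qed
qed

text \<open>The coordinates of \<open>T z v\<close> are used as the system of forms, so that
  injectivity becomes triviality of the kernel.\<close>

lemma locally_injective:
  assumes f: "coordinates V n f" and g: "coordinates W m g" and z0: "z0 \<in> topspace Z"
    and T: "\<And>z. z \<in> topspace Z \<Longrightarrow> lin_map V W (T z)"
    and Tv: "\<And>v. v \<in> carrier V \<Longrightarrow> continuous_map Z (fd_topology W) (\<lambda>z. T z v)"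
    and inj: "inj_on (T z0) (carrier V)"
  obtains U where "openin Z U" "z0 \<in> U" "\<And>z. z \<in> U \<Longrightarrow> inj_on (T z) (carrier V)"
proof -
  note D = coordinatesD[OF f] and E = coordinatesD[OF g]
  have TW: "T z v \<in> carrier W" if "z \<in> topspace Z" "v \<in> carrier V" for z v
    using T[OF that(1)] that by (auto simp: lin_map_def)
  have form: "linear_form V (\<lambda>v. g (T z v) j)" if "z \<in> topspace Z" "j < m" for z j
    using linear_form_lin_map[OF T[OF that(1)] E(11)[OF that(2)]] .
  define L where "L = (\<lambda>j z v. g (T z v) j) ` {..<m}"
  obtain U where U: "openin Z U" "z0 \<in> U"
    "\<And>z v i. z \<in> U \<Longrightarrow> v \<in> carrier V \<Longrightarrow> \<forall>l\<in>L. l z v = 0 \<Longrightarrow> i < n \<Longrightarrow> f v i = 0"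
  proof (rule kernel_locally_trivial[OF f z0, of L])
    show "linear_form V (l z)" if "l \<in> L" "z \<in> topspace Z" for l z
      using that form by (auto simp: L_def)
    show "continuous_map Z euclidean (\<lambda>z. l z v)" if "l \<in> L" "v \<in> carrier V" for l v
      using that Tv by (auto simp: L_def continuous_map_fd_topology[OF g])
    fix v i assume v: "v \<in> carrier V" "\<forall>l\<in>L. l z0 v = 0" and i: "i < n"
    have "g (T z0 (0 \<odot>\<^bsub>V\<^esub> v)) j = 0" if "j < m" for j
      using form[OF z0 that] v(1) by (simp add: linear_form_def)
    then have "T z0 v = T z0 (0 \<odot>\<^bsub>V\<^esub> v)"
      using v D(3) TW[OF z0] by (intro coordinates_eqI[OF g]) (auto simp: L_def)
    then have "v = 0 \<odot>\<^bsub>V\<^esub> v" using inj v(1) D(3) by (auto dest: inj_onD)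
    then have "f v i = 0 * f v i" using D(11)[OF i] v(1) by (metis linear_form_def)
    then show "f v i = 0" by simp
  qed blast
  show ?thesis
  proof (rule that[OF U(1,2)], rule inj_onI)
    fix z u v assume z: "z \<in> U" and uv: "u \<in> carrier V" "v \<in> carrier V" "T z u = T z v"
    have zZ: "z \<in> topspace Z" using z openin_subset[OF U(1)] by blast
    define d where "d = u \<oplus>\<^bsub>V\<^esub> (- 1) \<odot>\<^bsub>V\<^esub> v"
    have d: "d \<in> carrier V" using uv D(2,3) by (simp add: d_def)
    have "g (T z d) j = 0" if "j < m" for j
      using form[OF zZ that] uv D(3) by (simp add: linear_form_def d_def)
    then have d0: "f d i = 0" if "i < n" for i using U(3)[OF z d _ that] by (auto simp: L_def)
    show "u = v"
    proof (rule coordinates_eqI[OF f uv(1,2)])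
      fix i assume i: "i < n"
      then have "f d i = f u i - f v i"
        using D(11)[OF i] uv D(3) by (simp add: linear_form_def d_def)
      then show "f u i = f v i" using d0[OF i] by simp
    qed
  qed
qed

lemma lin_isosD:
  assumes "T \<in> lin_isos V W"
  shows "lin_map V W T" "bij_betw T (carrier V) (carrier W)" "T \<in> extensional (carrier V)"
    "\<And>v. v \<in> carrier V \<Longrightarrow> T v \<in> carrier W"
    "\<And>v. v \<in> carrier V \<Longrightarrow> inv_into (carrier V) T (T v) = v"
    "\<And>y. y \<in> carrier W \<Longrightarrow> inv_into (carrier V) T y \<in> carrier V"
    "\<And>y. y \<in> carrier W \<Longrightarrow> T (inv_into (carrier V) T y) = y"
    "inj_on T (carrier V)"
  using assms
  by (auto simp: lin_isos_def bij_betw_def inv_into_into f_inv_into_f lin_map_def)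

lemma lin_map_inverse:
  assumes f: "coordinates V n f" and T: "T \<in> lin_isos V W"
  shows "lin_map W V (inv_into (carrier V) T)"
  unfolding lin_map_def
proof (intro conjI ballI allI)
  note D = lin_isosD[OF T] and E = coordinatesD[OF f]
  show "inv_into (carrier V) T \<in> carrier W \<rightarrow> carrier V" using D by blast
  fix x y assume xy: "x \<in> carrier W" "y \<in> carrier W"
  have "x \<oplus>\<^bsub>W\<^esub> y = T (inv_into (carrier V) T x \<oplus>\<^bsub>V\<^esub> inv_into (carrier V) T y)"
    using xy D by (simp add: lin_map_def)
  then show "inv_into (carrier V) T (x \<oplus>\<^bsub>W\<^esub> y) = inv_into (carrier V) T x \<oplus>\<^bsub>V\<^esub> inv_into (carrier V) T y"
    using xy D E by simp
next
  note D = lin_isosD[OF T] and E = coordinatesD[OF f]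
  fix c y assume y: "y \<in> carrier W"
  have "c \<odot>\<^bsub>W\<^esub> y = T (c \<odot>\<^bsub>V\<^esub> inv_into (carrier V) T y)"
    using y D by (simp add: lin_map_def)
  then show "inv_into (carrier V) T (c \<odot>\<^bsub>W\<^esub> y) = c \<odot>\<^bsub>V\<^esub> inv_into (carrier V) T y"
    using y D E by simp
qed

lemma lin_map_compose:
  assumes "lin_map U V S" "lin_map V W T"
  shows "lin_map U W (\<lambda>u. T (S u))"
  using assms by (auto simp: lin_map_def Pi_iff)

text \<open>The role of \<open>S\<close> is to witness that \<open>V\<close> and \<open>W\<close>
  have equal dimension: following \<open>T\<close> by the inverse of \<open>S\<close> gives an
  injective endomorphism of \<open>V\<close>, hence a square matrix to which the dimension count
  applies.\<close>

lemma lin_map_inj_imp_bij: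
  assumes f: "coordinates V n f" and S: "S \<in> lin_isos V W"
    and T: "lin_map V W T" "inj_on T (carrier V)"
  shows "bij_betw T (carrier V) (carrier W)"
proof -
  note D = coordinatesD[OF f] and S' = lin_isosD[OF S]
  have TW: "T v \<in> carrier W" if "v \<in> carrier V" for v
    using T that by (auto simp: lin_map_def)
  define R where "R v = inv_into (carrier V) S (T v)" for v
  have R: "lin_map V V R"
    unfolding R_def by (rule lin_map_compose[OF T(1) lin_map_inverse[OF f S]])
  have injR: "inj_on R (carrier V)"
    using T(2) TW S'(7) unfolding R_def inj_on_def by metis
  have RV: "R v \<in> carrier V" if "v \<in> carrier V" for v
    using R that by (auto simp: lin_map_def)
  have form: "linear_form V (\<lambda>v. f (R v) i)" if "i < n" for i
    by (rule linear_form_lin_map[OF R D(11)[OF that]])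
  define m where "m i j = f (R (coordinate_vector V n f j)) i" for i j
  have fR: "f (R v) i = (\<Sum>j\<in>{..<n}. m i j * f v j)" if "v \<in> carrier V" "i < n" for v i
    using linear_form_expand[OF f form[OF that(2)] that(1)] by (simp add: m_def mult.commute)
  have inj: "\<forall>j\<in>{..<n}. t j = 0" if t: "\<forall>i\<in>{..<n}. (\<Sum>j\<in>{..<n}. m i j * t j) = 0" for t
  proof
    fix j assume j: "j \<in> {..<n}"
    define v where "v = inv_into (carrier V) f (restrict t {..<n})"
    have v: "v \<in> carrier V" "f v = restrict t {..<n}" unfolding v_def by (rule D; simp)+
    have "f (R v) i = 0" if "i < n" for i
      using t fR[OF v(1) that] that by (simp add: v(2))
    moreover have "f (R (0 \<odot>\<^bsub>V\<^esub> v)) i = 0" if "i < n" for i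
      using form[OF that] v(1) by (simp add: linear_form_def)
    ultimately have "R v = R (0 \<odot>\<^bsub>V\<^esub> v)"
      using RV D(3) v(1) by (intro coordinates_eqI[OF f]) auto
    then have "v = 0 \<odot>\<^bsub>V\<^esub> v" using injR v(1) D(3) by (auto dest: inj_onD)
    then have "f v j = 0 * f v j" using D(11)[of j] j v(1) by (metis lessThan_iff linear_form_def)
    then show "t j = 0" using j by (simp add: v(2))
  qed
  have "carrier W \<subseteq> T ` carrier V"
  proof
    fix y assume y: "y \<in> carrier W"
    obtain t where t: "\<And>i. i \<in> {..<n} \<Longrightarrow> (\<Sum>j\<in>{..<n}. m i j * t j) = f (inv_into (carrier V) S y) i"
      using matrix_inj_imp_surj[OF finite_lessThan inj] by blast
    define v where "v = inv_into (carrier V) f (restrict t {..<n})"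
    have v: "v \<in> carrier V" "f v = restrict t {..<n}" unfolding v_def by (rule D; simp)+
    have "R v = inv_into (carrier V) S y"
      using fR[OF v(1)] t RV[OF v(1)] S'(6)[OF y] by (intro coordinates_eqI[OF f]) (auto simp: v(2))
    then have "T v = y" using S'(7) TW[OF v(1)] y unfolding R_def by metis
    then show "y \<in> T ` carrier V" using v(1) by blast
  qed
  then show ?thesis using T(2) TW by (auto simp: bij_betw_def)
qed

lemma continuous_map_local:
  assumes "\<And>z. z \<in> topspace Z \<Longrightarrow> \<exists>U. openin Z U \<and> z \<in> U \<and> continuous_map (subtopology Z U) Y h"
  shows "continuous_map Z Y h"
  unfolding continuous_map_def
proof (intro conjI allI impI)
  show "h \<in> topspace Z \<rightarrow> topspace Y"
  proof
    fix z assume z: "z \<in> topspace Z"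
    then obtain U where "openin Z U" "z \<in> U" "continuous_map (subtopology Z U) Y h"
      using assms by blast
    then show "h z \<in> topspace Y" using z continuous_map_funspace by fastforce
  qed
  fix B assume B: "openin Y B"
  show "openin Z {z \<in> topspace Z. h z \<in> B}"
  proof (subst openin_subopen, intro ballI)
    fix z assume z: "z \<in> {z \<in> topspace Z. h z \<in> B}"
    then obtain U where U: "openin Z U" "z \<in> U" "continuous_map (subtopology Z U) Y h"
      using assms by blast
    have "openin (subtopology Z U) {x \<in> topspace (subtopology Z U). h x \<in> B}"
      using U(3) B by (rule openin_continuous_map_preimage)
    then have "openin Z {x \<in> topspace (subtopology Z U). h x \<in> B}"
      using U(1) openin_trans_full by blast
    then show "\<exists>T. openin Z T \<and> z \<in> T \<and> T \<subseteq> {z \<in> topspace Z. h z \<in> B}"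
      using z U(2) by (intro exI[of _ "{x \<in> topspace (subtopology Z U). h x \<in> B}"]) auto
  qed
qed

text \<open>The line through the preimage of \<open>y\<close> is the kernel of the equations stating
  that \<open>T z v\<close> is parallel to \<open>y\<close>. It has dimension 1 for every
  \<open>z\<close>, so a kernel vector extends continuously; dividing by the factor relating its
  image to \<open>y\<close> gives the preimage. A zero vector \<open>y\<close> spans no line and is
  treated separately, its preimage having constant coordinates 0.\<close>

lemma continuous_map_inverse_apply:
  assumes f: "coordinates V n f" and g: "coordinates W m g"
    and T: "\<And>z. z \<in> topspace Z \<Longrightarrow> T z \<in> lin_isos V W"
    and Tv: "\<And>v. v \<in> carrier V \<Longrightarrow> continuous_map Z (fd_topology W) (\<lambda>z. T z v)"
    and y: "y \<in> carrier W"
  shows "continuous_map Z (fd_topology V) (\<lambda>z. inv_into (carrier V) (T z) y)"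
proof (cases "\<forall>k<m. g y k = 0")
  note D = coordinatesD[OF f] and E = coordinatesD[OF g]
  case True
  then have y0: "y = 0 \<odot>\<^bsub>W\<^esub> y"
    using y E(3) E(11) by (intro coordinates_eqI[OF g]) (auto simp: linear_form_def)
  have zero: "0 = f (inv_into (carrier V) (T z) y) i" if "z \<in> topspace Z" "i < n" for z i
  proof -
    have "linear_form W (\<lambda>y. f (inv_into (carrier V) (T z) y) i)"
      by (rule linear_form_lin_map[OF lin_map_inverse[OF f T[OF that(1)]] D(11)[OF that(2)]])
    then have "f (inv_into (carrier V) (T z) y) i = 0 * f (inv_into (carrier V) (T z) y) i"
      using y y0 by (metis linear_form_def)
    then show ?thesis by simp
  qed
  have "continuous_map Z euclidean (\<lambda>z. f (inv_into (carrier V) (T z) y) i)" if "i < n" for i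
    by (rule continuous_map_eq[OF _ zero[OF _ that]]) simp_all
  then show ?thesis
    using lin_isosD(6)[OF T y] by (auto simp: continuous_map_fd_topology[OF f])
next
  note D = coordinatesD[OF f] and E = coordinatesD[OF g]
  case False
  then obtain k where k: "k < m" "g y k \<noteq> 0" by blast
  have TV: "lin_map V W (T z)" if "z \<in> topspace Z" for z using lin_isosD(1)[OF T[OF that]] .
  have form: "linear_form V (\<lambda>v. g (T z v) j)" if "z \<in> topspace Z" "j < m" for z j
    using linear_form_lin_map[OF TV[OF that(1)] E(11)[OF that(2)]] .
  have gTv: "continuous_map Z euclidean (\<lambda>z. g (T z v) j)" if "v \<in> carrier V" "j < m" for v j
    using Tv[OF that(1)] that(2) by (simp add: continuous_map_fd_topology[OF g])
  \<comment> \<open>A vector in the kernel of the forms \<open>l j z\<close> is mapped by \<open>T z\<close> to a multiple of \<open>y\<close>.\<close>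
  define l where "l j z v = g (T z v) j * g y k - g (T z v) k * g y j" for j z v
  show ?thesis
  proof (rule continuous_map_local)
    fix z0 assume z0: "z0 \<in> topspace Z"
    \<comment> \<open>Carries the line over \<open>z0\<close> to the line over \<open>z\<close>: if
      \<open>T z0 v\<close> is parallel to \<open>y\<close>, then so is the image of
      \<open>h z v\<close> under \<open>T z\<close>, being the same vector.\<close>
    define h where "h z v = inv_into (carrier V) (T z) (T z0 v)" for z v
    note I0 = lin_isosD[OF T[OF z0]]
    have h: "lin_map V V (h z)" "inj_on (h z) (carrier V)"
      and Th: "\<And>v. v \<in> carrier V \<Longrightarrow> T z (h z v) = T z0 v" if z: "z \<in> topspace Z" for z
    proof -
      note I = lin_isosD[OF T[OF z]]
      show "lin_map V V (h z)"
        unfolding h_def by (rule lin_map_compose[OF I0(1) lin_map_inverse[OF f T[OF z]]])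
      show Th: "T z (h z v) = T z0 v" if "v \<in> carrier V" for v
        using I(7) I0(4) that by (simp add: h_def)
      show "inj_on (h z) (carrier V)"
        using Th I0(8) by (metis inj_on_def)
    qed
    let ?v0 = "inv_into (carrier V) (T z0) y"
    obtain U \<sigma> where U: "openin Z U" "z0 \<in> U"
      and \<sigma>: "continuous_map (subtopology Z U) (fd_topology V) \<sigma>" "\<sigma> z0 = ?v0"
      and l\<sigma>: "\<And>z l'. z \<in> U \<Longrightarrow> l' \<in> l ` {..<m} \<Longrightarrow> l' z (\<sigma> z) = 0"
    proof (rule kernel_local_section[OF f z0, of "l ` {..<m}" h ?v0])
      show "linear_form V (l' z)" if "l' \<in> l ` {..<m}" "z \<in> topspace Z" for l' z
        using that form k(1) by (auto simp: l_def linear_form_def algebra_simps)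
      show "continuous_map Z euclidean (\<lambda>z. l' z v)" if "l' \<in> l ` {..<m}" "v \<in> carrier V" for l' v
        using that gTv k(1)
        by (auto simp: l_def intro!: continuous_map_diff continuous_map_mult_complex)
      show "l' z (h z v) = 0" if "z \<in> topspace Z" "v \<in> carrier V"
        "\<forall>l'\<in>l ` {..<m}. l' z0 v = 0" "l' \<in> l ` {..<m}" for z v l'
        using that Th by (auto simp: l_def)
    qed (use h I0(6,7) y in \<open>auto simp: l_def\<close>)
    have UZ: "z \<in> topspace Z" if "z \<in> U" for z using that openin_subset[OF U(1)] by blast
    have \<sigma>V: "\<sigma> z \<in> carrier V" if "z \<in> U" for z
      using continuous_map_funspace[OF \<sigma>(1)] UZ that by auto
    \<comment> \<open>The factor with \<open>T z (\<sigma> z)\<close> equal to \<open>t z\<close>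
      times \<open>y\<close>, read off at the nonzero coordinate \<open>k\<close> of
      \<open>y\<close>. It is 1 at \<open>z0\<close>, so it is invertible on a neighborhood.\<close>
    define t where "t z = g (T z (\<sigma> z)) k / g y k" for z
    have "continuous_map (subtopology Z U) (fd_topology W) (\<lambda>z. T z (\<sigma> z))"
      by (rule continuous_map_apply[OF f g _ _ \<sigma>(1)])
        (use TV Tv in \<open>auto intro: continuous_map_from_subtopology\<close>)
    then have t: "continuous_map (subtopology Z U) euclidean t"
      unfolding t_def[abs_def] using k
      by (intro continuous_map_divide_complex) (simp_all add: continuous_map_fd_topology[OF g])
    define U' where "U' = {z \<in> topspace (subtopology Z U). t z \<in> - {0}}"
    have "openin (subtopology Z U) U'"
      unfolding U'_def by (rule openin_continuous_map_preimage[OF t]) auto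
    then have oU': "openin Z U'" using U(1) openin_trans_full by blast
    have U'U: "U' \<subseteq> U" by (auto simp: U'_def)
    have "t z0 = 1" using \<sigma>(2) I0(7)[OF y] k by (simp add: t_def)
    then have z0U': "z0 \<in> U'" using U(2) z0 by (simp add: U'_def)
    have eq: "f (inv_into (carrier V) (T z) y) i = f (\<sigma> z) i / t z" if z: "z \<in> U'" and i: "i < n" for z i
    proof -
      have zU: "z \<in> U" "t z \<noteq> 0" using z by (auto simp: U'_def)
      note zZ = UZ[OF zU(1)]
      note I = lin_isosD[OF T[OF zZ]]
      have "g (T z (\<sigma> z)) j = t z * g y j" if "j < m" for j
        using l\<sigma>[OF zU(1), of "l j"] that k by (simp add: l_def t_def field_simps)
      then have "T z (\<sigma> z) = t z \<odot>\<^bsub>W\<^esub> y"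
        using I(4)[OF \<sigma>V[OF zU(1)]] y E(3) E(11)
        by (intro coordinates_eqI[OF g]) (auto simp: linear_form_def)
      then have "\<sigma> z = inv_into (carrier V) (T z) (t z \<odot>\<^bsub>W\<^esub> y)"
        using I(5)[OF \<sigma>V[OF zU(1)]] by simp
      also have "\<dots> = t z \<odot>\<^bsub>V\<^esub> inv_into (carrier V) (T z) y"
        using lin_map_inverse[OF f T[OF zZ]] y by (simp add: lin_map_def)
      finally show ?thesis
        using D(11)[OF i] I(6)[OF y] zU(2) by (simp add: linear_form_def)
    qed
    have "continuous_map (subtopology Z U') euclidean (\<lambda>z. f (inv_into (carrier V) (T z) y) i)" if i: "i < n" for i
    proof (rule continuous_map_eq)
      have "continuous_map (subtopology Z U) euclidean (\<lambda>z. f (\<sigma> z) i)"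
        using \<sigma>(1) i by (simp add: continuous_map_fd_topology[OF f])
      then have "continuous_map (subtopology Z U') euclidean (\<lambda>z. f (\<sigma> z) i)"
        "continuous_map (subtopology Z U') euclidean t"
        using t continuous_map_from_subtopology_mono[OF _ U'U] by blast+
      then show "continuous_map (subtopology Z U') euclidean (\<lambda>z. f (\<sigma> z) i / t z)"
        by (intro continuous_map_divide_complex) (auto simp: U'_def)
    qed (use eq i in auto)
    then have "continuous_map (subtopology Z U') (fd_topology V) (\<lambda>z. inv_into (carrier V) (T z) y)"
      using lin_isosD(6)[OF T y] by (auto simp: continuous_map_fd_topology[OF f])
    then show "\<exists>U. openin Z U \<and> z0 \<in> U \<and>
        continuous_map (subtopology Z U) (fd_topology V) (\<lambda>z. inv_into (carrier V) (T z) y)"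
      using oU' z0U' by blast
  qed
qed

section \<open>Linear isomorphisms: inverses, composites and their topology\<close>

lemma lin_map_restrict:
  assumes "coordinates V n f"
  shows "lin_map V W (restrict T (carrier V)) \<longleftrightarrow> lin_map V W T"
  using coordinatesD(2,3)[OF assms] by (auto simp: lin_map_def Pi_iff)

lemma restrict_in_lin_isos:
  assumes "coordinates V n f" "lin_map V W T"
    and "\<And>v. v \<in> carrier V \<Longrightarrow> R (T v) = v"
    and "\<And>y. y \<in> carrier W \<Longrightarrow> R y \<in> carrier V" "\<And>y. y \<in> carrier W \<Longrightarrow> T (R y) = y"
  shows "restrict T (carrier V) \<in> lin_isos V W"
proof -
  have "bij_betw T (carrier V) (carrier W)"
    by (rule bij_betw_byWitness[where f' = R]) (use assms in \<open>auto simp: lin_map_def\<close>)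
  then have "bij_betw (restrict T (carrier V)) (carrier V) (carrier W)"
    using bij_betw_cong by (metis restrict_apply')
  then show ?thesis using assms(1,2) by (simp add: lin_isos_def lin_map_restrict)
qed

text \<open>Only \<open>V\<close> comes with coordinates; closure of the carrier of \<open>W\<close>
  is transported along \<open>T\<close>. This admits \<open>quot_space\<close> as \<open>W\<close>
  without further preparation.\<close>

lemma inv_into_lin_isos:
  assumes f: "coordinates V n f" and T: "T \<in> lin_isos V W"
  shows "restrict (inv_into (carrier V) T) (carrier W) \<in> lin_isos W V"
proof -
  note D = lin_isosD[OF T] and E = coordinatesD[OF f]
  have "x \<oplus>\<^bsub>W\<^esub> y \<in> carrier W" if "x \<in> carrier W" "y \<in> carrier W" for x y
  proof -
    have "x \<oplus>\<^bsub>W\<^esub> y = T (inv_into (carrier V) T x \<oplus>\<^bsub>V\<^esub> inv_into (carrier V) T y)"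
      using that D by (simp add: lin_map_def)
    then show ?thesis using that D E by simp
  qed
  moreover have "c \<odot>\<^bsub>W\<^esub> y \<in> carrier W" if "y \<in> carrier W" for c y
  proof -
    have "c \<odot>\<^bsub>W\<^esub> y = T (c \<odot>\<^bsub>V\<^esub> inv_into (carrier V) T y)"
      using that D by (simp add: lin_map_def)
    then show ?thesis using that D E by simp
  qed
  ultimately have "lin_map W V (restrict (inv_into (carrier V) T) (carrier W))"
    using lin_map_inverse[OF f T] by (simp add: lin_map_def Pi_iff)
  moreover have "bij_betw (restrict (inv_into (carrier V) T) (carrier W)) (carrier W) (carrier V)"
    using D by (intro bij_betw_byWitness[where f' = T]) auto
  ultimately show ?thesis by (simp add: lin_isos_def)
qed

lemma compose_lin_isos:
  assumes "coordinates U n f" "S \<in> lin_isos U V" "T \<in> lin_isos V W"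
  shows "(\<lambda>u\<in>carrier U. T (S u)) \<in> lin_isos U W"
  using lin_isosD[OF assms(2)] lin_isosD[OF assms(3)]
  by (intro restrict_in_lin_isos[OF assms(1),
        where R = "\<lambda>y. inv_into (carrier U) S (inv_into (carrier V) T y)"] lin_map_compose[of U V S W T]) auto

lemma continuous_map_lin_map:
  assumes "coordinates V n f" "coordinates W m g" "lin_map V W T"
    and "continuous_map Z (fd_topology V) h"
  shows "continuous_map Z (fd_topology W) (\<lambda>z. T (h z))"
proof (rule continuous_map_apply[OF assms(1,2) _ _ assms(4)])
  show "continuous_map Z (fd_topology W) (\<lambda>z. T v)" if "v \<in> carrier V" for v
    using assms(3) that by (simp add: lin_map_def Pi_iff)
qed (rule assms(3))

lemma lin_isos_subset_hom_space: "lin_isos V W \<subseteq> carrier (hom_space V W)"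
  by (auto simp: lin_isos_def hom_space_def)

lemma topspace_iso_topology: "topspace (iso_topology V W) = lin_isos V W"
  using lin_isos_subset_hom_space by (auto simp: iso_topology_def)

lemma continuous_map_iso_topology:
  assumes "coordinates V n f" "coordinates W m g"
  shows "continuous_map Z (iso_topology V W) h \<longleftrightarrow> h \<in> topspace Z \<rightarrow> lin_isos V W \<and>
     (\<forall>v\<in>carrier V. continuous_map Z (fd_topology W) (\<lambda>z. h z v))"
  using lin_isos_subset_hom_space[of V W]
  by (auto simp: iso_topology_def continuous_map_in_subtopology continuous_map_hom_space[OF assms])

section \<open>Quotient maps\<close>

text \<open>Each map is constant on the fibers of the other and so descends along it; the two
  induced maps are mutually inverse.\<close>

lemma quotient_maps_imp_homeomorphic_space:
  assumes f: "quotient_map X Y f" and g: "quotient_map X Z g"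
    and eq: "\<And>x y. x \<in> topspace X \<Longrightarrow> y \<in> topspace X \<Longrightarrow> f x = f y \<longleftrightarrow> g x = g y"
  shows "Y homeomorphic_space Z"
proof -
  obtain k where k: "continuous_map Y Z k" "\<And>x. x \<in> topspace X \<Longrightarrow> k (f x) = g x"
    using quotient_map_lift_exists[OF f quotient_imp_continuous_map[OF g]] eq by metis
  obtain l where l: "continuous_map Z Y l" "\<And>x. x \<in> topspace X \<Longrightarrow> l (g x) = f x"
    using quotient_map_lift_exists[OF g quotient_imp_continuous_map[OF f]] eq by metis
  have "l (k y) = y" if "y \<in> topspace Y" for y
    using that k l quotient_imp_surjective_map[OF f] by (metis imageE)
  moreover have "k (l z) = z" if "z \<in> topspace Z" for z
    using that k l quotient_imp_surjective_map[OF g] by (metis imageE)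
  ultimately have "homeomorphic_maps Y Z k l"
    using k l by (simp add: homeomorphic_maps_def)
  then show ?thesis unfolding homeomorphic_space_def by blast
qed

text \<open>A section through every point of \<open>X\<close> makes \<open>f\<close> open: near
  \<open>f x\<close> the points whose section value stays in an open set \<open>B\<close> form an
  open set, and they lie in the image of \<open>B\<close>.\<close>

lemma local_sections_imp_quotient_map:
  assumes f: "continuous_map X Y f" "f ` topspace X = topspace Y"
    and sec: "\<And>x. x \<in> topspace X \<Longrightarrow> \<exists>U \<sigma>. openin Y U \<and> f x \<in> U \<and>
      continuous_map (subtopology Y U) X \<sigma> \<and> \<sigma> (f x) = x \<and> (\<forall>y\<in>U. f (\<sigma> y) = y)"
  shows "quotient_map X Y f"
proof (rule continuous_open_imp_quotient_map[OF f(1) _ f(2)])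
  show "open_map X Y f"
    unfolding open_map_def
  proof (intro allI impI)
    fix B assume B: "openin X B"
    show "openin Y (f ` B)"
    proof (subst openin_subopen, intro ballI)
      fix y assume "y \<in> f ` B"
      then obtain x where x: "x \<in> B" "y = f x" "x \<in> topspace X" using openin_subset[OF B] by blast
      then obtain U \<sigma> where U: "openin Y U" "y \<in> U" "continuous_map (subtopology Y U) X \<sigma>"
        "\<sigma> y = x" "\<forall>y\<in>U. f (\<sigma> y) = y" using sec by blast
      let ?T = "{z \<in> topspace (subtopology Y U). \<sigma> z \<in> B}"
      have "openin (subtopology Y U) ?T" using U(3) B by (rule openin_continuous_map_preimage)
      then have "openin Y ?T" using U(1) openin_trans_full by blast
      moreover have "y \<in> ?T" using x U openin_subset[OF U(1)] by auto
      moreover have "?T \<subseteq> f ` B" using U(5) by force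
      ultimately show "\<exists>T. openin Y T \<and> y \<in> T \<and> T \<subseteq> f ` B" by blast
    qed
  qed
qed

lemma quotient_map_quotient_topology: "quotient_map T (quotient_topology T q) q"
proof -
  have "{x \<in> topspace T. q x \<in> q ` topspace T} = topspace T" by blast
  then have "openin (quotient_topology T q) (q ` topspace T)"
    by (simp add: openin_quotient_topology)
  moreover have "topspace (quotient_topology T q) \<subseteq> q ` topspace T"
    using openin_quotient_topology[of T q "topspace (quotient_topology T q)"] openin_topspace by blast
  ultimately have "topspace (quotient_topology T q) = q ` topspace T"
    using openin_subset by (intro subset_antisym)
  then show ?thesis
    unfolding quotient_map_def openin_quotient_topology by simp
qed

section \<open>Equivariant families and clutching maps\<close>

lemma group_actionD:
  assumes "group_action G E \<phi>" "x \<in> E"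
  shows "g \<in> carrier G \<Longrightarrow> \<phi> g x \<in> E"
    and "g \<in> carrier G \<Longrightarrow> \<phi> (inv\<^bsub>G\<^esub> g) (\<phi> g x) = x"
    and "g \<in> carrier G \<Longrightarrow> \<phi> g (\<phi> (inv\<^bsub>G\<^esub> g) x) = x"
    and "g \<in> carrier G \<Longrightarrow> h \<in> carrier G \<Longrightarrow> \<phi> (g \<otimes>\<^bsub>G\<^esub> h) x = \<phi> g (\<phi> h x)"
    and "\<phi> \<one>\<^bsub>G\<^esub> x = x"
proof -
  interpret A: group_action G E \<phi> by (rule assms(1))
  interpret group G by (rule group_hom.axioms(1)[OF A.group_hom])
  show "\<phi> g x \<in> E" if "g \<in> carrier G" using A.element_image[OF that assms(2) refl] .
  show "\<phi> (inv\<^bsub>G\<^esub> g) (\<phi> g x) = x" if "g \<in> carrier G"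
    using A.orbit_sym_aux[OF that assms(2) refl] .
  show "\<phi> g (\<phi> (inv\<^bsub>G\<^esub> g) x) = x" if "g \<in> carrier G"
    using A.orbit_sym_aux[OF inv_closed[OF that] assms(2) refl] that by simp
  show "\<phi> (g \<otimes>\<^bsub>G\<^esub> h) x = \<phi> g (\<phi> h x)" if "g \<in> carrier G" "h \<in> carrier G"
    using A.composition_rule[OF assms(2) that] .
  show "\<phi> \<one>\<^bsub>G\<^esub> x = x" using A.id_eq_one assms(2) by (metis restrict_apply')
qed

text \<open>The isomorphisms \<open>\<alpha> s\<close> and the coordinates \<open>fw\<close>,
  \<open>fb x\<close> are choices. As parameters they stay fixed throughout, so that all
  constructions refer to the same ones.\<close>

locale bundle_extension =
  fixes G :: "('g, 'm) monoid_scheme" and X :: "'x set" and act :: "'g \<Rightarrow> 'x \<Rightarrow> 'x"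
    and TG :: "'g topology" and F :: "('g, 'x, 'f) vbundle" and w :: "('g, 'w) rep"
    and S :: "'x set" and \<alpha> :: "'x \<Rightarrow> 'w \<Rightarrow> 'f"
    and nw :: nat and fw :: "'w \<Rightarrow> nat \<Rightarrow> complex"
    and nb :: "'x \<Rightarrow> nat" and fb :: "'x \<Rightarrow> 'f \<Rightarrow> nat \<Rightarrow> complex"
  assumes act: "group_action G X act"
    and F: "equivariant_vector_bundle G TG (discrete_topology X) act F"
    and wact: "group_action G (carrier (rspace w)) (ract w)"
    and wlin: "\<And>g. g \<in> carrier G \<Longrightarrow> lin_map (rspace w) (rspace w) (ract w g)"
    and fw: "coordinates (rspace w) nw fw"
    and fb: "\<And>x. x \<in> X \<Longrightarrow> coordinates (bfib F x) (nb x) (fb x)"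
    and X: "X \<noteq> {}"
    and S: "S \<subseteq> X" "\<forall>C\<in>orbits G X act. \<exists>!s. s \<in> S \<inter> C"
    and \<alpha>: "\<And>s. s \<in> S \<Longrightarrow> \<alpha> s \<in> rep_isos (stabilizer G act s) w (fiber_rep F s)"
begin

abbreviation W where "W \<equiv> rspace w"

lemma vb: "vector_bundle (discrete_topology X) F"
  using F unfolding equivariant_vector_bundle_def by (elim conjE)

lemma group_G: "group G"
  using act by (simp add: group_action_def group_hom_def)

lemma bact: "group_action G (topspace (btop F)) (bact F)"
  using F unfolding equivariant_vector_bundle_def continuous_action_def by (elim conjE)

lemma bact_lin: "g \<in> carrier G \<Longrightarrow> x \<in> X \<Longrightarrow> lin_map (bfib F x) (bfib F (act g x)) (bact F g)"
  using F by (simp add: equivariant_vector_bundle_def)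

lemma inv_closed: "g \<in> carrier G \<Longrightarrow> inv\<^bsub>G\<^esub> g \<in> carrier G"
  using group_G by (rule group.inv_closed)

lemmas act_simps = group_actionD(1,2,3)[OF act]
lemmas wact_simps = group_actionD(1,2,3)[OF wact]

lemma bact_simps:
  assumes "x \<in> X" "u \<in> carrier (bfib F x)" "g \<in> carrier G"
  shows "bact F g u \<in> carrier (bfib F (act g x))"
    and "bact F (inv\<^bsub>G\<^esub> g) (bact F g u) = u"
    and "bact F g (bact F (inv\<^bsub>G\<^esub> g) u) = u"
proof -
  have "u \<in> topspace (btop F)" using carrier_bfib[OF vb assms(1)] assms(2) by blast
  then show "bact F (inv\<^bsub>G\<^esub> g) (bact F g u) = u" "bact F g (bact F (inv\<^bsub>G\<^esub> g) u) = u"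
    using group_actionD[OF bact] assms(3) by blast+
  show "bact F g u \<in> carrier (bfib F (act g x))"
    using bact_lin[OF assms(3,1)] assms(2) by (auto simp: lin_map_def)
qed

lemma bact_mult:
  assumes "x \<in> X" "u \<in> carrier (bfib F x)" "g \<in> carrier G" "h \<in> carrier G"
  shows "bact F (g \<otimes>\<^bsub>G\<^esub> h) u = bact F g (bact F h u)"
  using group_actionD(4)[OF bact] carrier_bfib[OF vb assms(1)] assms by blast

text \<open>Only the values over \<open>X\<close> are constrained; two families that represent the
  same mathematical object may differ elsewhere. Hence comparisons of families are made pointwise on
  \<open>X\<close>.\<close>

definition families :: "('x \<Rightarrow> 'w \<Rightarrow> 'f) set" where
  "families = {\<phi>. (\<forall>x\<in>X. \<phi> x \<in> lin_isos W (bfib F x)) \<and>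
     (\<forall>g\<in>carrier G. \<forall>x\<in>X. \<forall>v\<in>carrier W. \<phi> (act g x) (ract w g v) = bact F g (\<phi> x v))}"

definition clutch :: "('x \<Rightarrow> 'w \<Rightarrow> 'f) \<Rightarrow> 'x \<times> 'x \<Rightarrow> 'f \<Rightarrow> 'f" where
  "clutch \<phi> = (\<lambda>(x, x')\<in>X \<times> X. \<lambda>u\<in>carrier (bfib F x). \<phi> x' (inv_into (carrier W) (\<phi> x) u))"

lemma familiesD:
  assumes "\<phi> \<in> families" "x \<in> X"
  shows "\<phi> x \<in> lin_isos W (bfib F x)"
    and "\<And>v. v \<in> carrier W \<Longrightarrow> \<phi> x v \<in> carrier (bfib F x)"
    and "\<And>v. v \<in> carrier W \<Longrightarrow> inv_into (carrier W) (\<phi> x) (\<phi> x v) = v"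
    and "\<And>u. u \<in> carrier (bfib F x) \<Longrightarrow> inv_into (carrier W) (\<phi> x) u \<in> carrier W"
    and "\<And>u. u \<in> carrier (bfib F x) \<Longrightarrow> \<phi> x (inv_into (carrier W) (\<phi> x) u) = u"
    and "\<And>g v. g \<in> carrier G \<Longrightarrow> v \<in> carrier W \<Longrightarrow> \<phi> (act g x) (ract w g v) = bact F g (\<phi> x v)"
proof -
  show *: "\<phi> x \<in> lin_isos W (bfib F x)" using assms by (simp add: families_def)
  show "\<And>v. v \<in> carrier W \<Longrightarrow> \<phi> x v \<in> carrier (bfib F x)"
    "\<And>v. v \<in> carrier W \<Longrightarrow> inv_into (carrier W) (\<phi> x) (\<phi> x v) = v"
    "\<And>u. u \<in> carrier (bfib F x) \<Longrightarrow> inv_into (carrier W) (\<phi> x) u \<in> carrier W"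
    "\<And>u. u \<in> carrier (bfib F x) \<Longrightarrow> \<phi> x (inv_into (carrier W) (\<phi> x) u) = u"
    using lin_isosD[OF *] by auto
  show "\<And>g v. g \<in> carrier G \<Longrightarrow> v \<in> carrier W \<Longrightarrow> \<phi> (act g x) (ract w g v) = bact F g (\<phi> x v)"
    using assms by (simp add: families_def)
qed

lemma clutch_apply:
  "x \<in> X \<Longrightarrow> x' \<in> X \<Longrightarrow> u \<in> carrier (bfib F x) \<Longrightarrow>
    clutch \<phi> (x, x') u = \<phi> x' (inv_into (carrier W) (\<phi> x) u)"
  by (simp add: clutch_def)

lemma clutch_cong:
  assumes "\<And>x. x \<in> X \<Longrightarrow> \<phi> x = \<phi>' x"
  shows "clutch \<phi> = clutch \<phi>'"
  unfolding clutch_def by (intro restrict_ext) (auto simp: assms)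

lemma clutch_in_clutching_maps:
  assumes \<phi>: "\<phi> \<in> families"
  shows "clutch \<phi> \<in> clutching_maps X F"
proof -
  note D = familiesD[OF \<phi>]
  have iso: "clutch \<phi> (x, x') \<in> lin_isos (bfib F x) (bfib F x')" if "x \<in> X" "x' \<in> X" for x x'
  proof -
    have "(\<lambda>u\<in>carrier (bfib F x). \<phi> x' (restrict (inv_into (carrier W) (\<phi> x)) (carrier (bfib F x)) u))
        \<in> lin_isos (bfib F x) (bfib F x')"
      by (rule compose_lin_isos[OF fb[OF that(1)] inv_into_lin_isos[OF fw D(1)[OF that(1)]]
            D(1)[OF that(2)]])
    then show ?thesis using that by (simp add: clutch_def cong: restrict_cong)
  qed
  have "clutch \<phi> (x, x') =
      (\<lambda>u\<in>carrier (bfib F x). inv_into (carrier (bfib F x')) (clutch \<phi> (x', x)) u)"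
    if x: "x \<in> X" "x' \<in> X" for x x'
  proof (rule extensionalityI[where A = "carrier (bfib F x)"])
    fix u assume u: "u \<in> carrier (bfib F x)"
    let ?u' = "clutch \<phi> (x, x') u"
    have "clutch \<phi> (x', x) ?u' = u" "?u' \<in> carrier (bfib F x')"
      using x u by (simp_all add: clutch_apply D)
    then show "?u' = (\<lambda>u\<in>carrier (bfib F x). inv_into (carrier (bfib F x')) (clutch \<phi> (x', x)) u) u"
      using lin_isosD(5)[OF iso[OF x(2,1)], of ?u'] u by simp
  qed (use x in \<open>auto simp: clutch_def\<close>)
  moreover have "clutch \<phi> \<in> (\<Pi>\<^sub>E (x, x')\<in>X \<times> X. lin_isos (bfib F x) (bfib F x'))"
    using iso by (auto simp: PiE_iff clutch_def)
  moreover have "clutch \<phi> (x, x) = (\<lambda>u\<in>carrier (bfib F x). u)" if "x \<in> X" for x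
    using that by (auto simp: clutch_def D intro!: restrict_ext)
  moreover have "clutch \<phi> (x, x'') = compose (carrier (bfib F x)) (clutch \<phi> (x', x'')) (clutch \<phi> (x, x'))"
    if "x \<in> X" "x' \<in> X" "x'' \<in> X" for x x' x''
    by (rule extensionalityI[where A = "carrier (bfib F x)"])
      (use that in \<open>auto simp: compose_eq clutch_apply D, auto simp: clutch_def\<close>)
  ultimately show ?thesis unfolding clutching_maps_def by blast
qed

text \<open>If \<open>u\<close> is \<open>\<phi> x v\<close>, then translating \<open>u\<close> by
  the inverse of \<open>g\<close> replaces \<open>v\<close> by its translate, by equivariance of the
  family. Applying the member over the translate of \<open>x'\<close> gives the translate of
  \<open>\<phi> x' v\<close>, and the outer \<open>g\<close> cancels.\<close>

lemma clutch_in_Psi: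
  assumes \<phi>: "\<phi> \<in> families"
  shows "clutch \<phi> \<in> Psi G X act F"
proof -
  note D = familiesD[OF \<phi>]
  have "clutching_act G X act F g (clutch \<phi>) (x, x') u = clutch \<phi> (x, x') u"
    if g: "g \<in> carrier G" and x: "x \<in> X" "x' \<in> X" and u: "u \<in> carrier (bfib F x)" for g x x' u
  proof -
    let ?v = "inv_into (carrier W) (\<phi> x) u"
    note gi = inv_closed[OF g]
    have v: "?v \<in> carrier W" "\<phi> x ?v = u" using D x u by auto
    have ax: "act (inv\<^bsub>G\<^esub> g) x \<in> X" "act (inv\<^bsub>G\<^esub> g) x' \<in> X" using act_simps gi x by blast+
    have "bact F (inv\<^bsub>G\<^esub> g) u = \<phi> (act (inv\<^bsub>G\<^esub> g) x) (ract w (inv\<^bsub>G\<^esub> g) ?v)"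
      using D(6)[OF x(1) gi v(1)] v(2) by simp
    then have "clutch \<phi> (act (inv\<^bsub>G\<^esub> g) x, act (inv\<^bsub>G\<^esub> g) x') (bact F (inv\<^bsub>G\<^esub> g) u)
        = \<phi> (act (inv\<^bsub>G\<^esub> g) x') (ract w (inv\<^bsub>G\<^esub> g) ?v)"
      using ax v wact_simps(1)[OF v(1) gi] by (simp add: clutch_apply D)
    also have "\<dots> = bact F (inv\<^bsub>G\<^esub> g) (\<phi> x' ?v)" using D(6)[OF x(2) gi v(1)] .
    finally show ?thesis
      using x u bact_simps(3)[OF x(2) D(2)[OF x(2) v(1)] g] by (simp add: clutching_act_def clutch_apply)
  qed
  then have "clutching_act G X act F g (clutch \<phi>) = clutch \<phi>" if "g \<in> carrier G" for g
    using that by (auto simp: clutching_act_def clutch_def intro!: restrict_ext)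
  then show ?thesis using clutch_in_clutching_maps[OF \<phi>] by (simp add: Psi_def)
qed

lemma PsiD:
  assumes "\<psi> \<in> Psi G X act F"
  shows "\<psi> \<in> clutching_maps X F"
    and "\<And>x x'. x \<in> X \<Longrightarrow> x' \<in> X \<Longrightarrow> \<psi> (x, x') \<in> lin_isos (bfib F x) (bfib F x')"
    and "\<psi> \<in> extensional (X \<times> X)"
    and "\<And>g x x' u. g \<in> carrier G \<Longrightarrow> x \<in> X \<Longrightarrow> x' \<in> X \<Longrightarrow> u \<in> carrier (bfib F x) \<Longrightarrow>
      \<psi> (act g x, act g x') (bact F g u) = bact F g (\<psi> (x, x') u)"
proof -
  show \<psi>: "\<psi> \<in> clutching_maps X F" using assms by (simp add: Psi_def)
  then have PiE: "\<psi> \<in> (\<Pi>\<^sub>E (x, x')\<in>X \<times> X. lin_isos (bfib F x) (bfib F x'))"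
    unfolding clutching_maps_def mem_Collect_eq by (elim conjE)
  show "\<psi> (x, x') \<in> lin_isos (bfib F x) (bfib F x')" if "x \<in> X" "x' \<in> X" for x x'
    using PiE_mem[OF PiE, of "(x, x')"] that by simp
  show "\<psi> \<in> extensional (X \<times> X)" using PiE by (simp add: PiE_def)
  fix g x x' u assume g: "g \<in> carrier G" and x: "x \<in> X" "x' \<in> X" and u: "u \<in> carrier (bfib F x)"
  have "clutching_act G X act F g \<psi> (act g x, act g x') (bact F g u) = bact F g (\<psi> (x, x') u)"
    using g x u by (simp add: clutching_act_def act_simps bact_simps)
  then show "\<psi> (act g x, act g x') (bact F g u) = bact F g (\<psi> (x, x') u)"
    using assms g by (simp add: Psi_def)
qed

lemma clutch_eqI:
  assumes \<psi>: "\<psi> \<in> Psi G X act F"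
    and eq: "\<And>x x' u. x \<in> X \<Longrightarrow> x' \<in> X \<Longrightarrow> u \<in> carrier (bfib F x) \<Longrightarrow> clutch \<phi> (x, x') u = \<psi> (x, x') u"
  shows "clutch \<phi> = \<psi>"
proof (rule extensionalityI[where A = "X \<times> X"])
  fix z assume "z \<in> X \<times> X"
  then obtain x x' where x: "z = (x, x')" "x \<in> X" "x' \<in> X" by blast
  have "clutch \<phi> (x, x') = \<psi> (x, x')"
  proof (rule extensionalityI[where A = "carrier (bfib F x)"])
    show "clutch \<phi> (x, x') \<in> extensional (carrier (bfib F x))" using x by (simp add: clutch_def)
    show "\<psi> (x, x') \<in> extensional (carrier (bfib F x))"
      using lin_isosD(3)[OF PsiD(2)[OF \<psi> x(2,3)]] .
  qed (rule eq[OF x(2,3)])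
  then show "clutch \<phi> z = \<psi> z" by (simp add: x)
qed (use PsiD(3)[OF \<psi>] in \<open>simp_all add: clutch_def\<close>)

section \<open>Clutching maps whose quotient is isomorphic to the given representation\<close>

lemma class_eq:
  assumes "\<psi> \<in> clutching_maps X F" "x \<in> X" "x' \<in> X" "u \<in> carrier (bfib F x)"
  shows "clutch_rel F \<psi> `` {\<psi> (x, x') u} = clutch_rel F \<psi> `` {u}"
proof -
  have "\<psi> (x, x') u \<in> carrier (bfib F x')" using clutching_mapsD(3)[OF assms] .
  then have "(u, \<psi> (x, x') u) \<in> clutch_rel F \<psi>"
    using assms carrier_bfib[OF vb] by (auto simp: clutch_rel_def)
  then show ?thesis using equiv_class_eq[OF equiv_clutch_rel[OF vb assms(1)]] by blast
qed

text \<open>The isomorphism onto \<open>w\<close> sends the class of \<open>u\<close> in the fiber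
  over \<open>x\<close> to the preimage of \<open>u\<close> under \<open>\<phi> x\<close>; the
  clutching relation is exactly what makes this independent of the representative.\<close>

lemma clutch_in_Psi_class:
  assumes \<phi>: "\<phi> \<in> families"
  shows "clutch \<phi> \<in> Psi_class G X act F w"
proof -
  note D = familiesD[OF \<phi>] and cm = clutch_in_clutching_maps[OF \<phi>]
  obtain x0 where x0: "x0 \<in> X" using X by blast
  define r where "r = clutch_rel F (clutch \<phi>)"
  let ?Q = "quot_space X F (clutch \<phi>)"
  have pi: "(\<lambda>u\<in>carrier (bfib F x). r `` {u}) \<in> lin_isos (bfib F x) ?Q" if "x \<in> X" for x
    using quot_map_lin_iso[OF vb cm that] by (simp add: r_def)
  define \<pi> where "\<pi> = (\<lambda>u\<in>carrier (bfib F x0). r `` {u})"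
  have \<pi>: "\<pi> \<in> lin_isos (bfib F x0) ?Q" using pi[OF x0] by (simp add: \<pi>_def)
  define \<kappa> where "\<kappa> = (\<lambda>v\<in>carrier W. \<pi> (\<phi> x0 v))"
  have \<kappa>: "\<kappa> \<in> lin_isos W ?Q"
    unfolding \<kappa>_def by (rule compose_lin_isos[OF fw D(1)[OF x0] \<pi>])
  define k where "k = restrict (inv_into (carrier W) \<kappa>) (carrier ?Q)"
  have k: "k \<in> lin_isos ?Q W"
    unfolding k_def by (rule inv_into_lin_isos[OF fw \<kappa>])
  \<comment> \<open>The formula is needed over every \<open>x\<close>, not just \<open>x0\<close>,
    since \<open>g\<close> moves the fiber over \<open>x0\<close> to the one over
    \<open>act g x0\<close>.\<close>
  have k_class: "k (r `` {u}) = inv_into (carrier W) (\<phi> x) u"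
    if x: "x \<in> X" and u: "u \<in> carrier (bfib F x)" for x u
  proof -
    let ?v = "inv_into (carrier W) (\<phi> x) u"
    have u0: "clutch \<phi> (x, x0) u \<in> carrier (bfib F x0)" using clutching_mapsD(3)[OF cm x x0 u] .
    have v: "?v \<in> carrier W" using D(4)[OF x u] .
    have "r `` {u} = \<pi> (clutch \<phi> (x, x0) u)"
      using class_eq[OF cm x x0 u] u0 by (simp add: \<pi>_def r_def)
    also have "\<dots> = \<kappa> ?v" using v by (simp add: \<kappa>_def clutch_apply x x0 u)
    finally show ?thesis using lin_isosD(4,5)[OF \<kappa> v] by (simp add: k_def)
  qed
  have surj: "\<exists>u\<in>carrier (bfib F x0). c = r `` {u}" if "c \<in> carrier ?Q" for c
    using lin_isosD(6,7)[OF \<pi> that] by (metis \<pi>_def restrict_apply')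
  have "k (ract (quot_rep X F (clutch \<phi>)) g c) = ract w g (k c)"
    if g: "g \<in> carrier G" and c: "c \<in> carrier ?Q" for g c
  proof -
    obtain u where u: "u \<in> carrier (bfib F x0)" "c = r `` {u}" using surj[OF c] by blast
    let ?v = "inv_into (carrier W) (\<phi> x0) u"
    have v: "?v \<in> carrier W" "\<phi> x0 ?v = u" using D x0 u by auto
    have "u \<in> topspace (btop F)" using carrier_bfib[OF vb x0] u by blast
    then have "ract (quot_rep X F (clutch \<phi>)) g c = r `` {bact F g u}"
      using quot_map_equivariant[OF act F clutch_in_Psi[OF \<phi>] g] u by (simp add: r_def)
    then have "k (ract (quot_rep X F (clutch \<phi>)) g c) = inv_into (carrier W) (\<phi> (act g x0)) (bact F g u)"
      using k_class[OF act_simps(1)[OF x0 g] bact_simps(1)[OF x0 u(1) g]] by simp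
    also have "bact F g u = \<phi> (act g x0) (ract w g ?v)" using D(6)[OF x0 g v(1)] v(2) by simp
    also have "inv_into (carrier W) (\<phi> (act g x0)) \<dots> = ract w g ?v"
      using D(3)[OF act_simps(1)[OF x0 g] wact_simps(1)[OF v(1) g]] .
    finally show ?thesis using k_class[OF x0 u(1)] u(2) by simp
  qed
  then have "k \<in> rep_isos (carrier G) (quot_rep X F (clutch \<phi>)) w"
    using k by (simp add: rep_isos_def quot_rep_def)
  then show ?thesis using clutch_in_Psi[OF \<phi>] by (auto simp: Psi_class_def)
qed

text \<open>Each fiber maps isomorphically onto the quotient and on to \<open>w\<close> by
  \<open>k\<close>; the inverses \<open>\<phi> x\<close> of these composites \<open>q x\<close> form
  the family. Points related by \<open>\<psi>\<close> have the same class, so \<open>q x\<close> and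
  \<open>q x'\<close> agree on them.\<close>

lemma Psi_class_imp_clutch:
  assumes "\<psi> \<in> Psi_class G X act F w"
  obtains \<phi> where "\<phi> \<in> families" "clutch \<phi> = \<psi>"
proof -
  have \<psi>: "\<psi> \<in> Psi G X act F" using assms by (simp add: Psi_class_def)
  note P = PsiD[OF \<psi>]
  obtain k where k: "k \<in> rep_isos (carrier G) (quot_rep X F \<psi>) w"
    using assms by (auto simp: Psi_class_def)
  let ?Q = "quot_space X F \<psi>"
  define r where "r = clutch_rel F \<psi>"
  have ki: "k \<in> lin_isos ?Q W" using k by (simp add: rep_isos_def quot_rep_def)
  have pi: "(\<lambda>u\<in>carrier (bfib F x). r `` {u}) \<in> lin_isos (bfib F x) ?Q" if "x \<in> X" for x
    using quot_map_lin_iso[OF vb P(1) that] by (simp add: r_def)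
  define q where "q x = (\<lambda>u\<in>carrier (bfib F x). k ((\<lambda>u\<in>carrier (bfib F x). r `` {u}) u))" for x
  have q: "q x \<in> lin_isos (bfib F x) W" if "x \<in> X" for x
    unfolding q_def by (rule compose_lin_isos[OF fb[OF that] pi[OF that] ki])
  have q_apply: "q x u = k (r `` {u})" if "u \<in> carrier (bfib F x)" for x u
    using that by (simp add: q_def)
  define \<phi> where "\<phi> x = restrict (inv_into (carrier (bfib F x)) (q x)) (carrier W)" for x
  have \<phi>_iso: "\<phi> x \<in> lin_isos W (bfib F x)" if "x \<in> X" for x
    unfolding \<phi>_def by (rule inv_into_lin_isos[OF fb[OF that] q[OF that]])
  have \<phi>q: "\<phi> x (q x u) = u" if "x \<in> X" "u \<in> carrier (bfib F x)" for x u
    using lin_isosD(4,5)[OF q[OF that(1)] that(2)] by (simp add: \<phi>_def)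
  have q\<phi>: "q x (\<phi> x v) = v" "\<phi> x v \<in> carrier (bfib F x)" if "x \<in> X" "v \<in> carrier W" for x v
    using lin_isosD(6,7)[OF q[OF that(1)] that(2)] that(2) by (simp_all add: \<phi>_def)
  have fam: "\<phi> \<in> families"
    unfolding families_def
  proof (intro CollectI conjI ballI)
    fix g x v assume g: "g \<in> carrier G" and x: "x \<in> X" and v: "v \<in> carrier W"
    define u where "u = \<phi> x v"
    have u: "u \<in> carrier (bfib F x)" "k (r `` {u}) = v"
      using q\<phi>[OF x v] q_apply by (auto simp: u_def)
    have "u \<in> topspace (btop F)" using carrier_bfib[OF vb x] u by blast
    then have "ract (quot_rep X F \<psi>) g (r `` {u}) = r `` {bact F g u}"
      using quot_map_equivariant[OF act F \<psi> g] by (simp add: r_def)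
    moreover have "r `` {u} \<in> carrier ?Q"
      using lin_isosD(4)[OF pi[OF x] u(1)] u(1) by simp
    moreover have "rspace (quot_rep X F \<psi>) = ?Q" by (simp add: quot_rep_def)
    ultimately have "k (r `` {bact F g u}) = ract w g v"
      using k g u(2) unfolding rep_isos_def by force
    then have "q (act g x) (bact F g u) = ract w g v"
      using q_apply bact_simps(1)[OF x u(1) g] by simp
    then show "\<phi> (act g x) (ract w g v) = bact F g (\<phi> x v)"
      using \<phi>q[OF act_simps(1)[OF x g] bact_simps(1)[OF x u(1) g]] by (simp add: u_def)
  qed (rule \<phi>_iso)
  note D = familiesD[OF fam]
  have "clutch \<phi> (x, x') u = \<psi> (x, x') u"
    if x: "x \<in> X" "x' \<in> X" and u: "u \<in> carrier (bfib F x)" for x x' u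
  proof -
    have u': "\<psi> (x, x') u \<in> carrier (bfib F x')" using lin_isosD(4)[OF P(2)[OF x] u] .
    have "inv_into (carrier W) (\<phi> x) u = q x u"
      using D(3)[OF x(1) lin_isosD(4)[OF q[OF x(1)] u]] \<phi>q[OF x(1) u] by simp
    also have "\<dots> = q x' (\<psi> (x, x') u)"
      using class_eq[OF P(1) x u] u u' by (simp add: q_apply r_def)
    finally show ?thesis using \<phi>q[OF x(2) u'] by (simp add: clutch_apply x u)
  qed
  then have "clutch \<phi> = \<psi>" by (rule clutch_eqI[OF \<psi>])
  then show ?thesis using fam that by blast
qed

text \<open>Comparing the families over one point \<open>x0\<close> defines \<open>h\<close>.
  Equality of the clutching maps propagates the comparison to all points with the same
  \<open>h\<close>, and comparing over \<open>act g x0\<close> shows that \<open>h\<close> commutes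
  with \<open>g\<close>.\<close>

lemma clutch_eq_iff:
  assumes \<phi>: "\<phi> \<in> families" and \<phi>': "\<phi>' \<in> families"
  shows "clutch \<phi> = clutch \<phi>' \<longleftrightarrow>
    (\<exists>h\<in>rep_isos (carrier G) w w. \<forall>x\<in>X. \<forall>v\<in>carrier W. \<phi>' x v = \<phi> x (h v))"
proof
  note D = familiesD[OF \<phi>] and D' = familiesD[OF \<phi>']
  assume eq: "clutch \<phi> = clutch \<phi>'"
  obtain x0 where x0: "x0 \<in> X" using X by blast
  define h where "h = (\<lambda>v\<in>carrier W. restrict (inv_into (carrier W) (\<phi> x0)) (carrier (bfib F x0)) (\<phi>' x0 v))"
  have h: "h \<in> lin_isos W W"
    unfolding h_def by (rule compose_lin_isos[OF fw D'(1)[OF x0] inv_into_lin_isos[OF fw D(1)[OF x0]]])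
  have hv: "\<phi>' x v = \<phi> x (h v)" if x: "x \<in> X" and v: "v \<in> carrier W" for x v
  proof -
    have "clutch \<phi>' (x0, x) (\<phi>' x0 v) = \<phi>' x v" using D' x0 x v by (simp add: clutch_apply)
    moreover have "clutch \<phi> (x0, x) (\<phi>' x0 v) = \<phi> x (h v)"
      using D' x0 x v by (simp add: clutch_apply h_def)
    ultimately show ?thesis using eq by simp
  qed
  have "h (ract w g v) = ract w g (h v)" if g: "g \<in> carrier G" and v: "v \<in> carrier W" for g v
  proof -
    note gv = wact_simps(1)[OF v g] and gx = act_simps(1)[OF x0 g]
    have hV: "h v \<in> carrier W" "h (ract w g v) \<in> carrier W" using lin_isosD(4)[OF h] v gv by blast+
    have "\<phi> (act g x0) (h (ract w g v)) = \<phi>' (act g x0) (ract w g v)" using hv[OF gx gv] by simp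
    also have "\<dots> = bact F g (\<phi> x0 (h v))" using D'(6)[OF x0 g v] hv[OF x0 v] by simp
    also have "\<dots> = \<phi> (act g x0) (ract w g (h v))" using D(6)[OF x0 g hV(1)] by simp
    finally show ?thesis using D(3)[OF gx] hV wact_simps(1)[OF hV(1) g] by metis
  qed
  then have "h \<in> rep_isos (carrier G) w w" using h by (simp add: rep_isos_def)
  then show "\<exists>h\<in>rep_isos (carrier G) w w. \<forall>x\<in>X. \<forall>v\<in>carrier W. \<phi>' x v = \<phi> x (h v)"
    using hv by blast
next
  note D = familiesD[OF \<phi>] and D' = familiesD[OF \<phi>']
  assume "\<exists>h\<in>rep_isos (carrier G) w w. \<forall>x\<in>X. \<forall>v\<in>carrier W. \<phi>' x v = \<phi> x (h v)"
  then obtain h where h: "h \<in> rep_isos (carrier G) w w"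
    and hv: "\<And>x v. x \<in> X \<Longrightarrow> v \<in> carrier W \<Longrightarrow> \<phi>' x v = \<phi> x (h v)" by blast
  have hV: "h v \<in> carrier W" if "v \<in> carrier W" for v
    using h that lin_isosD(4)[of h W W] by (simp add: rep_isos_def)
  have "\<phi> x' (inv_into (carrier W) (\<phi> x) u) = \<phi>' x' (inv_into (carrier W) (\<phi>' x) u)"
    if x: "x \<in> X" "x' \<in> X" and u: "u \<in> carrier (bfib F x)" for x x' u
  proof -
    let ?v = "inv_into (carrier W) (\<phi>' x) u"
    have v: "?v \<in> carrier W" "\<phi>' x ?v = u" using D' x u by auto
    then have "inv_into (carrier W) (\<phi> x) u = h ?v"
      using hv[OF x(1) v(1)] D(3)[OF x(1) hV[OF v(1)]] by simp
    then show ?thesis using hv[OF x(2) v(1)] by simp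
  qed
  then show "clutch \<phi> = clutch \<phi>'" by (auto simp: clutch_def intro!: restrict_ext)
qed

section \<open>The product of isomorphism groups, the class of clutching maps, and tests for
  continuity into them\<close>

abbreviation P where "P \<equiv> \<Pi>\<^sub>E s\<in>S. rep_isos (stabilizer G act s) w w"

abbreviation TP where "TP \<equiv> product_topology (\<lambda>s. iso_group_topology (stabilizer G act s) w) S"

abbreviation TPsi where "TPsi \<equiv> subtopology (Psi_topology G X act F) (Psi_class G X act F w)"

lemma topspace_iso_group_topology: "topspace (iso_group_topology K w) = rep_isos K w w"
  by (auto simp: iso_group_topology_def topspace_iso_topology rep_isos_def)

lemma topspace_TP: "topspace TP = P"
  by (simp add: topspace_iso_group_topology)

text \<open>Combines the componentwise test for products with pointwise convergence of linear maps,
  so that only evaluations at single vectors have to be examined.\<close>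

lemma continuous_map_TP:
  "continuous_map Z TP h \<longleftrightarrow> h \<in> topspace Z \<rightarrow> P \<and>
     (\<forall>s\<in>S. \<forall>v\<in>carrier W. continuous_map Z (fd_topology W) (\<lambda>z. h z s v))"
proof -
  have "continuous_map Z (iso_group_topology K w) k \<longleftrightarrow> k \<in> topspace Z \<rightarrow> rep_isos K w w \<and>
     (\<forall>v\<in>carrier W. continuous_map Z (fd_topology W) (\<lambda>z. k z v))" for K k
    unfolding iso_group_topology_def continuous_map_in_subtopology continuous_map_iso_topology[OF fw fw]
    by (auto simp: rep_isos_def)
  then show ?thesis unfolding continuous_map_componentwise by (auto simp: PiE_def Pi_iff)
qed

lemma topspace_TPsi: "topspace TPsi = Psi_class G X act F w"
proof -
  have "\<psi> \<in> topspace (Psi_topology G X act F)" if "\<psi> \<in> Psi_class G X act F w" for \<psi>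
  proof -
    have "\<psi> \<in> Psi G X act F" using that by (simp add: Psi_class_def)
    then show ?thesis using PsiD(2,3)
      by (auto simp: Psi_topology_def PiE_iff topspace_iso_topology)
  qed
  then show ?thesis by auto
qed

lemma continuous_map_TPsi:
  "continuous_map Z TPsi h \<longleftrightarrow> h \<in> topspace Z \<rightarrow> Psi_class G X act F w \<and>
     (\<forall>x\<in>X. \<forall>x'\<in>X. \<forall>u\<in>carrier (bfib F x). continuous_map Z (fd_topology (bfib F x')) (\<lambda>z. h z (x, x') u))"
    (is "?L \<longleftrightarrow> ?R")
proof
  assume L: ?L
  have "continuous_map Z (iso_topology (bfib F x) (bfib F x')) (\<lambda>z. h z (x, x'))"
    if "x \<in> X" "x' \<in> X" for x x'
    using L that unfolding Psi_topology_def continuous_map_in_subtopology continuous_map_componentwise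
    by fastforce
  then show ?R
    using L continuous_map_funspace[OF L] topspace_TPsi
    by (simp add: continuous_map_iso_topology[OF fb fb])
next
  assume R: ?R
  have psi: "h z \<in> Psi G X act F" if "z \<in> topspace Z" for z
    using R that by (auto simp: Psi_class_def)
  have "continuous_map Z (iso_topology (bfib F x) (bfib F x')) (\<lambda>z. h z (x, x'))"
    if "x \<in> X" "x' \<in> X" for x x'
    using R that psi PsiD(2) by (simp add: continuous_map_iso_topology[OF fb fb])
  then show ?L
    using R psi PsiD(3) unfolding Psi_topology_def continuous_map_in_subtopology continuous_map_componentwise
    by (auto simp: image_subset_iff)
qed

section \<open>Orbit representatives and the families attached to points of the product\<close>

lemma representative:
  assumes "x \<in> X"
  obtains s g where "s \<in> S" "g \<in> carrier G" "x = act g s"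
proof -
  interpret A: group_action G X act by (rule act)
  have "orbit G act x \<in> orbits G X act" using assms by (auto simp: orbits_def)
  then obtain s where s: "s \<in> S" "s \<in> orbit G act x" using S(2) by blast
  then have "x \<in> orbit G act s" using A.orbit_sym[OF assms] S(1) by blast
  then show ?thesis using s(1) that by (auto simp: orbit_def)
qed

lemma representative_unique:
  assumes "s \<in> S" "s' \<in> S" "g \<in> carrier G" "act g s = s'"
  shows "s = s'"
proof -
  interpret A: group_action G X act by (rule act)
  have sX: "s \<in> X" using assms S(1) by blast
  then have "orbit G act s \<in> orbits G X act" by (auto simp: orbits_def)
  moreover have "s \<in> orbit G act s" using A.orbit_refl[OF sX] .
  moreover have "s' \<in> orbit G act s" using assms by (auto simp: orbit_def)
  ultimately show ?thesis using S(2) assms(1,2) by blast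
qed

definition rep_of :: "'x \<Rightarrow> 'x" where
  "rep_of x = (SOME s. s \<in> S \<and> (\<exists>g\<in>carrier G. x = act g s))"

text \<open>The representative of an orbit is unique, but a group element carrying it to
  \<open>x\<close> is determined only up to its stabilizer. \<open>family_orbit\<close> removes the
  dependence on this choice.\<close>

definition to_rep :: "'x \<Rightarrow> 'g" where
  "to_rep x = (SOME g. g \<in> carrier G \<and> x = act g (rep_of x))"

lemma rep_of:
  assumes "x \<in> X"
  shows "rep_of x \<in> S" "to_rep x \<in> carrier G" "act (to_rep x) (rep_of x) = x"
proof -
  have "\<exists>s. s \<in> S \<and> (\<exists>g\<in>carrier G. x = act g s)" using representative[OF assms] by metis
  then have *: "rep_of x \<in> S \<and> (\<exists>g\<in>carrier G. x = act g (rep_of x))"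
    unfolding rep_of_def by (rule someI_ex)
  then show "rep_of x \<in> S" by blast
  have "\<exists>g. g \<in> carrier G \<and> x = act g (rep_of x)" using * by blast
  then have "to_rep x \<in> carrier G \<and> x = act (to_rep x) (rep_of x)"
    unfolding to_rep_def by (rule someI_ex)
  then show "to_rep x \<in> carrier G" "act (to_rep x) (rep_of x) = x" by auto
qed

definition family :: "('x \<Rightarrow> 'w \<Rightarrow> 'w) \<Rightarrow> 'x \<Rightarrow> 'w \<Rightarrow> 'f" where
  "family p x = (\<lambda>v\<in>carrier W.
     bact F (to_rep x) (\<alpha> (rep_of x) (p (rep_of x) (ract w (inv\<^bsub>G\<^esub> (to_rep x)) v))))"

lemma \<alpha>D:
  assumes "s \<in> S"
  shows "\<alpha> s \<in> lin_isos W (bfib F s)"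
    and "\<And>v. v \<in> carrier W \<Longrightarrow> \<alpha> s v \<in> carrier (bfib F s)"
    and "\<And>h v. h \<in> stabilizer G act s \<Longrightarrow> v \<in> carrier W \<Longrightarrow> \<alpha> s (ract w h v) = bact F h (\<alpha> s v)"
proof -
  show 1: "\<alpha> s \<in> lin_isos W (bfib F s)" using \<alpha>[OF assms] by (simp add: rep_isos_def fiber_rep_def)
  show 2: "\<And>v. v \<in> carrier W \<Longrightarrow> \<alpha> s v \<in> carrier (bfib F s)" using lin_isosD(4)[OF 1] .
  show "\<And>h v. h \<in> stabilizer G act s \<Longrightarrow> v \<in> carrier W \<Longrightarrow> \<alpha> s (ract w h v) = bact F h (\<alpha> s v)"
    using \<alpha>[OF assms] 2 by (simp add: rep_isos_def fiber_rep_def)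
qed

lemma PD:
  assumes "p \<in> P" "s \<in> S"
  shows "p s \<in> lin_isos W W"
    and "\<And>v. v \<in> carrier W \<Longrightarrow> p s v \<in> carrier W"
    and "\<And>h v. h \<in> stabilizer G act s \<Longrightarrow> v \<in> carrier W \<Longrightarrow> p s (ract w h v) = ract w h (p s v)"
proof -
  have p: "p s \<in> rep_isos (stabilizer G act s) w w" using assms by blast
  then show 1: "p s \<in> lin_isos W W" by (simp add: rep_isos_def)
  show "\<And>v. v \<in> carrier W \<Longrightarrow> p s v \<in> carrier W" using lin_isosD(4)[OF 1] .
  show "\<And>h v. h \<in> stabilizer G act s \<Longrightarrow> v \<in> carrier W \<Longrightarrow> p s (ract w h v) = ract w h (p s v)"
    using p by (simp add: rep_isos_def)
qed

text \<open>The chosen element \<open>k\<close> and any other \<open>g\<close> with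
  \<open>x = act g s\<close> satisfy \<open>g = k h\<close> with \<open>h\<close> in the stabilizer
  of \<open>s\<close>. Both \<open>\<alpha> s\<close> and \<open>p s\<close> commute with
  \<open>h\<close>, so \<open>g\<close> and \<open>k\<close> give the same value.\<close>

lemma family_orbit:
  assumes p: "p \<in> P" and s: "s \<in> S" and g: "g \<in> carrier G" and v: "v \<in> carrier W"
  shows "family p (act g s) v = bact F g (\<alpha> s (p s (ract w (inv\<^bsub>G\<^esub> g) v)))"
proof -
  interpret group G by (rule group_G)
  have sX: "s \<in> X" using s S(1) by blast
  define x where "x = act g s"
  have x: "x \<in> X" using act_simps(1)[OF sX g] by (simp add: x_def)
  define k where "k = to_rep x"
  note R = rep_of[OF x]
  have k: "k \<in> carrier G" "inv\<^bsub>G\<^esub> k \<in> carrier G" using R by (simp_all add: k_def)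
  have rX: "rep_of x \<in> X" using R S(1) by blast
  have "act (inv\<^bsub>G\<^esub> k) x = rep_of x"
    using act_simps(2)[OF rX k(1)] R(3) by (simp add: k_def)
  then have hs: "act (inv\<^bsub>G\<^esub> k \<otimes>\<^bsub>G\<^esub> g) s = rep_of x"
    using group_actionD(4)[OF act sX k(2) g] by (simp add: x_def)
  define h where "h = inv\<^bsub>G\<^esub> k \<otimes>\<^bsub>G\<^esub> g"
  have h: "h \<in> carrier G" using k g by (simp add: h_def)
  \<comment> \<open>The set \<open>S\<close> meets an orbit only once, so the representative chosen
    for \<open>x\<close> must be \<open>s\<close>.\<close>
  have "s = rep_of x" using representative_unique[OF s R(1) h] hs by (simp add: h_def)
  then have rs: "rep_of x = s" by simp
  have hst: "h \<in> stabilizer G act s" using h hs rs by (simp add: stabilizer_def h_def)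
  have gkh: "g = k \<otimes>\<^bsub>G\<^esub> h" using k g by (simp add: h_def m_assoc[symmetric])
  define v' where "v' = ract w (inv\<^bsub>G\<^esub> g) v"
  have v': "v' \<in> carrier W" using wact_simps(1)[OF v] g by (simp add: v'_def)
  have "inv\<^bsub>G\<^esub> k = h \<otimes>\<^bsub>G\<^esub> inv\<^bsub>G\<^esub> g" using k g by (simp add: h_def m_assoc)
  then have "ract w (inv\<^bsub>G\<^esub> k) v = ract w h v'"
    using group_actionD(4)[OF wact v h] g by (simp add: v'_def)
  then have "\<alpha> s (p s (ract w (inv\<^bsub>G\<^esub> k) v)) = bact F h (\<alpha> s (p s v'))"
    using PD[OF p s] \<alpha>D[OF s] hst v' by simp
  then have "family p x v = bact F k (bact F h (\<alpha> s (p s v')))"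
    using v rs by (simp add: family_def k_def)
  also have "\<dots> = bact F g (\<alpha> s (p s v'))"
    using bact_mult[OF sX _ k(1) h] \<alpha>D[OF s] PD[OF p s] v' by (simp add: gkh)
  finally show ?thesis by (simp add: x_def v'_def)
qed

lemma family_rep:
  assumes "p \<in> P" "s \<in> S" "v \<in> carrier W"
  shows "family p s v = \<alpha> s (p s v)"
proof -
  interpret group G by (rule group_G)
  have sX: "s \<in> X" using assms S(1) by blast
  have "\<alpha> s (p s v) \<in> topspace (btop F)"
    using carrier_bfib[OF vb sX] \<alpha>D(2)[OF assms(2)] PD(2)[OF assms(1,2)] assms(3) by blast
  then show ?thesis
    using family_orbit[OF assms(1,2) one_closed assms(3)] group_actionD(5)[OF act sX]
      group_actionD(5)[OF wact assms(3)] group_actionD(5)[OF bact] by simp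
qed

lemma family_in_families:
  assumes p: "p \<in> P"
  shows "family p \<in> families"
  unfolding families_def
proof (intro CollectI conjI ballI)
  interpret group G by (rule group_G)
  fix x assume x: "x \<in> X"
  note R = rep_of[OF x]
  have rX: "rep_of x \<in> X" using R S(1) by blast
  let ?k = "to_rep x" and ?s = "rep_of x"
  have ki: "inv\<^bsub>G\<^esub> ?k \<in> carrier G" using R by simp
  have 1: "(\<lambda>v\<in>carrier W. ract w (inv\<^bsub>G\<^esub> ?k) v) \<in> lin_isos W W"
    by (rule restrict_in_lin_isos[OF fw wlin[OF ki], where R = "ract w ?k"])
      (use wact_simps R in auto)
  have 2: "(\<lambda>u\<in>carrier (bfib F ?s). bact F ?k u) \<in> lin_isos (bfib F ?s) (bfib F (act ?k ?s))"
  proof (rule restrict_in_lin_isos[OF fb[OF rX] bact_lin[OF R(2) rX], where R = "bact F (inv\<^bsub>G\<^esub> ?k)"])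
    fix u assume u: "u \<in> carrier (bfib F (act ?k ?s))"
    show "bact F ?k (bact F (inv\<^bsub>G\<^esub> ?k) u) = u"
      using bact_simps(3)[OF act_simps(1)[OF rX R(2)] u R(2)] .
    show "bact F (inv\<^bsub>G\<^esub> ?k) u \<in> carrier (bfib F ?s)"
      using bact_simps(1)[OF act_simps(1)[OF rX R(2)] u ki] act_simps(2)[OF rX R(2)] by simp
  qed (rule bact_simps(2)[OF rX _ R(2)])
  note 3 = compose_lin_isos[OF fw compose_lin_isos[OF fw 1 PD(1)[OF p R(1)]]
      compose_lin_isos[OF fw \<alpha>D(1)[OF R(1)] 2]]
  have "(\<lambda>u\<in>carrier W. (\<lambda>u\<in>carrier W. (\<lambda>u\<in>carrier (bfib F ?s). bact F ?k u) (\<alpha> ?s u))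
      ((\<lambda>u\<in>carrier W. p ?s ((\<lambda>v\<in>carrier W. ract w (inv\<^bsub>G\<^esub> ?k) v) u)) u)) = family p x"
    unfolding family_def
    using wact_simps(1)[OF _ ki] PD(2)[OF p R(1)] \<alpha>D(2)[OF R(1)] by (intro restrict_ext) simp
  then show "family p x \<in> lin_isos W (bfib F x)" using 3 R(3) by simp
next
  interpret group G by (rule group_G)
  fix g x v assume g: "g \<in> carrier G" and x: "x \<in> X" and v: "v \<in> carrier W"
  obtain s k where s: "s \<in> S" and k: "k \<in> carrier G" and xs: "x = act k s"
    using representative[OF x] .
  have sX: "s \<in> X" using s S(1) by blast
  define u where "u = \<alpha> s (p s (ract w (inv\<^bsub>G\<^esub> k) v))"
  have u: "u \<in> carrier (bfib F s)"
    using \<alpha>D(2)[OF s] PD(2)[OF p s] wact_simps(1)[OF v] k by (simp add: u_def)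
  have "inv\<^bsub>G\<^esub> (g \<otimes>\<^bsub>G\<^esub> k) = inv\<^bsub>G\<^esub> k \<otimes>\<^bsub>G\<^esub> inv\<^bsub>G\<^esub> g" using g k by (simp add: inv_mult_group)
  then have "ract w (inv\<^bsub>G\<^esub> (g \<otimes>\<^bsub>G\<^esub> k)) (ract w g v) = ract w (inv\<^bsub>G\<^esub> k) v"
    using group_actionD(4)[OF wact wact_simps(1)[OF v g]] wact_simps(2)[OF v g] g k by simp
  moreover have "act g x = act (g \<otimes>\<^bsub>G\<^esub> k) s" using group_actionD(4)[OF act sX g k] by (simp add: xs)
  ultimately have "family p (act g x) (ract w g v) = bact F (g \<otimes>\<^bsub>G\<^esub> k) u"
    using family_orbit[OF p s m_closed[OF g k] wact_simps(1)[OF v g]] by (simp add: u_def)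
  also have "\<dots> = bact F g (bact F k u)" by (rule bact_mult[OF sX u g k])
  also have "bact F k u = family p x v"
    using family_orbit[OF p s k v] by (simp add: xs u_def)
  finally show "family p (act g x) (ract w g v) = bact F g (family p x v)" .
qed

definition param :: "('x \<Rightarrow> 'w \<Rightarrow> 'f) \<Rightarrow> 'x \<Rightarrow> 'w \<Rightarrow> 'w" where
  "param \<phi> = (\<lambda>s\<in>S. \<lambda>v\<in>carrier W. inv_into (carrier W) (\<alpha> s) (\<phi> s v))"

text \<open>An element \<open>h\<close> of the stabilizer maps the fiber over \<open>s\<close> to
  itself, so equivariance of \<open>\<phi>\<close> there is commutation with \<open>h\<close>; this
  puts the parameter into the product. Values over the rest of the orbit are forced by equivariance,
  whence the family is recovered.\<close>

lemma param:
  assumes \<phi>: "\<phi> \<in> families"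
  shows "param \<phi> \<in> P" and "\<And>x. x \<in> X \<Longrightarrow> family (param \<phi>) x = \<phi> x"
proof -
  interpret group G by (rule group_G)
  note D = familiesD[OF \<phi>]
  have inv: "\<alpha> s (inv_into (carrier W) (\<alpha> s) (\<phi> s v)) = \<phi> s v"
    "inv_into (carrier W) (\<alpha> s) (\<phi> s v) \<in> carrier W" if "s \<in> S" "v \<in> carrier W" for s v
    using lin_isosD(6,7)[OF \<alpha>D(1)[OF that(1)]] D(2) that S(1) by auto
  have "param \<phi> s \<in> rep_isos (stabilizer G act s) w w" if s: "s \<in> S" for s
  proof -
    have sX: "s \<in> X" using s S(1) by blast
    have "(\<lambda>v\<in>carrier W. restrict (inv_into (carrier W) (\<alpha> s)) (carrier (bfib F s)) (\<phi> s v)) \<in> lin_isos W W"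
      by (rule compose_lin_isos[OF fw D(1)[OF sX] inv_into_lin_isos[OF fw \<alpha>D(1)[OF s]]])
    moreover have "(\<lambda>v\<in>carrier W. restrict (inv_into (carrier W) (\<alpha> s)) (carrier (bfib F s)) (\<phi> s v)) = param \<phi> s"
      using s D(2)[OF sX] by (simp add: param_def cong: restrict_cong)
    ultimately have iso: "param \<phi> s \<in> lin_isos W W" by simp
    have "param \<phi> s (ract w h v) = ract w h (param \<phi> s v)"
      if h: "h \<in> stabilizer G act s" and v: "v \<in> carrier W" for h v
    proof -
      have hG: "h \<in> carrier G" "act h s = s" using h by (auto simp: stabilizer_def)
      have hv: "ract w h v \<in> carrier W" using wact_simps(1)[OF v hG(1)] .
      let ?v = "inv_into (carrier W) (\<alpha> s) (\<phi> s v)"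
      have "\<phi> s (ract w h v) = bact F h (\<phi> s v)" using D(6)[OF sX hG(1) v] hG(2) by simp
      also have "\<dots> = \<alpha> s (ract w h ?v)" using \<alpha>D(3)[OF s h inv(2)[OF s v]] inv(1)[OF s v] by simp
      finally have "inv_into (carrier W) (\<alpha> s) (\<phi> s (ract w h v)) = ract w h ?v"
        using lin_isosD(5)[OF \<alpha>D(1)[OF s] wact_simps(1)[OF inv(2)[OF s v] hG(1)]] by simp
      then show ?thesis using s v hv by (simp add: param_def)
    qed
    then show ?thesis using iso by (simp add: rep_isos_def)
  qed
  then show p: "param \<phi> \<in> P" by (auto simp: PiE_iff param_def)
  fix x assume x: "x \<in> X"
  show "family (param \<phi>) x = \<phi> x"
  proof (rule extensionalityI[where A = "carrier W"])
    fix v assume v: "v \<in> carrier W"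
    obtain s k where s: "s \<in> S" and k: "k \<in> carrier G" and xs: "x = act k s"
      using representative[OF x] .
    have sX: "s \<in> X" using s S(1) by blast
    have kv: "ract w (inv\<^bsub>G\<^esub> k) v \<in> carrier W" using wact_simps(1)[OF v] k by simp
    have "family (param \<phi>) x v = bact F k (\<phi> s (ract w (inv\<^bsub>G\<^esub> k) v))"
      using family_orbit[OF p s k v] inv(1)[OF s kv] s kv by (simp add: xs param_def)
    also have "\<dots> = \<phi> x v" using D(6)[OF sX k kv] wact_simps(3)[OF v k] by (simp add: xs)
    finally show "family (param \<phi>) x v = \<phi> x v" .
  qed (use lin_isosD(3)[OF D(1)[OF x]] in \<open>auto simp: family_def\<close>)
qed

definition param_clutch :: "('x \<Rightarrow> 'w \<Rightarrow> 'w) \<Rightarrow> 'x \<times> 'x \<Rightarrow> 'f \<Rightarrow> 'f" where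
  "param_clutch p = clutch (family p)"

lemma param_clutch_image: "param_clutch ` P = Psi_class G X act F w"
proof (intro equalityI subsetI)
  fix \<psi> assume "\<psi> \<in> param_clutch ` P"
  then show "\<psi> \<in> Psi_class G X act F w"
    using clutch_in_Psi_class family_in_families by (auto simp: param_clutch_def)
next
  fix \<psi> assume "\<psi> \<in> Psi_class G X act F w"
  then obtain \<phi> where \<phi>: "\<phi> \<in> families" "clutch \<phi> = \<psi>" using Psi_class_imp_clutch by blast
  then have "param_clutch (param \<phi>) = \<psi>"
    using clutch_cong[of "family (param \<phi>)" \<phi>] param(2)[OF \<phi>(1)] by (simp add: param_clutch_def)
  then show "\<psi> \<in> param_clutch ` P" using param(1)[OF \<phi>(1)] by blast
qed

section \<open>Cosets of the diagonal are the fibers of the parametrization\<close>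

abbreviation coset where
  "coset p \<equiv> p <#\<^bsub>product_group S (\<lambda>s. iso_group (stabilizer G act s) w)\<^esub>
    diagonal S (carrier (iso_group (carrier G) w))"

text \<open>Multiplying \<open>p\<close> on the right by the diagonal element of \<open>h\<close>
  precomposes every member of \<open>family p\<close> with \<open>h\<close>, since \<open>h\<close>
  commutes with the action used to spread it over an orbit. Conversely, a relation between the
  families is read at \<open>s\<close> and \<open>\<alpha> s\<close> is cancelled.\<close>

lemma coset_eq_fibre:
  assumes p: "p \<in> P"
  shows "coset p = {q \<in> P. param_clutch q = param_clutch p}"
proof -
  have mem: "q \<in> coset p \<longleftrightarrow> (\<exists>h\<in>rep_isos (carrier G) w w. q = (\<lambda>s\<in>S. compose (carrier W) (p s) h))" for q
    by (auto simp: l_coset_def diagonal_def iso_group_def cong: restrict_cong)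
  have hD: "h v \<in> carrier W" "ract w g (h v) = h (ract w g v)"
    if "h \<in> rep_isos (carrier G) w w" "v \<in> carrier W" "g \<in> carrier G" for h v g
    using that lin_isosD(4)[of h W W] by (auto simp: rep_isos_def)
  show ?thesis
  proof (intro equalityI subsetI)
    fix q assume "q \<in> coset p"
    then obtain h where h: "h \<in> rep_isos (carrier G) w w"
      and q: "q = (\<lambda>s\<in>S. compose (carrier W) (p s) h)" using mem by blast
    have hiso: "h \<in> lin_isos W W" using h by (simp add: rep_isos_def)
    have qs: "q s v = p s (h v)" if "s \<in> S" "v \<in> carrier W" for s v
      using that by (simp add: q compose_eq)
    have "q s \<in> rep_isos (stabilizer G act s) w w" if s: "s \<in> S" for s
    proof -
      have "q s \<in> lin_isos W W"
        using compose_lin_isos[OF fw hiso PD(1)[OF p s]] s by (simp add: q compose_def)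
      moreover have "q s (ract w g v) = ract w g (q s v)"
        if g: "g \<in> stabilizer G act s" and v: "v \<in> carrier W" for g v
      proof -
        have gG: "g \<in> carrier G" using g by (simp add: stabilizer_def)
        then show ?thesis
          using qs[OF s] v wact_simps(1)[OF v gG] PD(3)[OF p s g] hD(1)[OF h v gG]
          by (simp flip: hD(2)[OF h v gG])
      qed
      ultimately show ?thesis by (simp add: rep_isos_def)
    qed
    then have qP: "q \<in> P" by (auto simp: PiE_iff q)
    have "family q x v = family p x (h v)" if x: "x \<in> X" and v: "v \<in> carrier W" for x v
    proof -
      obtain s k where s: "s \<in> S" and k: "k \<in> carrier G" and xs: "x = act k s"
        using representative[OF x] .
      note ki = inv_closed[OF k]
      show ?thesis
        using family_orbit[OF qP s k v] family_orbit[OF p s k hD(1)[OF h v k]] qs[OF s]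
          wact_simps(1)[OF v ki] hD(2)[OF h v ki] by (simp add: xs)
    qed
    then have "param_clutch p = param_clutch q"
      unfolding param_clutch_def clutch_eq_iff[OF family_in_families[OF p] family_in_families[OF qP]]
      using h by blast
    then show "q \<in> {q \<in> P. param_clutch q = param_clutch p}" using qP by simp
  next
    fix q assume "q \<in> {q \<in> P. param_clutch q = param_clutch p}"
    then have q: "q \<in> P" "param_clutch p = param_clutch q" by auto
    then obtain h where h: "h \<in> rep_isos (carrier G) w w"
      and eq: "\<And>x v. x \<in> X \<Longrightarrow> v \<in> carrier W \<Longrightarrow> family q x v = family p x (h v)"
      unfolding param_clutch_def clutch_eq_iff[OF family_in_families[OF p] family_in_families[OF q(1)]]
      by blast
    have hV: "h v \<in> carrier W" if "v \<in> carrier W" for v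
      using h that lin_isosD(4)[of h W W] by (simp add: rep_isos_def)
    have "q s v = p s (h v)" if s: "s \<in> S" and v: "v \<in> carrier W" for s v
    proof -
      have "\<alpha> s (q s v) = \<alpha> s (p s (h v))"
        using eq[of s v] s S(1) v family_rep[OF q(1) s v] family_rep[OF p s hV[OF v]] by auto
      then show ?thesis
        using lin_isosD(5)[OF \<alpha>D(1)[OF s]] PD(2)[OF q(1) s v] PD(2)[OF p s hV[OF v]] by metis
    qed
    then have "q s = compose (carrier W) (p s) h" if "s \<in> S" for s
      using that lin_isosD(3)[OF PD(1)[OF q(1) that]]
      by (intro extensionalityI[where A = "carrier W"]) (auto simp: compose_eq)
    then have "q = (\<lambda>s\<in>S. compose (carrier W) (p s) h)"
      using q(1) by (intro extensionalityI[where A = S]) (auto simp: PiE_def)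
    then show "q \<in> coset p" using mem h by blast
  qed
qed

section \<open>Continuity of the parametrization and its local sections\<close>

lemma continuous_map_family:
  assumes x: "x \<in> X" and v: "v \<in> carrier W"
  shows "continuous_map TP (fd_topology (bfib F x)) (\<lambda>p. family p x v)"
proof -
  note R = rep_of[OF x]
  let ?k = "to_rep x" and ?s = "rep_of x"
  have sX: "?s \<in> X" using R S(1) by blast
  let ?v = "ract w (inv\<^bsub>G\<^esub> ?k) v"
  have v': "?v \<in> carrier W" using wact_simps(1)[OF v inv_closed[OF R(2)]] .
  have "continuous_map TP TP (\<lambda>p. p)" using continuous_map_id by (simp add: id_def)
  then have "continuous_map TP (fd_topology W) (\<lambda>p. p ?s ?v)"
    using R(1) v' unfolding continuous_map_TP by blast
  moreover have "lin_map W (bfib F (act ?k ?s)) (\<lambda>u. bact F ?k (\<alpha> ?s u))"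
    by (rule lin_map_compose[OF lin_isosD(1)[OF \<alpha>D(1)[OF R(1)]] bact_lin[OF R(2) sX]])
  ultimately have "continuous_map TP (fd_topology (bfib F x)) (\<lambda>p. bact F ?k (\<alpha> ?s (p ?s ?v)))"
    using R(3) by (intro continuous_map_lin_map[OF fw fb[OF x]]) simp_all
  then show ?thesis using v by (simp add: family_def)
qed

text \<open>The members of \<open>family p\<close> depend on \<open>p\<close> through evaluations
  followed by fixed linear maps. Inversion is the one nonlinear operation and is covered by
  \<open>continuous_map_inverse_apply\<close>.\<close>

lemma continuous_map_param_clutch: "continuous_map TP TPsi param_clutch"
  unfolding continuous_map_TPsi
proof (intro conjI ballI)
  show "param_clutch \<in> topspace TP \<rightarrow> Psi_class G X act F w"
    unfolding topspace_TP using param_clutch_image by blast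
  fix x x' u assume x: "x \<in> X" "x' \<in> X" and u: "u \<in> carrier (bfib F x)"
  have fam: "family p \<in> families" if "p \<in> topspace TP" for p
    using that family_in_families unfolding topspace_TP by blast
  have inv: "continuous_map TP (fd_topology W) (\<lambda>p. inv_into (carrier W) (family p x) u)"
    by (rule continuous_map_inverse_apply[OF fw fb[OF x(1)] familiesD(1)[OF fam x(1)]
          continuous_map_family[OF x(1)] u])
  have "continuous_map TP (fd_topology (bfib F x')) (\<lambda>p. family p x' (inv_into (carrier W) (family p x) u))"
    by (rule continuous_map_apply[OF fw fb[OF x(2)] lin_isosD(1)[OF familiesD(1)[OF fam x(2)]]
          continuous_map_family[OF x(2)] inv])
  then show "continuous_map TP (fd_topology (bfib F x')) (\<lambda>p. param_clutch p (x, x') u)"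
    by (simp add: param_clutch_def clutch_apply x u)
qed

text \<open>The map \<open>u \<mapsto> \<psi> (act g x0, x0) (bact F g u)\<close> is the action of
  \<open>g\<close> on the quotient by \<open>\<psi>\<close>, read in the fiber over
  \<open>x0\<close>. So \<open>eqv\<close> says that \<open>T\<close> is an intertwiner into that
  quotient, and \<open>\<psi>\<close> transports it to all other fibers.\<close>

lemma intertwiner_families:
  assumes \<psi>: "\<psi> \<in> Psi G X act F" and x0: "x0 \<in> X"
    and T: "T \<in> lin_isos W (bfib F x0)"
    and eqv: "\<And>g v. g \<in> carrier G \<Longrightarrow> v \<in> carrier W \<Longrightarrow>
      T (ract w g v) = \<psi> (act g x0, x0) (bact F g (T v))"
  defines "\<phi> \<equiv> \<lambda>x. \<lambda>v\<in>carrier W. \<psi> (x0, x) (T v)"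
  shows "\<phi> \<in> families" "clutch \<phi> = \<psi>"
proof -
  note P = PsiD[OF \<psi>] and C = clutching_mapsD[OF PsiD(1)[OF \<psi>]]
  have Tv: "T v \<in> carrier (bfib F x0)" if "v \<in> carrier W" for v using lin_isosD(4)[OF T that] .
  show fam: "\<phi> \<in> families"
    unfolding families_def
  proof (intro CollectI conjI ballI)
    show "\<phi> x \<in> lin_isos W (bfib F x)" if "x \<in> X" for x
      unfolding \<phi>_def by (rule compose_lin_isos[OF fw T P(2)[OF x0 that]])
    fix g x v assume g: "g \<in> carrier G" and x: "x \<in> X" and v: "v \<in> carrier W"
    note gx0 = act_simps(1)[OF x0 g] and gx = act_simps(1)[OF x g]
    have "\<phi> (act g x) (ract w g v) = \<psi> (x0, act g x) (\<psi> (act g x0, x0) (bact F g (T v)))"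
      using wact_simps(1)[OF v g] eqv[OF g v] by (simp add: \<phi>_def)
    also have "\<dots> = \<psi> (act g x0, act g x) (bact F g (T v))"
      using C(5)[OF gx0 x0 gx bact_simps(1)[OF x0 Tv[OF v] g]] .
    also have "\<dots> = bact F g (\<psi> (x0, x) (T v))" using P(4)[OF g x0 x Tv[OF v]] .
    finally show "\<phi> (act g x) (ract w g v) = bact F g (\<phi> x v)" using v by (simp add: \<phi>_def)
  qed
  note D = familiesD[OF fam]
  have "clutch \<phi> (x, x') u = \<psi> (x, x') u"
    if x: "x \<in> X" "x' \<in> X" and u: "u \<in> carrier (bfib F x)" for x x' u
  proof -
    define v where "v = inv_into (carrier W) (\<phi> x) u"
    have v: "v \<in> carrier W" "\<phi> x v = u" using D x u by (auto simp: v_def)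
    have "clutch \<phi> (x, x') u = \<psi> (x0, x') (T v)"
      using v(1) by (simp add: clutch_apply x u \<phi>_def flip: v_def[unfolded \<phi>_def])
    also have "\<dots> = \<psi> (x, x') (\<psi> (x0, x) (T v))" using C(5)[OF x0 x Tv[OF v(1)]] by simp
    also have "\<psi> (x0, x) (T v) = u" using v by (simp add: \<phi>_def)
    finally show ?thesis .
  qed
  then show "clutch \<phi> = \<psi>" by (rule clutch_eqI[OF \<psi>])
qed

text \<open>The section turns a continuous choice of intertwiners into families and then into
  parameters. It can be made to pass through \<open>p0\<close> because the intertwiner at
  \<open>\<psi>0\<close> may be prescribed as the member over \<open>x0\<close> of
  \<open>family p0\<close>.\<close>

lemma param_clutch_local_section:
  assumes p0: "p0 \<in> P"
  shows "\<exists>U \<sigma>. openin TPsi U \<and> param_clutch p0 \<in> U \<and> continuous_map (subtopology TPsi U) TP \<sigma> \<and>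
    \<sigma> (param_clutch p0) = p0 \<and> (\<forall>\<psi>\<in>U. param_clutch (\<sigma> \<psi>) = \<psi>)"
proof -
  obtain x0 where x0: "x0 \<in> X" using X by blast
  let ?B = "bfib F x0"
  note fb0 = fb[OF x0]
  note fH = coordinates_hom_space[OF fw fb0]
  note E = coordinatesD[OF fb0]
  define \<psi>0 where "\<psi>0 = param_clutch p0"
  have \<psi>0: "\<psi>0 \<in> Psi_class G X act F w" using param_clutch_image p0 by (auto simp: \<psi>0_def)
  have Psi: "\<psi> \<in> Psi G X act F" if "\<psi> \<in> Psi_class G X act F w" for \<psi>
    using that by (simp add: Psi_class_def)
  \<comment> \<open>An arbitrary family for each \<open>\<psi>\<close>, with no continuity. It
    enters only through the maps \<open>h\<close>, which merely have to be linear and injective and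
    to preserve kernels.\<close>
  define fam where "fam \<psi> = (SOME \<phi>. \<phi> \<in> families \<and> clutch \<phi> = \<psi>)" for \<psi>
  have fam: "fam \<psi> \<in> families" "clutch (fam \<psi>) = \<psi>" if "\<psi> \<in> Psi_class G X act F w" for \<psi>
  proof -
    have "\<exists>\<phi>. \<phi> \<in> families \<and> clutch \<phi> = \<psi>" using Psi_class_imp_clutch[OF that] by metis
    then have "fam \<psi> \<in> families \<and> clutch (fam \<psi>) = \<psi>" unfolding fam_def by (rule someI_ex)
    then show "fam \<psi> \<in> families" "clutch (fam \<psi>) = \<psi>" by auto
  qed
  define \<phi>0 where "\<phi>0 = family p0"
  have \<phi>0: "\<phi>0 \<in> families" "clutch \<phi>0 = \<psi>0"
    using family_in_families[OF p0] by (auto simp: \<phi>0_def \<psi>0_def param_clutch_def)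
  note D0 = familiesD[OF \<phi>0(1)]
  \<comment> \<open>The intertwiners from \<open>w\<close> to \<open>F/\<psi>\<close>, transported to the fiber over \<open>x0\<close>, are the common zeros of
    the forms \<open>l g v j \<psi>\<close>.\<close>
  define l where "l g v j \<psi> T = fb x0 (T (ract w g v)) j - fb x0 (\<psi> (act g x0, x0) (bact F g (T v))) j"
    for g v j and \<psi> :: "'x \<times> 'x \<Rightarrow> 'f \<Rightarrow> 'f" and T :: "'w \<Rightarrow> 'f"
  define L where "L = {l g v j | g v j. g \<in> carrier G \<and> v \<in> carrier W \<and> j < nb x0}"
  have step: "lin_map ?B ?B (\<lambda>u. \<psi> (act g x0, x0) (bact F g u))"
    if "\<psi> \<in> Psi_class G X act F w" "g \<in> carrier G" for \<psi> g
    by (rule lin_map_compose[OF bact_lin[OF that(2) x0]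
          lin_isosD(1)[OF PsiD(2)[OF Psi[OF that(1)] act_simps(1)[OF x0 that(2)] x0]]])
  have HB: "T v \<in> carrier ?B" if "T \<in> carrier (hom_space W ?B)" "v \<in> carrier W" for T v
    using that by (auto simp: carrier_hom_space lin_map_def)
  have kernel: "(\<forall>l\<in>L. l \<psi> T = 0) \<longleftrightarrow> (\<forall>g\<in>carrier G. \<forall>v\<in>carrier W.
      T (ract w g v) = \<psi> (act g x0, x0) (bact F g (T v)))"
    if \<psi>: "\<psi> \<in> Psi_class G X act F w" and T: "T \<in> carrier (hom_space W ?B)" for \<psi> T
  proof -
    have "T (ract w g v) = \<psi> (act g x0, x0) (bact F g (T v))"
      if "\<forall>l\<in>L. l \<psi> T = 0" "g \<in> carrier G" "v \<in> carrier W" for g v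
    proof (rule coordinates_eqI[OF fb0])
      show "T (ract w g v) \<in> carrier ?B" using HB[OF T wact_simps(1)[OF that(3,2)]] .
      show "\<psi> (act g x0, x0) (bact F g (T v)) \<in> carrier ?B"
        using step[OF \<psi> that(2)] HB[OF T that(3)] by (auto simp: lin_map_def)
      fix j assume "j < nb x0"
      then have "l g v j \<in> L" using that by (auto simp: L_def)
      then have "l g v j \<psi> T = 0" using that(1) by blast
      then show "fb x0 (T (ract w g v)) j = fb x0 (\<psi> (act g x0, x0) (bact F g (T v))) j"
        by (simp add: l_def)
    qed
    then show ?thesis by (auto simp: L_def l_def)
  qed
  \<comment> \<open>Carries the kernel at \<open>\<psi>0\<close> into the kernel at \<open>\<psi>\<close>: both spaces of intertwiners are isomorphic
    to the endomorphisms of \<open>w\<close>, so the kernel has locally constant dimension.\<close>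
  define h where "h \<psi> T = (\<lambda>v\<in>carrier W. fam \<psi> x0 (inv_into (carrier W) (\<phi>0 x0) (T v)))"
    for \<psi> and T :: "'w \<Rightarrow> 'f"
  have ker0: "\<forall>l\<in>L. l \<psi>0 (\<phi>0 x0) = 0"
  proof -
    have "\<phi>0 x0 (ract w g v) = \<psi>0 (act g x0, x0) (bact F g (\<phi>0 x0 v))"
      if g: "g \<in> carrier G" and v: "v \<in> carrier W" for g v
    proof -
      note gx = act_simps(1)[OF x0 g] and gv = wact_simps(1)[OF v g]
      have "bact F g (\<phi>0 x0 v) = \<phi>0 (act g x0) (ract w g v)" using D0(6)[OF x0 g v] by simp
      then show ?thesis
        using D0(2,3)[OF gx gv] x0 gx by (simp add: clutch_apply flip: \<phi>0(2))
    qed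
    then show ?thesis
      using kernel[OF \<psi>0] lin_isos_subset_hom_space D0(1)[OF x0] by blast
  qed
  have cTPsi: "continuous_map TPsi (fd_topology (bfib F x')) (\<lambda>\<psi>. \<psi> (x, x') u)"
    if "x \<in> X" "x' \<in> X" "u \<in> carrier (bfib F x)" for x x' u
  proof -
    have "continuous_map TPsi TPsi (\<lambda>\<psi>. \<psi>)" using continuous_map_id by (simp add: id_def)
    then show ?thesis using that unfolding continuous_map_TPsi by blast
  qed
  \<comment> \<open>The unknown vector is itself a linear map, so the ambient space is
    \<open>hom_space W ?B\<close>; the prescribed kernel vector at \<open>\<psi>0\<close> is
    \<open>\<phi>0 x0\<close>.\<close>
  obtain U T where U: "openin TPsi U" "\<psi>0 \<in> U"
    and T: "continuous_map (subtopology TPsi U) (fd_topology (hom_space W ?B)) T" "T \<psi>0 = \<phi>0 x0"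
    and lT: "\<And>\<psi> l'. \<psi> \<in> U \<Longrightarrow> l' \<in> L \<Longrightarrow> l' \<psi> (T \<psi>) = 0"
  proof (rule kernel_local_section[OF fH, of \<psi>0 TPsi L h "\<phi>0 x0"], unfold topspace_TPsi)
    show "\<psi>0 \<in> Psi_class G X act F w" by (rule \<psi>0)
    fix \<psi> assume \<psi>: "\<psi> \<in> Psi_class G X act F w"
    note D = familiesD[OF fam(1)[OF \<psi>]]
    show "linear_form (hom_space W ?B) (l' \<psi>)" if l': "l' \<in> L" for l'
    proof -
      obtain g v j where gvj: "l' = l g v j" "g \<in> carrier G" "v \<in> carrier W" "j < nb x0"
        using l' by (auto simp: L_def)
      note gv = wact_simps(1)[OF gvj(3,2)]
      note 1 = E(11)[OF gvj(4)] and 2 = linear_form_lin_map[OF step[OF \<psi> gvj(2)] E(11)[OF gvj(4)]]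
      show ?thesis
        using 1 2 HB[OF _ gvj(3)] HB[OF _ gv] gvj(3) gv unfolding linear_form_def gvj(1) l_def
        by (simp add: hom_space_def algebra_simps)
    qed
    \<comment> \<open>The isomorphism from the quotient by \<open>\<psi>0\<close> to the quotient by
      \<open>\<psi>\<close>, both read in the fiber over \<open>x0\<close>; \<open>h \<psi>\<close>
      is composition with it.\<close>
    define R where "R u = fam \<psi> x0 (inv_into (carrier W) (\<phi>0 x0) u)" for u
    have R: "lin_map ?B ?B R"
      unfolding R_def
      by (rule lin_map_compose[OF lin_map_inverse[OF fw D0(1)[OF x0]] lin_isosD(1)[OF D(1)[OF x0]]])
    have hR: "h \<psi> S = (\<lambda>v\<in>carrier W. R (S v))" for S by (simp add: h_def R_def)
    have hH: "h \<psi> S \<in> carrier (hom_space W ?B)" if "S \<in> carrier (hom_space W ?B)" for S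
      using that lin_map_compose[of W ?B S ?B R] R
      by (simp add: hR carrier_hom_space lin_map_restrict[OF fw])
    show "lin_map (hom_space W ?B) (hom_space W ?B) (h \<psi>)"
      unfolding lin_map_def
    proof (intro conjI ballI allI)
      show "h \<psi> \<in> carrier (hom_space W ?B) \<rightarrow> carrier (hom_space W ?B)" using hH by blast
      fix S S' assume SS': "S \<in> carrier (hom_space W ?B)" "S' \<in> carrier (hom_space W ?B)"
      have "R (S v \<oplus>\<^bsub>?B\<^esub> S' v) = R (S v) \<oplus>\<^bsub>?B\<^esub> R (S' v)" if "v \<in> carrier W" for v
        using R HB[OF SS'(1) that] HB[OF SS'(2) that] by (simp add: lin_map_def)
      then show "h \<psi> (S \<oplus>\<^bsub>hom_space W ?B\<^esub> S') = h \<psi> S \<oplus>\<^bsub>hom_space W ?B\<^esub> h \<psi> S'"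
        by (auto simp: hR hom_space_def)
    next
      fix c S assume S: "S \<in> carrier (hom_space W ?B)"
      have "R (c \<odot>\<^bsub>?B\<^esub> S v) = c \<odot>\<^bsub>?B\<^esub> R (S v)" if "v \<in> carrier W" for v
        using R HB[OF S that] by (simp add: lin_map_def)
      then show "h \<psi> (c \<odot>\<^bsub>hom_space W ?B\<^esub> S) = c \<odot>\<^bsub>hom_space W ?B\<^esub> h \<psi> S"
        by (auto simp: hR hom_space_def)
    qed
    have R_inj: "u = u'" if "u \<in> carrier ?B" "u' \<in> carrier ?B" "R u = R u'" for u u'
      using that D(3)[OF x0 D0(4)[OF x0]] D0(5)[OF x0] unfolding R_def by metis
    show "inj_on (h \<psi>) (carrier (hom_space W ?B))"
    proof (rule inj_onI)
      fix S S' assume SS': "S \<in> carrier (hom_space W ?B)" "S' \<in> carrier (hom_space W ?B)"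
        and eq: "h \<psi> S = h \<psi> S'"
      show "S = S'"
      proof (rule extensionalityI[where A = "carrier W"])
        fix v assume v: "v \<in> carrier W"
        have "R (S v) = R (S' v)" using fun_cong[OF eq, of v] v by (simp add: hR)
        then show "S v = S' v" using R_inj HB SS' v by blast
      qed (use SS' in \<open>simp_all add: carrier_hom_space\<close>)
    qed
    show "l' \<psi> (h \<psi> S) = 0" if "S \<in> carrier (hom_space W ?B)" "\<forall>l'\<in>L. l' \<psi>0 S = 0" "l' \<in> L" for S l'
    proof -
      have "h \<psi> S (ract w g v) = \<psi> (act g x0, x0) (bact F g (h \<psi> S v))"
        if g: "g \<in> carrier G" and v: "v \<in> carrier W" for g v
      proof -
        note gx = act_simps(1)[OF x0 g] and gv = wact_simps(1)[OF v g]
        \<comment> \<open>Through \<open>\<phi>0 x0\<close> the intertwiner \<open>S\<close> becomes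
          an endomorphism of \<open>w\<close>, with value \<open>t\<close> at \<open>v\<close>;
          \<open>h \<psi>\<close> reads the same endomorphism through the family chosen for
          \<open>\<psi>\<close>.\<close>
        define t where "t = inv_into (carrier W) (\<phi>0 x0) (S v)"
        have t: "t \<in> carrier W" "S v = \<phi>0 x0 t"
          using D0(4,5)[OF x0] HB[OF \<open>S \<in> _\<close> v] by (simp_all add: t_def)
        note gt = wact_simps(1)[OF t(1) g]
        have "S (ract w g v) = \<psi>0 (act g x0, x0) (bact F g (S v))"
          using kernel[OF \<psi>0 \<open>S \<in> _\<close>] \<open>\<forall>l'\<in>L. l' \<psi>0 S = 0\<close> g v by blast
        also have "bact F g (S v) = \<phi>0 (act g x0) (ract w g t)"
          using D0(6)[OF x0 g t(1)] t(2) by simp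
        also have "\<psi>0 (act g x0, x0) \<dots> = \<phi>0 x0 (ract w g t)"
          using D0(2,3)[OF gx gt] x0 gx by (simp add: clutch_apply flip: \<phi>0(2))
        finally have "h \<psi> S (ract w g v) = fam \<psi> x0 (ract w g t)"
          using gv D0(3)[OF x0 gt] by (simp add: h_def)
        also have "\<dots> = \<psi> (act g x0, x0) (fam \<psi> (act g x0) (ract w g t))"
          using clutch_apply[OF gx x0 D(2)[OF gx gt], of "fam \<psi>"] D(3)[OF gx gt] fam(2)[OF \<psi>] by simp
        also have "fam \<psi> (act g x0) (ract w g t) = bact F g (h \<psi> S v)"
          using D(6)[OF x0 g t(1)] v by (simp add: h_def t_def)
        finally show ?thesis .
      qed
      then show ?thesis using kernel[OF \<psi> hH[OF that(1)]] that(3) by blast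
    qed
  next
    show "continuous_map TPsi euclidean (\<lambda>\<psi>. l' \<psi> S)"
      if l': "l' \<in> L" and S: "S \<in> carrier (hom_space W ?B)" for l' S
    proof -
      obtain g v j where gvj: "l' = l g v j" "g \<in> carrier G" "v \<in> carrier W" "j < nb x0"
        using l' by (auto simp: L_def)
      have "continuous_map TPsi euclidean (\<lambda>\<psi>. fb x0 (\<psi> (act g x0, x0) (bact F g (S v))) j)"
        using cTPsi[OF act_simps(1)[OF x0 gvj(2)] x0 bact_simps(1)[OF x0 HB[OF S gvj(3)] gvj(2)]] gvj(4)
        unfolding continuous_map_fd_topology[OF fb0] by blast
      then show ?thesis
        unfolding gvj(1) l_def by (intro continuous_map_diff) simp_all
    qed
    show "\<phi>0 x0 \<in> carrier (hom_space W ?B)" using lin_isos_subset_hom_space D0(1)[OF x0] by blast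
    show "\<forall>l\<in>L. l \<psi>0 (\<phi>0 x0) = 0" by (rule ker0)
  qed blast
  have UZ: "U \<subseteq> Psi_class G X act F w" using openin_subset[OF U(1)] unfolding topspace_TPsi .
  have topU: "topspace (subtopology TPsi U) = U" using UZ topspace_TPsi by auto
  have TH: "T \<psi> \<in> carrier (hom_space W ?B)" if "\<psi> \<in> U" for \<psi>
    using continuous_map_funspace[OF T(1)] that unfolding topU by auto
  have Tlin: "lin_map W ?B (T \<psi>)" if "\<psi> \<in> U" for \<psi>
    using TH[OF that] by (simp add: carrier_hom_space)
  have Tv: "continuous_map (subtopology TPsi U) (fd_topology ?B) (\<lambda>\<psi>. T \<psi> v)" if "v \<in> carrier W" for v
    using T(1) that unfolding continuous_map_hom_space[OF fw fb0] by blast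
  have inj0: "inj_on (T \<psi>0) (carrier W)" using lin_isosD(8)[OF D0(1)[OF x0]] T(2) by simp
  \<comment> \<open>Near \<open>\<psi>0\<close> the kernel lemma provides intertwiners but says
    nothing about invertibility. At \<open>\<psi>0\<close> the map is injective, and injectivity
    persists after shrinking; equality of dimensions then gives bijectivity.\<close>
  obtain U' where U': "openin (subtopology TPsi U) U'" "\<psi>0 \<in> U'"
    and inj: "\<And>\<psi>. \<psi> \<in> U' \<Longrightarrow> inj_on (T \<psi>) (carrier W)"
    by (rule locally_injective[OF fw fb0, of \<psi>0 "subtopology TPsi U" T])
      (use Tlin Tv inj0 U(2) topU in auto)
  have U'U: "U' \<subseteq> U" using openin_subset[OF U'(1)] topU by blast
  have oU': "openin TPsi U'" using U'(1) U(1) openin_trans_full by blast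
  have topU': "topspace (subtopology TPsi U') = U'" using U'U UZ topspace_TPsi by auto
  define \<theta> where "\<theta> \<psi> = (\<lambda>x. \<lambda>v\<in>carrier W. \<psi> (x0, x) (T \<psi> v))" for \<psi> :: "'x \<times> 'x \<Rightarrow> 'f \<Rightarrow> 'f"
  have \<theta>: "\<theta> \<psi> \<in> families" "clutch (\<theta> \<psi>) = \<psi>" if \<psi>: "\<psi> \<in> U'" for \<psi>
  proof -
    have \<psi>U: "\<psi> \<in> U" and \<psi>c: "\<psi> \<in> Psi_class G X act F w" using \<psi> U'U UZ by auto
    have "T \<psi> \<in> lin_isos W ?B"
      using lin_map_inj_imp_bij[OF fw D0(1)[OF x0] Tlin[OF \<psi>U] inj[OF \<psi>]] TH[OF \<psi>U]
      by (simp add: lin_isos_def carrier_hom_space)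
    moreover have "T \<psi> (ract w g v) = \<psi> (act g x0, x0) (bact F g (T \<psi> v))"
      if "g \<in> carrier G" "v \<in> carrier W" for g v
      using kernel[OF \<psi>c TH[OF \<psi>U]] lT[OF \<psi>U] that by blast
    ultimately show "\<theta> \<psi> \<in> families" "clutch (\<theta> \<psi>) = \<psi>"
      unfolding \<theta>_def using intertwiner_families[OF Psi[OF \<psi>c] x0] by blast+
  qed
  define \<sigma> where "\<sigma> \<psi> = param (\<theta> \<psi>)" for \<psi>
  have "param_clutch (\<sigma> \<psi>) = \<psi>" if "\<psi> \<in> U'" for \<psi>
    using clutch_cong[of "family (param (\<theta> \<psi>))" "\<theta> \<psi>"] param(2)[OF \<theta>(1)[OF that]] \<theta>(2)[OF that]
    by (simp add: param_clutch_def \<sigma>_def)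
  \<comment> \<open>Transporting \<open>\<phi>0 x0\<close> along \<open>\<psi>0\<close>, the
    clutching map of \<open>\<phi>0\<close> itself, returns \<open>\<phi>0\<close>, whose parameter
    is \<open>p0\<close>.\<close>
  moreover have "\<sigma> \<psi>0 = p0"
  proof (rule extensionalityI[where A = S])
    fix s assume s: "s \<in> S"
    then have sX: "s \<in> X" using S(1) by blast
    have "inv_into (carrier W) (\<alpha> s) (\<theta> \<psi>0 s v) = p0 s v" if v: "v \<in> carrier W" for v
    proof -
      have "\<theta> \<psi>0 s v = \<psi>0 (x0, s) (\<phi>0 x0 v)" using v T(2) by (simp add: \<theta>_def)
      also have "\<dots> = \<phi>0 s v"
        using clutch_apply[OF x0 sX D0(2)[OF x0 v], of \<phi>0] D0(3)[OF x0 v] \<phi>0(2) by simp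
      also have "\<dots> = \<alpha> s (p0 s v)" using family_rep[OF p0 s v] by (simp add: \<phi>0_def)
      finally show ?thesis using lin_isosD(5)[OF \<alpha>D(1)[OF s] PD(2)[OF p0 s v]] by simp
    qed
    then have "\<sigma> \<psi>0 s = restrict (p0 s) (carrier W)"
      using s by (simp add: \<sigma>_def param_def cong: restrict_cong)
    then show "\<sigma> \<psi>0 s = p0 s"
      using lin_isosD(3)[OF PD(1)[OF p0 s]] by (simp add: extensional_restrict)
  qed (use p0 in \<open>auto simp: \<sigma>_def param_def PiE_def\<close>)
  moreover have "continuous_map (subtopology TPsi U') TP \<sigma>"
    unfolding continuous_map_TP topU'
  proof (intro conjI ballI)
    show "\<sigma> \<in> U' \<rightarrow> P" using param(1)[OF \<theta>(1)] unfolding \<sigma>_def by blast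
    fix s v assume s: "s \<in> S" and v: "v \<in> carrier W"
    have sX: "s \<in> X" using s S(1) by blast
    have psi_lin: "lin_map ?B (bfib F s) (\<psi> (x0, s))" if "\<psi> \<in> topspace (subtopology TPsi U')" for \<psi>
      using lin_isosD(1)[OF PsiD(2)[OF Psi x0 sX]] that U'U UZ topU' by blast
    have "continuous_map (subtopology TPsi U') (fd_topology (bfib F s)) (\<lambda>\<psi>. \<psi> (x0, s) (T \<psi> v))"
    proof (rule continuous_map_apply[where T = "\<lambda>\<psi>. \<psi> (x0, s)" and h = "\<lambda>\<psi>. T \<psi> v", OF fb0 fb[OF sX]])
      show "continuous_map (subtopology TPsi U') (fd_topology (bfib F s)) (\<lambda>\<psi>. \<psi> (x0, s) u)"
        if "u \<in> carrier ?B" for u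
        by (rule continuous_map_from_subtopology[OF cTPsi[OF x0 sX that]])
      show "continuous_map (subtopology TPsi U') (fd_topology ?B) (\<lambda>\<psi>. T \<psi> v)"
        by (rule continuous_map_from_subtopology_mono[OF Tv[OF v] U'U])
    qed (rule psi_lin)
    then have "continuous_map (subtopology TPsi U') (fd_topology W)
        (\<lambda>\<psi>. inv_into (carrier W) (\<alpha> s) (\<psi> (x0, s) (T \<psi> v)))"
      by (rule continuous_map_lin_map[OF fb[OF sX] fw lin_map_inverse[OF fw \<alpha>D(1)[OF s]]])
    then show "continuous_map (subtopology TPsi U') (fd_topology W) (\<lambda>\<psi>. \<sigma> \<psi> s v)"
      using s v by (simp add: \<sigma>_def param_def \<theta>_def)
  qed
  ultimately show ?thesis using oU' U'(2) unfolding \<psi>0_def by blast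
qed

lemma Psi_class_homeomorphic: "TPsi homeomorphic_space iso_quotient G act S w"
proof (rule quotient_maps_imp_homeomorphic_space)
  show "quotient_map TP TPsi param_clutch"
  proof (rule local_sections_imp_quotient_map[OF continuous_map_param_clutch])
    show "param_clutch ` topspace TP = topspace TPsi"
      unfolding topspace_TP topspace_TPsi by (rule param_clutch_image)
  qed (use param_clutch_local_section topspace_TP in blast)
  show "quotient_map TP (iso_quotient G act S w) coset"
    unfolding iso_quotient_def by (rule quotient_map_quotient_topology)
  fix p q assume "p \<in> topspace TP" "q \<in> topspace TP"
  then have "p \<in> P" "q \<in> P" by (simp_all only: topspace_TP)
  then show "param_clutch p = param_clutch q \<longleftrightarrow> coset p = coset q"
    \<comment> \<open>Each point lies in its own fiber, so equal fibers force equal clutching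
      maps.\<close>
    by (auto simp: coset_eq_fibre simp del: PiE_iff)
qed

end

section \<open>Choice of coordinates and of the stabilizer-equivariant isomorphisms, and
  conclusion\<close>

theorem theorem1p3:
  fixes G :: "('g, 'm) monoid_scheme" and TG :: "'g topology" and n :: nat and A :: "'g chart set"
    and X :: "'x set" and act :: "'g \<Rightarrow> 'x \<Rightarrow> 'x" and F :: "('g, 'x, 'f) vbundle"
    and S :: "'x set" and w :: "('g, 'w) rep"
  assumes "compact_lie_group G TG n A"
    and "finite X" and "X \<noteq> {}"
    and "continuous_action G TG (discrete_topology X) act"
    and "equivariant_vector_bundle G TG (discrete_topology X) act F"
    and "S \<subseteq> X" and "\<forall>C\<in>orbits G X act. \<exists>!s. s \<in> S \<inter> C"
    and "representation_extension G TG X act F w"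
  shows "subtopology (Psi_topology G X act F) (Psi_class G X act F w)
           homeomorphic_space iso_quotient G act S w"
proof -
  have rep: "representation G TG w"
    and ext: "\<And>x. x \<in> X \<Longrightarrow> \<exists>f. f \<in> rep_isos (stabilizer G act x) w (fiber_rep F x)"
    using assms(8) unfolding representation_extension_def by blast+
  obtain nw fw where fw: "coordinates (rspace w) nw fw"
    using rep fd_space_coordinates unfolding representation_def by blast
  have "\<exists>m f. coordinates (bfib F x) m f" if "x \<in> X" for x
    using assms(5) that fd_space_coordinates[of "bfib F x"]
    unfolding equivariant_vector_bundle_def vector_bundle_def by (metis topspace_discrete_topology)
  then obtain nb fb where fb: "\<And>x. x \<in> X \<Longrightarrow> coordinates (bfib F x) (nb x) (fb x)" by metis
  obtain \<alpha> where \<alpha>: "\<And>x. x \<in> X \<Longrightarrow> \<alpha> x \<in> rep_isos (stabilizer G act x) w (fiber_rep F x)"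
    using ext by metis
  interpret bundle_extension G X act TG F w S \<alpha> nw fw nb fb
  proof (rule bundle_extension.intro)
    show "group_action G X act" using assms(4) by (simp add: continuous_action_def)
    show "group_action G (carrier (rspace w)) (ract w)"
      using rep by (simp add: representation_def continuous_action_def)
    show "\<And>g. g \<in> carrier G \<Longrightarrow> lin_map (rspace w) (rspace w) (ract w g)"
      using rep by (simp add: representation_def)
    show "\<And>s. s \<in> S \<Longrightarrow> \<alpha> s \<in> rep_isos (stabilizer G act s) w (fiber_rep F s)"
      using \<alpha> assms(6) by blast
  qed (use assms fw fb in auto)
  show ?thesis by (rule Psi_class_homeomorphic)
qed

end
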